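(* Let $n\in\mathbb{N}$ and $\alpha>-1$. Then $\mathcal{R}^{(\alpha)}_{(n)}$ consists of all operators belonging to $\mathcal{B}(\mathcal{A}_{(n)}^2(\mathbb{D},\mu_\alpha))$ that are diagonal with respect to the orthonormal basis $(b^{(\alpha)}_{p,n-1})_{p=0}^\infty$ of $\mathcal{A}_{(n)}^2(\mathbb{D},\mu_\alpha)$. Furthermore, $$\mathcal{R}^{(\alpha)}_{(n)}\cong\ell^\infty(\mathbb{N}_0).$$
   Context: $\mathbb{N}=\{1,2,\dots\}$, $\mathbb{N}_0=\{0,1,2,\dots\}$, $\mathbb{D}$ is the open unit disk, $\mathbb{T}$ the unit circle, and $\mathrm{d}\mu_\alpha(z)=\frac{\alpha+1}{\pi}(1-|z|^2)^\alpha\,\mathrm{d}\mu(z)$ on $\mathbb{D}$, where $\mu$ is Lebesgue plane measure. A function $f$ is $n$-analytic if it is smooth and $(\partial/\partial\overline{z})^n f=0$. $\mathcal{A}_n^2(\mathbb{D},\mu_\alpha)$ is the Hilbert space of $n$-analytic functions on $\mathbb{D}$ square-integrable with respect to $\mu_\alpha$, with the inner product of $L^2(\mathbb{D},\mu_\alpha)$ (and $\mathcal{A}_0^2=\{0\}$). $\mathcal{A}_{(n)}^2(\mathbb{D},\mu_\alpha)$ is the orthogonal complement of $\mathcal{A}_{n-1}^2(\mathbb{D},\mu_\alpha)$ in $\mathcal{A}_n^2(\mathbb{D},\mu_\alpha)$. It is invariant under the rotations $f\mapsto f(\tau^{-1}\,\cdot)$, $\tau\in\mathbb{T}$; denote by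 $\rho_{(n)}^{(\alpha)}(\tau)$ the rotation acting on it. $\mathcal{R}^{(\alpha)}_{(n)}$ is the von Neumann algebra of radial operators, i.e. of all $S\in\mathcal{B}(\mathcal{A}_{(n)}^2(\mathbb{D},\mu_\alpha))$ commuting with $\rho_{(n)}^{(\alpha)}(\tau)$ for every $\tau\in\mathbb{T}$. For $p,q\in\mathbb{N}_0$ the normalized disk polynomial is $$b^{(\alpha)}_{p,q}(z)=(-1)^{p+q}\,\widetilde{c}^{(\alpha)}_{p,q}\,(1-z\overline{z})^{-\alpha}\,\frac{\partial^q}{\partial z^q}\frac{\partial^p}{\partial\overline{z}^p}\Bigl((1-z\overline{z})^{p+q+\alpha}\Bigr),\qquad \widetilde{c}^{(\alpha)}_{p,q}=\sqrt{\frac{(\alpha+p+q+1)\Gamma(\alpha+p+1)\Gamma(\alpha+q+1)}{(\alpha+1)\,p!\,q!\,\Gamma(\alpha+p+q+1)^2}}.$$ $\cong$ denotes isometric isomorphism of W*-algebras. *)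

theory Defs
  imports "HOL-Analysis.Analysis" "HOL-Library.FuncSet"
begin

section \<open>Polyanalytic functions on the unit disk\<close>

text \<open>Derivatives are real Frechet derivatives of functions on the plane.\<close>

definition d_z :: "(complex \<Rightarrow> complex) \<Rightarrow> complex \<Rightarrow> complex" where
  "d_z f z = (frechet_derivative f (at z) 1 - \<i> * frechet_derivative f (at z) \<i>) / 2"

definition d_zbar :: "(complex \<Rightarrow> complex) \<Rightarrow> complex \<Rightarrow> complex" where
  "d_zbar f z = (frechet_derivative f (at z) 1 + \<i> * frechet_derivative f (at z) \<i>) / 2"

abbreviation disk :: "complex set" where
  "disk \<equiv> ball 0 1"

fun C_k_on :: "nat \<Rightarrow> complex set \<Rightarrow> (complex \<Rightarrow> complex) \<Rightarrow> bool" where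
  "C_k_on 0 U f \<longleftrightarrow> continuous_on U f"
| "C_k_on (Suc k) U f \<longleftrightarrow>
     (\<forall>z\<in>U. f differentiable (at z)) \<and>
     (\<forall>v. C_k_on k U (\<lambda>z. frechet_derivative f (at z) v))"

definition smooth_on :: "complex set \<Rightarrow> (complex \<Rightarrow> complex) \<Rightarrow> bool" where
  "smooth_on U f \<longleftrightarrow> (\<forall>k. C_k_on k U f)"

definition polyanalytic :: "nat \<Rightarrow> (complex \<Rightarrow> complex) \<Rightarrow> bool" where
  "polyanalytic n f \<longleftrightarrow> smooth_on disk f \<and> (\<forall>z\<in>disk. (d_zbar ^^ n) f z = 0)"

section \<open>Weighted Bergman spaces\<close>

definition mu :: "real \<Rightarrow> complex measure" where
  "mu \<alpha> = density (restrict_space lborel disk)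
     (\<lambda>z. ennreal ((\<alpha> + 1) / pi * (1 - (cmod z)\<^sup>2) powr \<alpha>))"

definition L2_inner :: "real \<Rightarrow> (complex \<Rightarrow> complex) \<Rightarrow> (complex \<Rightarrow> complex) \<Rightarrow> complex" where
  "L2_inner \<alpha> f g = (LINT z|mu \<alpha>. f z * cnj (g z))"

definition L2_norm :: "real \<Rightarrow> (complex \<Rightarrow> complex) \<Rightarrow> real" where
  "L2_norm \<alpha> f = sqrt (LINT z|mu \<alpha>. (cmod (f z))\<^sup>2)"

text \<open>
  A function on the disk is represented by its extension by zero to the plane, so that
  equality of elements is equality of functions. Smooth functions on the disk that agree
  almost everywhere are equal, hence passing to classes in \<open>L\<^sup>2\<close> identifies nothing.
\<close>

definition poly_Bergman :: "nat \<Rightarrow> real \<Rightarrow> (complex \<Rightarrow> complex) set" where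
  "poly_Bergman n \<alpha> = {f. polyanalytic n f
     \<and> f \<in> borel_measurable (mu \<alpha>) \<and> integrable (mu \<alpha>) (\<lambda>z. (cmod (f z))\<^sup>2)
     \<and> (\<forall>z. z \<notin> disk \<longrightarrow> f z = 0)}"

text \<open>Used for \<open>n \<ge> 1\<close> only; \<open>poly_Bergman 0 \<alpha>\<close> is the zero space.\<close>

definition true_poly_Bergman :: "nat \<Rightarrow> real \<Rightarrow> (complex \<Rightarrow> complex) set" where
  "true_poly_Bergman n \<alpha> =
     {f \<in> poly_Bergman n \<alpha>. \<forall>g \<in> poly_Bergman (n - 1) \<alpha>. L2_inner \<alpha> f g = 0}"

definition disk_poly_const :: "real \<Rightarrow> nat \<Rightarrow> nat \<Rightarrow> real" where
  "disk_poly_const \<alpha> p q =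
     sqrt ((\<alpha> + p + q + 1) * Gamma (\<alpha> + p + 1) * Gamma (\<alpha> + q + 1)
           / ((\<alpha> + 1) * fact p * fact q * (Gamma (\<alpha> + p + q + 1))\<^sup>2))"

text \<open>On the disk, \<open>1 - z * cnj z\<close> is the positive real \<open>1 - (cmod z)\<^sup>2\<close>.\<close>

definition disk_poly :: "real \<Rightarrow> nat \<Rightarrow> nat \<Rightarrow> complex \<Rightarrow> complex" where
  "disk_poly \<alpha> p q z =
     (if z \<in> disk then
        (-1) ^ (p + q) * of_real (disk_poly_const \<alpha> p q)
        * of_real ((1 - (cmod z)\<^sup>2) powr (- \<alpha>))
        * (d_z ^^ q) ((d_zbar ^^ p)
            (\<lambda>w. of_real ((1 - (cmod w)\<^sup>2) powr (real p + real q + \<alpha>)))) z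
      else 0)"

section \<open>Bounded operators on a subspace of the weighted \<open>L\<^sup>2\<close> space\<close>

text \<open>
  In this section \<open>H\<close> is a closed linear subspace of \<open>L\<^sup>2\<close> over \<open>mu \<alpha>\<close>, given as a set of
  functions as above. Operators on \<open>H\<close> are extensional, i.e. undefined off \<open>H\<close>.
\<close>

definition orthonormal_basis ::
  "real \<Rightarrow> (complex \<Rightarrow> complex) set \<Rightarrow> (nat \<Rightarrow> complex \<Rightarrow> complex) \<Rightarrow> bool" where
  "orthonormal_basis \<alpha> H e \<longleftrightarrow>
     (\<forall>p. e p \<in> H) \<and>
     (\<forall>p q. L2_inner \<alpha> (e p) (e q) = (if p = q then 1 else 0)) \<and>
     (\<forall>f\<in>H. \<forall>\<epsilon>>0. \<exists>N c. L2_norm \<alpha> (\<lambda>z. f z - (\<Sum>p<N. c p * e p z)) < \<epsilon>)"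

type_synonym oper = "(complex \<Rightarrow> complex) \<Rightarrow> (complex \<Rightarrow> complex)"

definition bounded_ops :: "real \<Rightarrow> (complex \<Rightarrow> complex) set \<Rightarrow> oper set" where
  "bounded_ops \<alpha> H = {S \<in> H \<rightarrow>\<^sub>E H.
     (\<forall>f\<in>H. \<forall>g\<in>H. S (\<lambda>z. f z + g z) = (\<lambda>z. S f z + S g z)) \<and>
     (\<forall>c. \<forall>f\<in>H. S (\<lambda>z. c * f z) = (\<lambda>z. c * S f z)) \<and>
     (\<exists>C. \<forall>f\<in>H. L2_norm \<alpha> (S f) \<le> C * L2_norm \<alpha> f)}"

definition op_norm :: "real \<Rightarrow> (complex \<Rightarrow> complex) set \<Rightarrow> oper \<Rightarrow> real" where
  "op_norm \<alpha> H S = (SUP f \<in> {f \<in> H. L2_norm \<alpha> f \<le> 1}. L2_norm \<alpha> (S f))"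

definition op_adjoint :: "real \<Rightarrow> (complex \<Rightarrow> complex) set \<Rightarrow> oper \<Rightarrow> oper" where
  "op_adjoint \<alpha> H S = (THE T. T \<in> bounded_ops \<alpha> H \<and>
     (\<forall>f\<in>H. \<forall>g\<in>H. L2_inner \<alpha> (S f) g = L2_inner \<alpha> f (T g)))"

definition diagonal_ops ::
  "real \<Rightarrow> (complex \<Rightarrow> complex) set \<Rightarrow> (nat \<Rightarrow> complex \<Rightarrow> complex) \<Rightarrow> oper set" where
  "diagonal_ops \<alpha> H e =
     {S \<in> bounded_ops \<alpha> H. \<forall>p. \<exists>c. S (e p) = (\<lambda>z. c * e p z)}"

section \<open>W*-algebras\<close>

record 'a wstar_algebra =
  wcarrier :: "'a set"
  wadd :: "'a \<Rightarrow> 'a \<Rightarrow> 'a"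
  wscale :: "complex \<Rightarrow> 'a \<Rightarrow> 'a"
  wmult :: "'a \<Rightarrow> 'a \<Rightarrow> 'a"
  wstar :: "'a \<Rightarrow> 'a"
  wnorm :: "'a \<Rightarrow> real"
  wtopology :: "'a topology"  \<comment> \<open>the weak-* topology given by the predual\<close>

definition wstar_isometric_iso ::
  "'a wstar_algebra \<Rightarrow> 'b wstar_algebra \<Rightarrow> ('a \<Rightarrow> 'b) \<Rightarrow> bool" where
  "wstar_isometric_iso A B \<Phi> \<longleftrightarrow>
     bij_betw \<Phi> (wcarrier A) (wcarrier B) \<and>
     (\<forall>x\<in>wcarrier A. \<forall>y\<in>wcarrier A. \<Phi> (wadd A x y) = wadd B (\<Phi> x) (\<Phi> y)) \<and>
     (\<forall>c. \<forall>x\<in>wcarrier A. \<Phi> (wscale A c x) = wscale B c (\<Phi> x)) \<and>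
     (\<forall>x\<in>wcarrier A. \<forall>y\<in>wcarrier A. \<Phi> (wmult A x y) = wmult B (\<Phi> x) (\<Phi> y)) \<and>
     (\<forall>x\<in>wcarrier A. \<Phi> (wstar A x) = wstar B (\<Phi> x)) \<and>
     (\<forall>x\<in>wcarrier A. wnorm B (\<Phi> x) = wnorm A x) \<and>
     homeomorphic_map (wtopology A) (wtopology B) \<Phi>"

definition wstar_isomorphic :: "'a wstar_algebra \<Rightarrow> 'b wstar_algebra \<Rightarrow> bool" where
  "wstar_isomorphic A B \<longleftrightarrow> (\<exists>\<Phi>. wstar_isometric_iso A B \<Phi>)"

text \<open>The coarsest topology on \<open>X\<close> making all functionals in \<open>F\<close> (nonempty) continuous.\<close>

definition initial_topology :: "'a set \<Rightarrow> ('a \<Rightarrow> complex) set \<Rightarrow> 'a topology" where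
  "initial_topology X F =
     topology_generated_by {{x \<in> X. \<phi> x \<in> U} | \<phi> U. \<phi> \<in> F \<and> open U}"

text \<open>
  The weak-* (ultraweak) topology of bounded operators is induced by the functionals
  \<open>S \<mapsto> (\<Sum>k. \<langle>S (f k), g k\<rangle>)\<close> with square-summable sequences \<open>f\<close> and \<open>g\<close> in \<open>H\<close>.
\<close>

definition ultraweak_functionals ::
  "real \<Rightarrow> (complex \<Rightarrow> complex) set \<Rightarrow> (oper \<Rightarrow> complex) set" where
  "ultraweak_functionals \<alpha> H =
     {\<lambda>S. (\<Sum>k. L2_inner \<alpha> (S (f k)) (g k)) | f g :: nat \<Rightarrow> complex \<Rightarrow> complex.
        range f \<subseteq> H \<and> range g \<subseteq> H \<and>
        summable (\<lambda>k. (L2_norm \<alpha> (f k))\<^sup>2) \<and> summable (\<lambda>k. (L2_norm \<alpha> (g k))\<^sup>2)}"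

text \<open>The von Neumann algebra on \<open>H\<close> whose set of elements is \<open>R\<close>.\<close>

definition operator_algebra ::
  "real \<Rightarrow> (complex \<Rightarrow> complex) set \<Rightarrow> oper set \<Rightarrow> oper wstar_algebra" where
  "operator_algebra \<alpha> H R =
     \<lparr>wcarrier = R,
      wadd = (\<lambda>S T. \<lambda>f\<in>H. \<lambda>z. S f z + T f z),
      wscale = (\<lambda>c S. \<lambda>f\<in>H. \<lambda>z. c * S f z),
      wmult = compose H,
      wstar = op_adjoint \<alpha> H,
      wnorm = op_norm \<alpha> H,
      wtopology = initial_topology R (ultraweak_functionals \<alpha> H)\<rparr>"

text \<open>\<open>\<ell>\<^sup>\<infinity>\<close> over the natural numbers (from 0); its predual is \<open>\<ell>\<^sup>1\<close>.\<close>

definition l_infinity :: "(nat \<Rightarrow> complex) wstar_algebra" where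
  "l_infinity =
     \<lparr>wcarrier = {x. bounded (range x)},
      wadd = (\<lambda>x y p. x p + y p),
      wscale = (\<lambda>c x p. c * x p),
      wmult = (\<lambda>x y p. x p * y p),
      wstar = (\<lambda>x p. cnj (x p)),
      wnorm = (\<lambda>x. SUP p. cmod (x p)),
      wtopology = initial_topology {x. bounded (range x)}
        {\<lambda>x. (\<Sum>p. a p * x p) | a. summable (\<lambda>p. cmod (a p))}\<rparr>"

section \<open>Radial operators\<close>

definition rotation :: "nat \<Rightarrow> real \<Rightarrow> complex \<Rightarrow> oper" where
  "rotation n \<alpha> \<tau> = (\<lambda>f\<in>true_poly_Bergman n \<alpha>. \<lambda>z. f (inverse \<tau> * z))"

definition radial_ops :: "nat \<Rightarrow> real \<Rightarrow> oper set" where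
  "radial_ops n \<alpha> = {S \<in> bounded_ops \<alpha> (true_poly_Bergman n \<alpha>).
     \<forall>\<tau>\<in>sphere 0 1. compose (true_poly_Bergman n \<alpha>) S (rotation n \<alpha> \<tau>)
                  = compose (true_poly_Bergman n \<alpha>) (rotation n \<alpha> \<tau>) S}"

end

theory Submission
  imports Defs "HOL-Complex_Analysis.Complex_Analysis" "HOL-Real_Asymp.Real_Asymp"
begin

text \<open>
  An \<open>n\<close>-analytic function on the disk is a polynomial of degree less than \<open>n\<close> in \<open>cnj z\<close> with
  holomorphic coefficients. Collecting its monomials according to their degree under rotations
  splits it into finite-dimensional parts, and in each degree the orthogonal complement of the
  \<open>(n - 1)\<close>-analytic monomials is spanned by one disk polynomial. The inner product of a disk
  polynomial with a monomial is a sum of Beta integrals over a common denominator, whose numerators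
  form an iterated finite difference of a polynomial, so it vanishes for small degree in \<open>cnj z\<close>.
  Hence every element of the true polyanalytic space is the pointwise sum of its expansion in disk
  polynomials; by Fatou's lemma the expansion converges in the mean. Conversely, every
  square-summable sequence arises, because the coefficients of the disk polynomials grow only
  polynomially with \<open>p\<close>. The space is thus a copy of the square-summable sequences on which the
  rotations act diagonally with pairwise distinct characters, so that commuting with the rotations
  means being diagonal. A diagonal operator is determined by its bounded sequence of eigenvalues,
  and on diagonal operators the ultraweak functionals are exactly the summable sequences.
\<close>

section \<open>Wirtinger calculus\<close>

text \<open>An \<open>n\<close>-analytic \<open>f\<close> can be square-integrable while its terms
  \<open>cnj z ^ k * h k z\<close> are not: in \<open>(1 - z * cnj z) * h z\<close> the first factor
  damps the growth of \<open>h\<close>. Inner products of \<open>f\<close> with monomials are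
  therefore computed over smaller disks, where the coefficient series converge uniformly, and only
  the whole function is passed to the limit. Elements of the space are genuine functions, and two
  pointwise statements stand in for completeness: each element is everywhere the sum of its
  expansion, and each square-summable sequence sums everywhere to an element. With Parseval's
  identity they turn statements about operators into statements about coordinates. The index
  \<open>p\<close> starts at 0 because an \<open>n\<close>-analytic monomial has at most the power
  \<open>n - 1\<close> of \<open>cnj z\<close>: its rotational degree is at least
  \<open>-(n - 1)\<close>, the degree of the disk polynomial with \<open>p = 0\<close>. Truncated
  exponents such as \<open>p + b - q\<close> are paired with coefficients that vanish when the
  subtraction is not exact.\<close>

definition has_wirtinger :: "(complex \<Rightarrow> complex) \<Rightarrow> complex \<Rightarrow> complex \<Rightarrow> complex \<Rightarrow> bool" where
  "has_wirtinger f a b z \<longleftrightarrow> (f has_derivative (\<lambda>h. a * h + b * cnj h)) (at z)"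

text \<open>Differentiation is local. Closed formulas for iterated derivatives hold on the disk
  only, and locality lets them replace the iterates under the next derivative.\<close>

lemma has_derivative_cong_open:
  assumes "open U" "z \<in> U" "\<And>w. w \<in> U \<Longrightarrow> f w = g w"
  shows "(f has_derivative f') (at z) \<longleftrightarrow> (g has_derivative f') (at z)"
  using has_derivative_transform_within_open[OF _ assms(1,2)] assms(3) by metis

lemma frechet_derivative_cong_open:
  assumes "open U" "z \<in> U" "\<And>w. w \<in> U \<Longrightarrow> f w = g w"
  shows "frechet_derivative f (at z) = frechet_derivative g (at z)"
  unfolding frechet_derivative_def using has_derivative_cong_open[OF assms] by presburger

lemma differentiable_cong_open:
  assumes "open U" "z \<in> U" "\<And>w. w \<in> U \<Longrightarrow> f w = g w"
  shows "f differentiable (at z) \<longleftrightarrow> g differentiable (at z)"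
  unfolding differentiable_def using has_derivative_cong_open[OF assms] by presburger

lemma has_wirtinger_frechet:
  assumes "has_wirtinger f a b z"
  shows "frechet_derivative f (at z) v = a * v + b * cnj v"
  using assms frechet_derivative_at unfolding has_wirtinger_def by metis

lemma has_wirtinger_differentiable: "has_wirtinger f a b z \<Longrightarrow> f differentiable (at z)"
  unfolding has_wirtinger_def differentiable_def by blast

lemma has_wirtinger_d_z: "has_wirtinger f a b z \<Longrightarrow> d_z f z = a"
  unfolding d_z_def by (simp add: has_wirtinger_frechet algebra_simps)

lemma has_wirtinger_d_zbar: "has_wirtinger f a b z \<Longrightarrow> d_zbar f z = b"
  unfolding d_zbar_def by (simp add: has_wirtinger_frechet algebra_simps)

text \<open>Real-linear maps of the plane are exactly the maps sending \<open>h\<close> to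
  \<open>a * h + b * cnj h\<close>. The operators \<open>d_z\<close> and \<open>d_zbar\<close> are
  total and obey the rules of calculus only where the function is differentiable;
  \<open>has_wirtinger\<close> carries differentiability and both values together, and this is the
  way into it.\<close>

lemma differentiable_has_wirtinger:
  assumes "f differentiable (at z)"
  shows "has_wirtinger f (d_z f z) (d_zbar f z) z"
proof -
  let ?D = "frechet_derivative f (at z)"
  have D: "(f has_derivative ?D) (at z)"
    using assms frechet_derivative_works by blast
  then have lin: "linear ?D"
    by (rule has_derivative_linear)
  have "?D h = d_z f z * h + d_zbar f z * cnj h" for h
  proof -
    have "?D h = ?D (Re h *\<^sub>R 1 + Im h *\<^sub>R \<i>)"
      by (rule arg_cong[of _ _ ?D]) (simp add: complex_eq_iff)
    also have "\<dots> = Re h *\<^sub>R ?D 1 + Im h *\<^sub>R ?D \<i>"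
      by (simp only: linear_add[OF lin] linear_cmul[OF lin])
    also have "\<dots> = d_z f z * h + d_zbar f z * cnj h"
      unfolding d_z_def d_zbar_def by (simp add: complex_eq_iff field_simps)
    finally show ?thesis .
  qed
  then have "?D = (\<lambda>h. d_z f z * h + d_zbar f z * cnj h)" by blast
  then show ?thesis
    using D unfolding has_wirtinger_def by metis
qed

lemma has_wirtinger_const: "has_wirtinger (\<lambda>w. c) 0 0 z"
  unfolding has_wirtinger_def by simp

lemma has_wirtinger_add:
  assumes "has_wirtinger f a b z" "has_wirtinger g c d z"
  shows "has_wirtinger (\<lambda>w. f w + g w) (a + c) (b + d) z"
  unfolding has_wirtinger_def
  by (rule has_derivative_eq_rhs[OF has_derivative_add[OF assms[unfolded has_wirtinger_def]]])
     (simp add: algebra_simps)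

lemma has_wirtinger_mult:
  assumes "has_wirtinger f a b z" "has_wirtinger g c d z"
  shows "has_wirtinger (\<lambda>w. f w * g w) (a * g z + f z * c) (b * g z + f z * d) z"
  unfolding has_wirtinger_def
  by (rule has_derivative_eq_rhs[OF has_derivative_mult[OF assms[unfolded has_wirtinger_def]]])
     (simp add: algebra_simps)

lemma has_wirtinger_cmult:
  assumes "has_wirtinger f a b z"
  shows "has_wirtinger (\<lambda>w. c * f w) (c * a) (c * b) z"
  using has_wirtinger_mult[OF has_wirtinger_const assms, of c] by simp

lemma has_wirtinger_sum:
  assumes "\<And>i. i \<in> I \<Longrightarrow> has_wirtinger (f i) (a i) (b i) z"
  shows "has_wirtinger (\<lambda>w. \<Sum>i\<in>I. f i w) (\<Sum>i\<in>I. a i) (\<Sum>i\<in>I. b i) z"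
  using assms
proof (induction I rule: infinite_finite_induct)
  case (insert x F)
  then show ?case by (simp add: has_wirtinger_add)
qed (simp_all add: has_wirtinger_const)

lemma has_wirtinger_holomorphic:
  assumes "(f has_field_derivative a) (at z)"
  shows "has_wirtinger f a 0 z"
  using assms unfolding has_wirtinger_def has_field_derivative_def by simp

lemma has_wirtinger_power:
  "has_wirtinger (\<lambda>w. w ^ m) (of_nat m * z ^ (m - 1)) 0 z"
  by (rule has_wirtinger_holomorphic) (auto intro!: derivative_eq_intros)

lemma has_wirtinger_cnj_power:
  "has_wirtinger (\<lambda>w. cnj w ^ m) 0 (of_nat m * cnj z ^ (m - 1)) z"
  unfolding has_wirtinger_def
  by (rule has_derivative_eq_rhs, (rule derivative_intros bounded_linear.has_derivative[OF bounded_linear_cnj])+)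
     (simp add: fun_eq_iff)

lemma d_zbar_cong:
  assumes "open U" "z \<in> U" "\<And>w. w \<in> U \<Longrightarrow> f w = g w"
  shows "d_zbar f z = d_zbar g z"
  unfolding d_zbar_def by (simp add: frechet_derivative_cong_open[OF assms])

lemma d_z_cong:
  assumes "open U" "z \<in> U" "\<And>w. w \<in> U \<Longrightarrow> f w = g w"
  shows "d_z f z = d_z g z"
  unfolding d_z_def by (simp add: frechet_derivative_cong_open[OF assms])

lemma d_zbar_funpow_cong:
  assumes "open U" "z \<in> U" "\<And>w. w \<in> U \<Longrightarrow> f w = g w"
  shows "(d_zbar ^^ m) f z = (d_zbar ^^ m) g z"
  using assms(2)
proof (induction m arbitrary: z)
  case (Suc m)
  then show ?case
    using d_zbar_cong[OF assms(1) Suc.prems, of "(d_zbar ^^ m) f" "(d_zbar ^^ m) g"] by simp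
qed (use assms in simp)

lemma d_z_funpow_cong:
  assumes "open U" "z \<in> U" "\<And>w. w \<in> U \<Longrightarrow> f w = g w"
  shows "(d_z ^^ m) f z = (d_z ^^ m) g z"
  using assms(2)
proof (induction m arbitrary: z)
  case (Suc m)
  then show ?case
    using d_z_cong[OF assms(1) Suc.prems, of "(d_z ^^ m) f" "(d_z ^^ m) g"] by simp
qed (use assms in simp)

section \<open>Smooth functions\<close>

lemma C_k_on_cong:
  assumes "open U" "\<And>w. w \<in> U \<Longrightarrow> f w = g w"
  shows "C_k_on k U f \<longleftrightarrow> C_k_on k U g"
  using assms(2)
proof (induction k arbitrary: f g)
  case 0
  then show ?case by (auto intro: continuous_on_cong)
next
  case (Suc k)
  have "C_k_on k U (\<lambda>z. frechet_derivative f (at z) v) \<longleftrightarrow>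
        C_k_on k U (\<lambda>z. frechet_derivative g (at z) v)" for v
    by (rule Suc.IH) (metis assms(1) frechet_derivative_cong_open Suc.prems)
  moreover have "(\<forall>z\<in>U. f differentiable (at z)) \<longleftrightarrow> (\<forall>z\<in>U. g differentiable (at z))"
    by (metis assms(1) differentiable_cong_open Suc.prems)
  ultimately show ?case by simp
qed

lemma C_k_on_Suc_imp: "open U \<Longrightarrow> C_k_on (Suc k) U f \<Longrightarrow> C_k_on k U f"
proof (induction k arbitrary: f)
  case 0
  then have "\<forall>z\<in>U. f differentiable (at z)" by simp
  then have "\<forall>z\<in>U. isCont f z"
    by (simp add: differentiable_imp_continuous_within)
  then show ?case
    by (simp add: continuous_at_imp_continuous_on)
next
  case (Suc k)
  then show ?case
    by (metis C_k_on.simps(2))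
qed

lemma C_k_on_const: "C_k_on k U (\<lambda>z. c)"
proof (induction k arbitrary: c)
  case (Suc k)
  then show ?case by simp
qed simp

lemma C_k_on_add:
  assumes "open U"
  shows "C_k_on k U f \<Longrightarrow> C_k_on k U g \<Longrightarrow> C_k_on k U (\<lambda>z. f z + g z)"
proof (induction k arbitrary: f g)
  case 0
  then show ?case by (simp add: continuous_on_add)
next
  case (Suc k)
  have "frechet_derivative (\<lambda>z. f z + g z) (at z) v =
      frechet_derivative f (at z) v + frechet_derivative g (at z) v" if "z \<in> U" for z v
  proof -
    have "(f has_derivative frechet_derivative f (at z)) (at z)"
         "(g has_derivative frechet_derivative g (at z)) (at z)"
      using Suc.prems that by (simp_all add: frechet_derivative_works)
    from has_derivative_add[OF this] show ?thesis
      by (metis frechet_derivative_at)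
  qed
  moreover have "C_k_on k U (\<lambda>z. frechet_derivative f (at z) v + frechet_derivative g (at z) v)" for v
    using Suc by simp
  ultimately have "C_k_on k U (\<lambda>z. frechet_derivative (\<lambda>z. f z + g z) (at z) v)" for v
    using C_k_on_cong[OF assms] by (metis (no_types, lifting))
  then show ?case
    using Suc.prems by simp
qed

lemma C_k_on_mult:
  assumes "open U"
  shows "C_k_on k U f \<Longrightarrow> C_k_on k U g \<Longrightarrow> C_k_on k U (\<lambda>z. f z * g z)"
proof (induction k arbitrary: f g)
  case 0
  then show ?case by (simp add: continuous_on_mult)
next
  case (Suc k)
  have eq: "frechet_derivative (\<lambda>z. f z * g z) (at z) v =
      f z * frechet_derivative g (at z) v + frechet_derivative f (at z) v * g z" if "z \<in> U" for z v
  proof -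
    have "(f has_derivative frechet_derivative f (at z)) (at z)"
         "(g has_derivative frechet_derivative g (at z)) (at z)"
      using Suc.prems that by (simp_all add: frechet_derivative_works)
    from has_derivative_mult[OF this] show ?thesis
      by (metis frechet_derivative_at)
  qed
  \<comment> \<open>The product rule mixes \<open>f\<close> and \<open>g\<close> with their
    derivatives, so the order of smoothness of \<open>f\<close> and \<open>g\<close> is lowered by
    one to meet the induction hypothesis.\<close>
  have "C_k_on k U (\<lambda>z. f z * frechet_derivative g (at z) v + frechet_derivative f (at z) v * g z)" for v
    using Suc.prems C_k_on_Suc_imp[OF assms]
    by (intro C_k_on_add[OF assms] Suc.IH) auto
  with eq have "C_k_on k U (\<lambda>z. frechet_derivative (\<lambda>z. f z * g z) (at z) v)" for v
    using C_k_on_cong[OF assms] by (metis (no_types, lifting))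
  then show ?case
    using Suc.prems by simp
qed

lemma C_k_on_holomorphic:
  assumes "open U"
  shows "f holomorphic_on U \<Longrightarrow> C_k_on k U f"
proof (induction k arbitrary: f)
  case 0
  then show ?case by (simp add: holomorphic_on_imp_continuous_on)
next
  case (Suc k)
  have w: "has_wirtinger f (deriv f z) 0 z" if "z \<in> U" for z
    using Suc.prems assms that by (intro has_wirtinger_holomorphic holomorphic_derivI)
  then have "frechet_derivative f (at z) v = deriv f z * v" if "z \<in> U" for z v
    using has_wirtinger_frechet that by fastforce
  moreover have "C_k_on k U (\<lambda>z. deriv f z * v)" for v
    using Suc assms by (intro C_k_on_mult C_k_on_const) (auto intro: holomorphic_deriv)
  ultimately have "C_k_on k U (\<lambda>z. frechet_derivative f (at z) v)" for v
    using C_k_on_cong[OF assms] by (metis (no_types, lifting))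
  then show ?case
    using has_wirtinger_differentiable[OF w] by simp
qed

lemma C_k_on_cnj: "C_k_on k U cnj"
proof (cases k)
  case (Suc m)
  have w: "has_wirtinger cnj 0 1 z" for z
    using has_wirtinger_cnj_power[of 1 z] by simp
  then have "frechet_derivative cnj (at z) v = cnj v" for z v
    using has_wirtinger_frechet by fastforce
  then show ?thesis
    using Suc has_wirtinger_differentiable[OF w] C_k_on_const by auto
qed (simp add: continuous_intros)

lemma smooth_on_cong:
  "open U \<Longrightarrow> (\<And>w. w \<in> U \<Longrightarrow> f w = g w) \<Longrightarrow> smooth_on U f \<longleftrightarrow> smooth_on U g"
  unfolding smooth_on_def using C_k_on_cong by blast

lemma smooth_on_const: "smooth_on U (\<lambda>z. c)"
  unfolding smooth_on_def using C_k_on_const by blast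

lemma smooth_on_add:
  "open U \<Longrightarrow> smooth_on U f \<Longrightarrow> smooth_on U g \<Longrightarrow> smooth_on U (\<lambda>z. f z + g z)"
  unfolding smooth_on_def using C_k_on_add by blast

lemma smooth_on_mult:
  "open U \<Longrightarrow> smooth_on U f \<Longrightarrow> smooth_on U g \<Longrightarrow> smooth_on U (\<lambda>z. f z * g z)"
  unfolding smooth_on_def using C_k_on_mult by blast

lemma smooth_on_cmult: "open U \<Longrightarrow> smooth_on U f \<Longrightarrow> smooth_on U (\<lambda>z. c * f z)"
  using smooth_on_mult smooth_on_const by blast

lemma smooth_on_cnj_power: "open U \<Longrightarrow> smooth_on U (\<lambda>z. cnj z ^ m)"
proof (induction m)
  case (Suc m)
  then show ?case
    using smooth_on_mult[of U cnj] C_k_on_cnj by (simp add: smooth_on_def)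
qed (simp add: smooth_on_const)

lemma smooth_on_holomorphic: "open U \<Longrightarrow> f holomorphic_on U \<Longrightarrow> smooth_on U f"
  unfolding smooth_on_def using C_k_on_holomorphic by blast

lemma smooth_on_differentiable: "smooth_on U f \<Longrightarrow> z \<in> U \<Longrightarrow> f differentiable (at z)"
  unfolding smooth_on_def using C_k_on.simps(2) by blast

lemma smooth_on_d_zbar:
  assumes "open U" "smooth_on U f"
  shows "smooth_on U (d_zbar f)"
proof -
  have "smooth_on U (\<lambda>z. frechet_derivative f (at z) v)" for v
    unfolding smooth_on_def
  proof
    fix k
    have "C_k_on (Suc k) U f"
      using assms(2) unfolding smooth_on_def by blast
    then show "C_k_on k U (\<lambda>z. frechet_derivative f (at z) v)"
      by simp
  qed
  then have "smooth_on U (\<lambda>z. (1/2) * (frechet_derivative f (at z) 1 +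
      \<i> * frechet_derivative f (at z) \<i>))"
    by (intro smooth_on_cmult smooth_on_add assms(1)) auto
  then show ?thesis
    unfolding d_zbar_def[abs_def] by simp
qed

lemma smooth_on_d_zbar_funpow: "open U \<Longrightarrow> smooth_on U f \<Longrightarrow> smooth_on U ((d_zbar ^^ m) f)"
  by (induction m) (simp_all add: smooth_on_d_zbar)

lemma d_zbar_funpow_add:
  assumes "open U" "smooth_on U f" "smooth_on U g" "z \<in> U"
  shows "(d_zbar ^^ m) (\<lambda>w. f w + g w) z = (d_zbar ^^ m) f z + (d_zbar ^^ m) g z"
  using assms(4)
proof (induction m arbitrary: z)
  case (Suc m)
  have "has_wirtinger ((d_zbar ^^ m) h) (d_z ((d_zbar ^^ m) h) z) (d_zbar ((d_zbar ^^ m) h) z) z"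
    if "smooth_on U h" for h
    using that smooth_on_d_zbar_funpow smooth_on_differentiable Suc.prems assms(1)
    by (intro differentiable_has_wirtinger) blast
  then have "d_zbar (\<lambda>w. (d_zbar ^^ m) f w + (d_zbar ^^ m) g w) z
      = d_zbar ((d_zbar ^^ m) f) z + d_zbar ((d_zbar ^^ m) g) z"
    using has_wirtinger_add has_wirtinger_d_zbar assms by meson
  moreover have "d_zbar ((d_zbar ^^ m) (\<lambda>w. f w + g w)) z
      = d_zbar (\<lambda>w. (d_zbar ^^ m) f w + (d_zbar ^^ m) g w) z"
    using Suc by (intro d_zbar_cong[OF assms(1)]) auto
  ultimately show ?case by simp
qed simp

section \<open>The structure of polyanalytic functions\<close>

text \<open>For \<open>d_zbar\<close> the holomorphic \<open>h\<close> is a constant. The product is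
  a falling factorial in truncated subtraction: for \<open>m > k\<close> it contains the zero factor
  with \<open>i = k\<close>, so the truncated exponent does no harm.\<close>

lemma d_zbar_funpow_cnj_power_mult:
  assumes "open U" "h holomorphic_on U" "z \<in> U"
  shows "(d_zbar ^^ m) (\<lambda>w. cnj w ^ k * h w) z =
    of_nat (\<Prod>i<m. k - i) * cnj z ^ (k - m) * h z"
  using assms(3)
proof (induction m arbitrary: z)
  case (Suc m)
  have "(d_zbar ^^ Suc m) (\<lambda>w. cnj w ^ k * h w) z =
      d_zbar (\<lambda>w. of_nat (\<Prod>i<m. k - i) * (cnj w ^ (k - m) * h w)) z"
    using Suc by (simp add: mult.assoc, intro d_zbar_cong[OF assms(1)]) (auto simp: mult.assoc)
  also have "\<dots> = of_nat (\<Prod>i<m. k - i) * (of_nat (k - m) * cnj z ^ (k - m - 1) * h z + cnj z ^ (k - m) * 0)"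
    by (rule has_wirtinger_d_zbar[OF has_wirtinger_cmult[OF has_wirtinger_mult[OF has_wirtinger_cnj_power
        has_wirtinger_holomorphic[OF holomorphic_derivI[OF assms(2,1) Suc.prems]]]]])
  finally show ?case
    by (simp add: mult.assoc)
qed simp

lemma polyanalytic_cong:
  assumes "\<And>z. z \<in> disk \<Longrightarrow> f z = g z"
  shows "polyanalytic m f \<longleftrightarrow> polyanalytic m g"
proof -
  have "(\<forall>z\<in>disk. (d_zbar ^^ m) f z = 0) \<longleftrightarrow> (\<forall>z\<in>disk. (d_zbar ^^ m) g z = 0)"
    by (intro ball_cong refl) (simp only: d_zbar_funpow_cong[OF open_ball _ assms])
  then show ?thesis
    unfolding polyanalytic_def using smooth_on_cong[of disk f g] assms by simp
qed

lemma polyanalytic_add: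
  "polyanalytic m f \<Longrightarrow> polyanalytic m g \<Longrightarrow> polyanalytic m (\<lambda>z. f z + g z)"
  unfolding polyanalytic_def
  by (intro conjI ballI) (blast intro: smooth_on_add, subst d_zbar_funpow_add[OF open_ball], auto)

lemma polyanalytic_cnj_power_mult:
  assumes "k < m" "h holomorphic_on disk"
  shows "polyanalytic m (\<lambda>z. cnj z ^ k * h z)"
proof -
  have "(\<Prod>i<m. k - i) = 0"
    using assms(1) by (auto intro!: prod_zero)
  then show ?thesis
    unfolding polyanalytic_def using assms(2)
    by (auto simp: d_zbar_funpow_cnj_power_mult[OF open_ball]
        intro!: smooth_on_mult smooth_on_cnj_power)
       (auto intro: smooth_on_holomorphic)
qed

lemma polyanalytic_sum:
  assumes "\<And>i. i \<in> I \<Longrightarrow> polyanalytic m (f i)"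
  shows "polyanalytic m (\<lambda>z. \<Sum>i\<in>I. f i z)"
  using assms
proof (induction I rule: infinite_finite_induct)
  case (insert x F)
  then show ?case by (simp add: polyanalytic_add)
next
  case empty
  \<comment> \<open>The empty sum is the zero function, read as
    \<open>cnj w ^ 0 * 0\<close>.\<close>
  show ?case
    using d_zbar_funpow_cnj_power_mult[OF open_ball holomorphic_on_const, of _ 0 1 m 0 0]
    by (simp add: polyanalytic_def smooth_on_const)
next
  case (infinite A)
  then show ?case
    using d_zbar_funpow_cnj_power_mult[OF open_ball holomorphic_on_const, of _ 0 1 m 0 0]
    by (simp add: polyanalytic_def smooth_on_const)
qed

text \<open>The Cauchy-Riemann equations: without its conjugate-linear part the real derivative is
  multiplication by \<open>d_z g z\<close>.\<close>

lemma holomorphic_if_d_zbar_zero: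
  assumes "open U" "smooth_on U g" "\<And>z. z \<in> U \<Longrightarrow> d_zbar g z = 0"
  shows "g holomorphic_on U"
proof -
  have "g field_differentiable (at z)" if "z \<in> U" for z
  proof -
    have "has_wirtinger g (d_z g z) 0 z"
      using differentiable_has_wirtinger[OF smooth_on_differentiable[OF assms(2) that]]
        assms(3) that by simp
    then have "(g has_derivative (*) (d_z g z)) (at z)"
      unfolding has_wirtinger_def by simp
    then show ?thesis
      unfolding field_differentiable_def has_field_derivative_def by blast
  qed
  then show ?thesis
    using assms(1) by (simp add: holomorphic_on_open field_differentiable_def)
qed

text \<open>For an \<open>(m + 1)\<close>-analytic \<open>f\<close> the function
  \<open>g = (d_zbar ^^ m) f\<close> is holomorphic, and \<open>cnj z ^ m * g z / fact m\<close> has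
  the same \<open>m\<close>-th derivative \<open>g\<close>. Subtracting it leaves an
  \<open>m\<close>-analytic function for the induction.\<close>

lemma polyanalytic_decomposition:
  assumes "polyanalytic m f"
  shows "\<exists>h. (\<forall>k<m. h k holomorphic_on disk) \<and> (\<forall>z\<in>disk. f z = (\<Sum>k<m. cnj z ^ k * h k z))"
  using assms
proof (induction m arbitrary: f)
  case 0
  then show ?case by (simp add: polyanalytic_def)
next
  case (Suc m)
  define g where "g = (d_zbar ^^ m) f"
  define f1 where "f1 = (\<lambda>z. f z + cnj z ^ m * (- g z / fact m))"
  have smf: "smooth_on disk f"
    using Suc.prems polyanalytic_def by blast
  have g: "g holomorphic_on disk"
    using Suc.prems unfolding polyanalytic_def g_def
    by (intro holomorphic_if_d_zbar_zero smooth_on_d_zbar_funpow) auto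
  then have g': "(\<lambda>z. - g z / fact m) holomorphic_on disk"
    by (intro holomorphic_intros) auto
  then have smg: "smooth_on disk (\<lambda>z. cnj z ^ m * (- g z / fact m))"
    by (intro smooth_on_mult smooth_on_cnj_power smooth_on_holomorphic) auto
  have fct: "(\<Prod>i<m. m - i) = fact m"
    by (simp add: fact_prod_rev lessThan_atLeast0)
  have "(d_zbar ^^ m) f1 z = 0" if "z \<in> disk" for z
    unfolding f1_def
    by (subst d_zbar_funpow_add[OF open_ball smf smg that],
        subst d_zbar_funpow_cnj_power_mult[OF open_ball g' that]) (simp add: g_def fct)
  then have "polyanalytic m f1"
    unfolding polyanalytic_def f1_def using smooth_on_add[OF _ smf smg] by simp
  from Suc.IH[OF this] obtain h where
    h: "\<forall>k<m. h k holomorphic_on disk" "\<forall>z\<in>disk. f1 z = (\<Sum>k<m. cnj z ^ k * h k z)"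
    by blast
  define h' where "h' = h (m := \<lambda>z. g z / fact m)"
  have "\<forall>k<Suc m. h' k holomorphic_on disk"
    using h(1) g unfolding h'_def less_Suc_eq by (auto intro!: holomorphic_intros)
  moreover have "f z = (\<Sum>k<Suc m. cnj z ^ k * h' k z)" if "z \<in> disk" for z
  proof -
    have "f z = f1 z + cnj z ^ m * (g z / fact m)"
      by (simp add: f1_def)
    also have "\<dots> = (\<Sum>k<m. cnj z ^ k * h' k z) + cnj z ^ m * h' m z"
      using h(2) that by (simp add: h'_def)
    finally show ?thesis by simp
  qed
  ultimately show ?case by blast
qed

lemma polyanalytic_iff:
  "polyanalytic m f \<longleftrightarrow>
    (\<exists>h. (\<forall>k<m. h k holomorphic_on disk) \<and> (\<forall>z\<in>disk. f z = (\<Sum>k<m. cnj z ^ k * h k z)))"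
proof
  assume "\<exists>h. (\<forall>k<m. h k holomorphic_on disk) \<and> (\<forall>z\<in>disk. f z = (\<Sum>k<m. cnj z ^ k * h k z))"
  then obtain h where h: "\<forall>k<m. h k holomorphic_on disk"
    "\<And>z. z \<in> disk \<Longrightarrow> f z = (\<Sum>k<m. cnj z ^ k * h k z)" by blast
  have "polyanalytic m (\<lambda>z. \<Sum>k<m. cnj z ^ k * h k z)"
    using h(1) by (intro polyanalytic_sum polyanalytic_cnj_power_mult) auto
  then show "polyanalytic m f"
    using polyanalytic_cong[of f "\<lambda>z. \<Sum>k<m. cnj z ^ k * h k z" m] h(2) by blast
qed (rule polyanalytic_decomposition)

section \<open>Disk polynomials\<close>

lemma one_minus_cmod_square_pos: "z \<in> disk \<Longrightarrow> 0 < 1 - (cmod z)\<^sup>2"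
  by (simp add: abs_square_less_1)

text \<open>Chain rule with \<open>2 * (z \<bullet> h) = cnj z * h + z * cnj h\<close>; the base is
  positive on the disk, which admits every real exponent.\<close>

lemma has_wirtinger_weight_powr:
  assumes "z \<in> disk"
  shows "has_wirtinger (\<lambda>w. of_real ((1 - (cmod w)\<^sup>2) powr \<beta>))
    (- of_real \<beta> * cnj z * of_real ((1 - (cmod z)\<^sup>2) powr (\<beta> - 1)))
    (- of_real \<beta> * z * of_real ((1 - (cmod z)\<^sup>2) powr (\<beta> - 1))) z"
proof -
  have "((\<lambda>w. 1 - (w \<bullet> w)) has_derivative (\<lambda>h. - (2 * (z \<bullet> h)))) (at z)"
    by (auto intro!: derivative_eq_intros simp: inner_commute)
  then have g: "((\<lambda>w. 1 - (cmod w)\<^sup>2) has_derivative (\<lambda>h. - (2 * (z \<bullet> h)))) (at z)"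
    by (simp add: power2_norm_eq_inner)
  have "((\<lambda>x. x powr \<beta>) has_real_derivative \<beta> * (1 - (cmod z)\<^sup>2) powr (\<beta> - 1)) (at (1 - (cmod z)\<^sup>2))"
    using one_minus_cmod_square_pos[OF assms] by (rule has_real_derivative_powr)
  from DERIV_compose_FDERIV[OF this g]
  have "((\<lambda>w. complex_of_real ((1 - (cmod w)\<^sup>2) powr \<beta>)) has_derivative
      (\<lambda>h. of_real (- (2 * (z \<bullet> h)) * (\<beta> * (1 - (cmod z)\<^sup>2) powr (\<beta> - 1))))) (at z)"
    by (rule has_derivative_of_real)
  then show ?thesis
    unfolding has_wirtinger_def
    by (rule has_derivative_eq_rhs) (auto simp: fun_eq_iff complex_eq_iff inner_complex_def algebra_simps)
qed

text \<open>\<open>fact k * (a gchoose k)\<close> is the falling factorial of \<open>a\<close>, the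
  constant left by \<open>k\<close> derivatives of a power with real exponent
  \<open>a\<close>.\<close>

lemma fact_Suc_gbinomial:
  "fact (Suc k) * ((a::real) gchoose Suc k) = (a - of_nat k) * (fact k * (a gchoose k))"
  unfolding gbinomial_mult_fact by (simp add: atLeastLessThanSuc mult.commute)

lemma of_real_gbinomial_Suc:
  "complex_of_real (fact (Suc k) * (a gchoose Suc k)) = of_real (a - k) * of_real (fact k * (a gchoose k))"
  unfolding fact_Suc_gbinomial by simp

text \<open>\<open>d_zbar\<close> treats \<open>z ^ p\<close> as a constant, so each derivative
  meets only the power of the weight and contributes one more factor \<open>- z\<close>; no product
  expansion arises.\<close>

lemma d_zbar_funpow_weight:
  assumes "z \<in> disk"
  shows "(d_zbar ^^ p) (\<lambda>w. of_real ((1 - (cmod w)\<^sup>2) powr \<beta>)) z =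
    (-1) ^ p * of_real (fact p * (\<beta> gchoose p)) * z ^ p * of_real ((1 - (cmod z)\<^sup>2) powr (\<beta> - p))"
  using assms
proof (induction p arbitrary: z)
  case (Suc p)
  let ?c = "(-1) ^ p * complex_of_real (fact p * (\<beta> gchoose p))"
  have "(d_zbar ^^ Suc p) (\<lambda>w. of_real ((1 - (cmod w)\<^sup>2) powr \<beta>)) z =
      d_zbar (\<lambda>w. ?c * (w ^ p * of_real ((1 - (cmod w)\<^sup>2) powr (\<beta> - p)))) z"
    unfolding funpow.simps o_def
    by (intro d_zbar_cong[OF open_ball Suc.prems]) (simp add: Suc.IH)
  also have "\<dots> = ?c * (0 * of_real ((1 - (cmod z)\<^sup>2) powr (\<beta> - p)) +
      z ^ p * (- of_real (\<beta> - p) * z * of_real ((1 - (cmod z)\<^sup>2) powr (\<beta> - p - 1))))"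
    by (rule has_wirtinger_d_zbar[OF has_wirtinger_cmult[OF has_wirtinger_mult[OF has_wirtinger_power
        has_wirtinger_weight_powr[OF Suc.prems]]]])
  also have "\<dots> = (-1) ^ Suc p * (of_real (\<beta> - p) * of_real (fact p * (\<beta> gchoose p))) * z ^ Suc p *
      of_real ((1 - (cmod z)\<^sup>2) powr (\<beta> - Suc p))"
    by (simp add: algebra_simps)
  finally show ?case
    by (simp only: of_real_gbinomial_Suc)
qed simp

text \<open>Pascal's rule in the form shared by the Leibniz formula and by the iterated finite
  difference of binomial coefficients.\<close>

lemma sum_binomial_Suc:
  fixes x :: "nat \<Rightarrow> nat \<Rightarrow> 'a::comm_semiring_1"
  shows "(\<Sum>j\<le>q. of_nat (q choose j) * (x (Suc j) (q - j) + x j (Suc (q - j)))) =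
    (\<Sum>j\<le>Suc q. of_nat (Suc q choose j) * x j (Suc q - j))"
proof -
  let ?B = "\<Sum>j\<le>q. of_nat (q choose Suc j) * x (Suc j) (q - j)"
  have "(\<Sum>j\<le>q. of_nat (q choose j) * x j (Suc (q - j))) =
      (\<Sum>j\<le>Suc q. of_nat (q choose j) * x j (Suc q - j))"
    by (simp add: Suc_diff_le binomial_eq_0)
  also have "\<dots> = x 0 (Suc q) + ?B"
    by (subst sum.atMost_Suc_shift) simp
  finally have 1: "(\<Sum>j\<le>q. of_nat (q choose j) * x j (Suc (q - j))) = x 0 (Suc q) + ?B" .
  have "(\<Sum>j\<le>Suc q. of_nat (Suc q choose j) * x j (Suc q - j)) =
      x 0 (Suc q) + ((\<Sum>j\<le>q. of_nat (q choose j) * x (Suc j) (q - j)) + ?B)"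
    by (subst sum.atMost_Suc_shift) (simp add: ring_distribs sum.distrib)
  then show ?thesis
    by (simp only: distrib_left sum.distrib 1 add_ac)
qed

text \<open>Each factor enters as the sequence of its successive \<open>d_z\<close>-derivatives, so
  that differentiability of every order is part of the data.\<close>

lemma d_z_funpow_Leibniz:
  fixes A B A' B' :: "nat \<Rightarrow> complex \<Rightarrow> complex"
  assumes "open U" "z \<in> U"
    and A: "\<And>j z. z \<in> U \<Longrightarrow> has_wirtinger (A j) (A (Suc j) z) (A' j z) z"
    and B: "\<And>j z. z \<in> U \<Longrightarrow> has_wirtinger (B j) (B (Suc j) z) (B' j z) z"
  shows "(d_z ^^ q) (\<lambda>w. A 0 w * B 0 w) z = (\<Sum>j\<le>q. of_nat (q choose j) * (A j z * B (q - j) z))"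
  using assms(2)
proof (induction q arbitrary: z)
  case (Suc q)
  have "(d_z ^^ Suc q) (\<lambda>w. A 0 w * B 0 w) z =
      d_z (\<lambda>w. \<Sum>j\<le>q. of_nat (q choose j) * (A j w * B (q - j) w)) z"
    unfolding funpow.simps o_def
    by (intro d_z_cong[OF assms(1) Suc.prems]) (simp add: Suc.IH)
  also have "\<dots> = (\<Sum>j\<le>q. of_nat (q choose j) * (A (Suc j) z * B (q - j) z + A j z * B (Suc (q - j)) z))"
    by (rule has_wirtinger_d_z[OF has_wirtinger_sum[OF has_wirtinger_cmult[OF has_wirtinger_mult[OF
        A[OF Suc.prems] B[OF Suc.prems]]]]])
  also have "\<dots> = (\<Sum>j\<le>Suc q. of_nat (Suc q choose j) * (A j z * B (Suc q - j) z))"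
    by (rule sum_binomial_Suc[of q "\<lambda>i j. A i z * B j z"])
  finally show ?case .
qed simp

text \<open>Terms with \<open>j > p\<close> carry the factor \<open>p choose j = 0\<close>, which
  makes the truncated exponent \<open>p - j\<close> harmless.\<close>

lemma d_z_funpow_power_weight:
  assumes "z \<in> disk"
  shows "(d_z ^^ q) (\<lambda>w. w ^ p * of_real ((1 - (cmod w)\<^sup>2) powr \<gamma>)) z =
    (\<Sum>j\<le>q. of_nat (q choose j) * (of_nat (fact j * (p choose j)) * z ^ (p - j) *
      ((-1) ^ (q - j) * of_real (fact (q - j) * (\<gamma> gchoose (q - j))) * cnj z ^ (q - j) *
       of_real ((1 - (cmod z)\<^sup>2) powr (\<gamma> - (q - j))))))"
proof -
  define A where "A j w = complex_of_nat (fact j * (p choose j)) * w ^ (p - j)" for j w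
  define B where "B j w = (-1) ^ j * of_real (fact j * (\<gamma> gchoose j)) * (cnj w ^ j *
       of_real ((1 - (cmod w)\<^sup>2) powr (\<gamma> - j)))" for j w
  have A: "has_wirtinger (A j) (A (Suc j) w) 0 w" for j w
  proof -
    have "(p - j) * (p choose j) = Suc j * (p choose Suc j)"
      by (metis binomial_absorb_comp binomial_absorption mult.commute)
    then have "of_nat ((p - j) * (p choose j)) = (of_nat (Suc j * (p choose Suc j)) :: complex)"
      by (rule arg_cong)
    then have "complex_of_nat (fact j * (p choose j)) * (of_nat (p - j) * w ^ (p - j - 1)) = A (Suc j) w"
      unfolding A_def by (simp only: of_nat_mult fact_Suc of_nat_fact diff_Suc_eq_diff_pred mult.assoc mult.left_commute) (simp add: mult.commute)
    then show ?thesis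
      using has_wirtinger_cmult[OF has_wirtinger_power[where m = "p - j" and z = w], of "of_nat (fact j * (p choose j))"]
      by (simp only: A_def[abs_def] mult_zero_right)
  qed
  have B: "has_wirtinger (B j) (B (Suc j) w) (d_zbar (B j) w) w" if w: "w \<in> disk" for j w
  proof -
    let ?c = "(-1) ^ j * complex_of_real (fact j * (\<gamma> gchoose j))"
    have eq: "?c * (0 * of_real ((1 - (cmod w)\<^sup>2) powr (\<gamma> - j)) + cnj w ^ j *
        (- of_real (\<gamma> - j) * cnj w * of_real ((1 - (cmod w)\<^sup>2) powr (\<gamma> - j - 1)))) = B (Suc j) w"
      unfolding B_def of_real_gbinomial_Suc by (simp add: algebra_simps)
    note * = has_wirtinger_cmult[OF has_wirtinger_mult[OF has_wirtinger_cnj_power[where m=j]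
        has_wirtinger_weight_powr[OF w, of "\<gamma> - j"]], of ?c]
    have "B j differentiable at w" "d_z (B j) w = B (Suc j) w"
      using has_wirtinger_differentiable[OF *] has_wirtinger_d_z[OF *] unfolding eq
      unfolding B_def by simp_all
    then show ?thesis
      using differentiable_has_wirtinger by metis
  qed
  have "(d_z ^^ q) (\<lambda>w. A 0 w * B 0 w) z = (\<Sum>j\<le>q. of_nat (q choose j) * (A j z * B (q - j) z))"
    by (rule d_z_funpow_Leibniz[OF open_ball assms, where A' = "\<lambda>j w. 0" and B' = "\<lambda>j. d_zbar (B j)"])
       (simp_all only: A B)
  then show ?thesis
    by (simp add: A_def B_def mult.assoc)
qed

text \<open>What stays in front of the sum once both derivatives are carried out: the normalization,
  the falling factorial from the \<open>p\<close> derivatives in \<open>cnj z\<close>, and the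
  \<open>fact q\<close> common to all Leibniz terms.\<close>

definition disk_poly_factor :: "real \<Rightarrow> nat \<Rightarrow> nat \<Rightarrow> real" where
  "disk_poly_factor \<alpha> p q =
     disk_poly_const \<alpha> p q * (fact p * ((p + q + \<alpha>) gchoose p)) * fact q"

text \<open>Exponents of the weight: \<open>p\<close> derivatives lower
  \<open>p + q + \<alpha>\<close> to \<open>q + \<alpha>\<close>, the \<open>q - j\<close>
  derivatives falling on it lower this to \<open>\<alpha> + j\<close>, and the prefactor removes
  \<open>\<alpha>\<close>. A polynomial in \<open>z\<close> and \<open>cnj z\<close>
  remains.\<close>

lemma disk_poly_eq:
  assumes "z \<in> disk"
  shows "disk_poly \<alpha> p q z = of_real (disk_poly_factor \<alpha> p q) *
    (\<Sum>j\<le>q. (-1) ^ j * of_real (of_nat (p choose j) * ((q + \<alpha>) gchoose (q - j))) *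
       z ^ (p - j) * cnj z ^ (q - j) * (1 - z * cnj z) ^ j)"
proof -
  define W where "W = 1 - (cmod z)\<^sup>2"
  have W: "W > 0" "complex_of_real W = 1 - z * cnj z"
    using one_minus_cmod_square_pos[OF assms] by (simp_all add: W_def complex_norm_square[symmetric])
  let ?C = "(-1) ^ p * complex_of_real (fact p * ((p + q + \<alpha>) gchoose p))"
  let ?w = "\<lambda>w. complex_of_real ((1 - (cmod w)\<^sup>2) powr (q + \<alpha>))"
  \<comment> \<open>A constant may be pulled out of an iterated \<open>d_z\<close> only where the
    iterates are differentiable; elsewhere the value of \<open>d_z\<close> is unspecified.\<close>
  have comm: "(d_z ^^ m) (\<lambda>w. c * f w) z = c * (d_z ^^ m) f z" if "\<And>m w. w \<in> disk \<Longrightarrow> (d_z ^^ m) f differentiable at w"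
    for m c f
    using assms
  proof (induction m arbitrary: z)
    case (Suc m)
    have "d_z ((d_z ^^ m) (\<lambda>w. c * f w)) z = d_z (\<lambda>w. c * (d_z ^^ m) f w) z"
      by (rule d_z_cong[OF open_ball Suc.prems Suc.IH])
    also have "\<dots> = c * d_z ((d_z ^^ m) f) z"
      by (rule has_wirtinger_d_z[OF has_wirtinger_cmult[OF differentiable_has_wirtinger[OF that[OF Suc.prems]]]])
    finally show ?case by simp
  qed simp
  \<comment> \<open>The Leibniz formula agrees with the iterates on the whole open disk, so
    differentiability is read off its right-hand side.\<close>
  have diff: "(d_z ^^ m) (\<lambda>w. w ^ p * ?w w) differentiable at w" if w: "w \<in> disk" for m w
  proof -
    define S where "S = (\<lambda>z. \<Sum>j\<le>m. of_nat (m choose j) * (of_nat (fact j * (p choose j)) * z ^ (p - j) *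
      ((-1) ^ (m - j) * of_real (fact (m - j) * ((q + \<alpha>) gchoose (m - j))) * cnj z ^ (m - j) *
       of_real ((1 - (cmod z)\<^sup>2) powr ((q + \<alpha>) - (m - j))))))"
    have "S differentiable at w"
      unfolding S_def
      by (rule has_wirtinger_differentiable has_wirtinger_sum has_wirtinger_mult has_wirtinger_const
          has_wirtinger_power has_wirtinger_cnj_power has_wirtinger_weight_powr[OF w])+
    moreover have "(d_z ^^ m) (\<lambda>w. w ^ p * ?w w) v = S v" if "v \<in> disk" for v
      unfolding S_def by (rule d_z_funpow_power_weight[OF that])
    ultimately show ?thesis
      using differentiable_cong_open[OF open_ball w, of "(d_z ^^ m) (\<lambda>w. w ^ p * ?w w)" S] by blast
  qed
  have "disk_poly \<alpha> p q z = (-1) ^ (p + q) * of_real (disk_poly_const \<alpha> p q) * of_real (W powr (- \<alpha>)) *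
      (d_z ^^ q) (\<lambda>w. ?C * (w ^ p * ?w w)) z"
  proof -
    have "(d_z ^^ q) ((d_zbar ^^ p) (\<lambda>w. of_real ((1 - (cmod w)\<^sup>2) powr (real p + real q + \<alpha>)))) z =
        (d_z ^^ q) (\<lambda>w. ?C * (w ^ p * ?w w)) z"
      by (rule d_z_funpow_cong[OF open_ball assms], subst d_zbar_funpow_weight) (simp_all add: mult.assoc)
    then show ?thesis
      unfolding disk_poly_def W_def by (simp only: assms if_True)
  qed
  also have "(d_z ^^ q) (\<lambda>w. ?C * (w ^ p * ?w w)) z = ?C * (d_z ^^ q) (\<lambda>w. w ^ p * ?w w) z"
    by (rule comm[OF diff])
  also have "(d_z ^^ q) (\<lambda>w. w ^ p * ?w w) z = of_real (W powr \<alpha>) * ((-1) ^ q * fact q *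
      (\<Sum>j\<le>q. (-1) ^ j * of_real (of_nat (p choose j) * ((q + \<alpha>) gchoose (q - j))) *
       z ^ (p - j) * cnj z ^ (q - j) * (1 - z * cnj z) ^ j))"
    unfolding d_z_funpow_power_weight[OF assms] sum_distrib_left
  proof (rule sum.cong[OF refl])
    fix j assume "j \<in> {..q}"
    then have j: "j \<le> q" by simp
    have "W powr (real q + \<alpha> - real (q - j)) = W powr \<alpha> * W ^ j"
    proof -
      have "real q + \<alpha> - real (q - j) = \<alpha> + real j"
        using j by (simp add: of_nat_diff)
      then show ?thesis
        using W(1) by (simp add: powr_add powr_realpow)
    qed
    then have 1: "complex_of_real (W powr (real q + \<alpha> - real (q - j))) = of_real (W powr \<alpha>) * (1 - z * cnj z) ^ j"
      using W(2) by simp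
    have 2: "(-1) ^ (q - j) = (-1) ^ q * ((-1) ^ j :: complex)"
    proof -
      obtain i where "q = j + i" using j le_iff_add by blast
      then show ?thesis by (simp add: power_add mult.commute)
    qed
    have "fact q = fact j * fact (q - j) * (q choose j)"
      using binomial_fact_lemma[OF j] by simp
    then have 3: "fact q = (fact j * fact (q - j) * of_nat (q choose j) :: complex)"
      by (metis of_nat_fact of_nat_mult)
    show "of_nat (q choose j) * (of_nat (fact j * (p choose j)) * z ^ (p - j) *
      ((-1) ^ (q - j) * of_real (fact (q - j) * ((real q + \<alpha>) gchoose (q - j))) * cnj z ^ (q - j) *
       of_real ((1 - (cmod z)\<^sup>2) powr (real q + \<alpha> - real (q - j))))) =
      of_real (W powr \<alpha>) * ((-1) ^ q * fact q * ((-1) ^ j * of_real (of_nat (p choose j) * ((q + \<alpha>) gchoose (q - j))) *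
       z ^ (p - j) * cnj z ^ (q - j) * (1 - z * cnj z) ^ j))"
      unfolding W_def[symmetric] 1 2 3 by (simp add: mult_ac)
  qed
  also have "of_real (W powr (- \<alpha>)) = (inverse (of_real (W powr \<alpha>)) :: complex)"
    by (simp add: powr_minus)
  finally show ?thesis
    using W(1) unfolding disk_poly_factor_def
    by (simp add: power_add mult_ac power_mult_distrib[symmetric])
qed

section \<open>Rotation invariance and radial moments\<close>

text \<open>Lebesgue measure is determined by its values on boxes. The preimage of a box is its
  image under the inverse, again orthogonal map, which has the same measure.\<close>

lemma lborel_distr_orthogonal_transformation:
  fixes f :: "real^'n::{finite,wellorder} \<Rightarrow> real^'n::_"
  assumes "orthogonal_transformation f"
  shows "distr lborel borel f = lborel"
proof (rule lborel_eqI[symmetric])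
  define g where "g = inv f"
  have g: "orthogonal_transformation g"
    unfolding g_def by (rule orthogonal_transformation_inv[OF assms])
  have meas: "f \<in> borel_measurable borel"
    using assms by (intro borel_measurable_continuous_onI linear_continuous_on)
      (simp add: linear_conv_bounded_linear[symmetric] orthogonal_transformation_linear)
  fix l u :: "real^'n::_"
  assume le: "\<And>b. b \<in> Basis \<Longrightarrow> l \<bullet> b \<le> u \<bullet> b"
  have eq: "f -` box l u = g ` box l u"
    unfolding g_def using orthogonal_transformation_bij[OF assms] by (simp add: bij_vimage_eq_inv_image)
  have m: "f -` box l u \<in> sets borel"
    using measurable_sets[OF meas] by simp
  have "g ` box l u \<in> lmeasurable"
    by (intro measurable_orthogonal_image[OF g]) simp
  then have "emeasure lebesgue (g ` box l u) = ennreal (measure lebesgue (g ` box l u))"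
    by (rule emeasure_eq_measure2)
  also have "measure lebesgue (g ` box l u) = measure lebesgue (box l u)"
    by (intro measure_orthogonal_image[OF g]) simp
  finally have "emeasure lebesgue (g ` box l u) = (\<Prod>b\<in>Basis. (u - l) \<bullet> b)"
    using le by (simp add: measure_lborel_box_eq measure_completion)
  then show "emeasure (distr lborel borel f) (box l u) = (\<Prod>b\<in>Basis. (u - l) \<bullet> b)"
    using m meas by (simp add: emeasure_distr eq emeasure_completion)
qed simp

text \<open>Identifies the plane with \<open>real^2\<close>, box by box, so that invariance under
  orthogonal maps can be carried over to complex rotations.\<close>

lemma lborel_distr_complex_of_vec:
  "distr lborel borel (\<lambda>v::real^2. Complex (v $ 1) (v $ 2)) = lborel"
proof (rule lborel_eqI[symmetric])
  let ?f = "\<lambda>v::real^2. Complex (v $ 1) (v $ 2)"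
  have eq: "?f = (\<lambda>v. of_real (v $ 1) + \<i> * of_real (v $ 2))"
    by (simp add: complex_eq_iff fun_eq_iff)
  have meas: "?f \<in> borel_measurable borel"
    unfolding eq by (intro borel_measurable_continuous_onI continuous_intros)
  fix l u :: complex
  assume le: "\<And>b. b \<in> Basis \<Longrightarrow> l \<bullet> b \<le> u \<bullet> b"
  let ?v = "\<lambda>z. (\<chi> i. if i = 1 then Re z else Im z) :: real^2"
  have "?f -` box l u = box (?v l) (?v u)"
    by (auto simp: in_box_complex_iff mem_box_cart forall_2)
  then have "emeasure (distr lborel borel ?f) (box l u) = emeasure lborel (box (?v l) (?v u))"
    using meas by (simp add: emeasure_distr)
  also have "\<dots> = (\<Prod>b\<in>Basis. (?v u - ?v l) \<bullet> b)"
    using le[of 1] le[of \<i>] by (intro emeasure_lborel_box)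
       (auto simp: Basis_vec_def inner_axis Basis_complex_def complex_inner_i_right)
  also have "(\<Prod>b\<in>Basis. (?v u - ?v l) \<bullet> b) = (\<Prod>i\<in>(UNIV::2 set). (?v u - ?v l) $ i)"
    by (simp add: Basis_vec_def axis_eq_axis inner_axis prod.UNION_disjoint)
  also have "\<dots> = (\<Prod>b\<in>Basis. (u - l) \<bullet> b)"
    by (simp add: UNIV_2 Basis_complex_def)
  finally show "emeasure (distr lborel borel ?f) (box l u) = (\<Prod>b\<in>Basis. (u - l) \<bullet> b)" .
qed simp

text \<open>In coordinates, multiplication by \<open>\<tau>\<close> is linear and norm-preserving,
  hence orthogonal.\<close>

lemma lborel_distr_rotation:
  assumes "cmod \<tau> = 1"
  shows "distr lborel borel ((*) \<tau>) = lborel"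
proof -
  define f where "f = (\<lambda>v::real^2. Complex (v $ 1) (v $ 2))"
  define g where "g = (\<lambda>z. (\<chi> i. if i = 1 then Re z else Im z) :: real^2)"
  have fg: "f (g z) = z" for z
    by (simp add: f_def g_def)
  have eq: "f = (\<lambda>v. of_real (v $ 1) + \<i> * of_real (v $ 2))"
    by (simp add: complex_eq_iff fun_eq_iff f_def)
  have f: "f \<in> borel_measurable borel"
    unfolding eq by (intro borel_measurable_continuous_onI continuous_intros)
  define R where "R = (\<lambda>v. g (\<tau> * f v))"
  have ng: "norm (g z) = cmod z" for z
    by (simp add: g_def norm_vec_def L2_set_def UNIV_2 cmod_def)
  have nf: "cmod (f v) = norm v" for v
    by (simp add: f_def norm_vec_def L2_set_def UNIV_2 cmod_def)
  have "linear R"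
    by (rule linearI) (auto simp: R_def g_def f_def vec_eq_iff algebra_simps)
  then have R: "orthogonal_transformation R"
    unfolding orthogonal_transformation using assms by (simp add: R_def ng nf norm_mult)
  then have Rm: "R \<in> borel_measurable borel"
    by (intro borel_measurable_continuous_onI linear_continuous_on)
      (simp add: linear_conv_bounded_linear[symmetric] orthogonal_transformation_linear)
  have fd: "distr lborel borel f = lborel"
    unfolding f_def by (rule lborel_distr_complex_of_vec)
  have tm: "(*) \<tau> \<in> borel_measurable borel"
    by (intro borel_measurable_continuous_onI continuous_intros)
  have "distr lborel borel ((*) \<tau>) = distr (distr lborel borel f) borel ((*) \<tau>)"
    by (simp add: fd)
  also have "\<dots> = distr lborel borel ((*) \<tau> \<circ> f)"
    using f tm by (subst distr_distr) auto
  also have "(*) \<tau> \<circ> f = f \<circ> R"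
    by (simp add: R_def fg fun_eq_iff)
  also have "distr lborel borel (f \<circ> R) = distr (distr lborel borel R) borel f"
    using f Rm by (subst distr_distr) auto
  also have "\<dots> = lborel"
    by (simp add: lborel_distr_orthogonal_transformation[OF R] fd)
  finally show ?thesis .
qed

lemma disk_borel [measurable]: "disk \<in> sets borel"
  by simp

lemma borel_measurable_cnj [measurable]: "cnj \<in> borel_measurable borel"
  by (intro borel_measurable_continuous_onI continuous_intros)

text \<open>Replaces polar coordinates: the part of the disk with
  \<open>x < (cmod z)\<^sup>2\<close> is an annulus of area \<open>pi * (1 - x)\<close>, so the
  squared modulus spreads area uniformly over the unit interval. Measures on the line are compared
  on half-lines.\<close>

lemma distr_cmod_square:
  "distr (density lborel (\<lambda>z. indicator disk z)) borel (\<lambda>z. (cmod z)\<^sup>2) =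
   density lborel (\<lambda>t. ennreal pi * indicator {0<..<1} t)"
proof (rule measure_eqI_lessThan)
  have m: "(\<lambda>z. (cmod z)\<^sup>2) \<in> borel_measurable borel" by measurable
  have e1: "emeasure (distr (density lborel (\<lambda>z. indicator disk z)) borel (\<lambda>z. (cmod z)\<^sup>2)) {x<..} =
     emeasure lborel (disk \<inter> {z. x < (cmod z)\<^sup>2})" for x
  proof -
    have "emeasure (distr (density lborel (\<lambda>z. indicator disk z)) borel (\<lambda>z. (cmod z)\<^sup>2)) {x<..} =
        emeasure (density lborel (\<lambda>z. indicator disk z)) {z::complex. x < (cmod z)\<^sup>2}"
      by (subst emeasure_distr) (auto simp: vimage_def)
    also have "\<dots> = (\<integral>\<^sup>+z. indicator disk z * indicator {z::complex. x < (cmod z)\<^sup>2} z \<partial>lborel)"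
      by (rule emeasure_density) measurable
    also have "\<dots> = (\<integral>\<^sup>+z. indicator (disk \<inter> {z. x < (cmod z)\<^sup>2}) z \<partial>lborel)"
      by (simp add: indicator_inter_arith)
    also have "\<dots> = emeasure lborel (disk \<inter> {z. x < (cmod z)\<^sup>2})"
      by (rule nn_integral_indicator) measurable
    finally show ?thesis .
  qed
  have e2: "emeasure (density lborel (\<lambda>t. ennreal pi * indicator {0<..<1} t)) {x<..} =
     ennreal pi * emeasure lborel ({0<..<1} \<inter> {x<..})" for x :: real
  proof -
    have "emeasure (density lborel (\<lambda>t. ennreal pi * indicator {0<..<1} t)) {x<..} =
        (\<integral>\<^sup>+t. ennreal pi * indicator {0<..<1} t * indicator {x<..} t \<partial>lborel)"
      by (rule emeasure_density) auto
    also have "\<dots> = (\<integral>\<^sup>+t. ennreal pi * indicator ({0<..<1} \<inter> {x<..}) t \<partial>lborel)"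
      by (simp add: indicator_inter_arith mult.assoc)
    also have "\<dots> = ennreal pi * emeasure lborel ({0<..<1} \<inter> {x<..})"
      by (rule nn_integral_cmult_indicator) measurable
    finally show ?thesis .
  qed
  have e3: "emeasure lborel (disk \<inter> {z. x < (cmod z)\<^sup>2}) = ennreal pi * emeasure lborel ({0<..<1} \<inter> {x<..})" for x
  proof (cases "x < 0")
    case True
    then have "disk \<inter> {z. x < (cmod z)\<^sup>2} = disk" "{0<..<1} \<inter> {x<..} = {0<..<1}"
      by (auto intro: less_le_trans)
    then show ?thesis
      using emeasure_ball[of 1 "0::complex"] by (simp add: unit_ball_vol_2)
  next
    case False
    show ?thesis
    proof (cases "x < 1")
      case True
      have "disk \<inter> {z. x < (cmod z)\<^sup>2} = disk - cball 0 (sqrt x)"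
        using False by (auto simp: real_le_rsqrt real_sqrt_less_iff not_le sqrt_le_D real_less_lsqrt)
           (metis not_le real_le_rsqrt real_sqrt_abs abs_norm_cancel real_sqrt_less_iff)+
      moreover have "cball 0 (sqrt x) \<subseteq> (disk::complex set)"
        using True real_sqrt_lt_1_iff[of x] by (auto intro: le_less_trans simp del: real_sqrt_lt_1_iff)
      ultimately have "emeasure lborel (disk \<inter> {z. x < (cmod z)\<^sup>2}) = ennreal pi - ennreal (pi * x)"
        using False emeasure_ball[of 1 "0::complex"] emeasure_cball[of "sqrt x" "0::complex"]
        by (simp add: emeasure_Diff unit_ball_vol_2)
      also have "\<dots> = ennreal pi * ennreal (1 - x)"
        using False True by (simp add: ennreal_minus ennreal_mult[symmetric] right_diff_distrib)
      moreover have "{0<..<1} \<inter> {x<..} = {x<..<1}"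
        using False by auto
      ultimately show ?thesis using True by simp
    next
      case ge: False
      have "disk \<inter> {z. x < (cmod z)\<^sup>2} = {}"
        using ge by (auto simp: not_less dest!: power_le_one[OF norm_ge_zero less_imp_le, of _ 2])
      moreover have "{0<..<1} \<inter> {x<..} = {}" using ge by auto
      ultimately show ?thesis by simp
    qed
  qed
  show "emeasure (distr (density lborel (\<lambda>z. indicator disk z)) borel (\<lambda>z. (cmod z)\<^sup>2)) {x<..} =
    emeasure (density lborel (\<lambda>t. ennreal pi * indicator {0<..<1} t)) {x<..}" for x
    unfolding e1 e2 e3 ..
  show "emeasure (distr (density lborel (\<lambda>z. indicator disk z)) borel (\<lambda>z. (cmod z)\<^sup>2)) {x<..} < \<infinity>" for x
  proof -
    have "emeasure lborel (disk \<inter> {z. x < (cmod z)\<^sup>2}) \<le> emeasure lborel (disk :: complex set)"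
      by (intro emeasure_mono) auto
    then show ?thesis
      unfolding e1 using emeasure_lborel_ball_finite[of "0::complex" 1] by (auto simp: le_less_trans)
  qed
qed auto

lemma nn_integral_disk_radial:
  assumes [measurable]: "g \<in> borel_measurable borel"
  shows "(\<integral>\<^sup>+z. indicator disk z * g ((cmod z)\<^sup>2) \<partial>lborel) = (\<integral>\<^sup>+t. ennreal pi * indicator {0<..<1} t * g t \<partial>lborel)"
proof -
  have "(\<integral>\<^sup>+z. indicator disk z * g ((cmod z)\<^sup>2) \<partial>lborel) =
      (\<integral>\<^sup>+z. g ((cmod z)\<^sup>2) \<partial>density lborel (\<lambda>z. indicator disk z))"
    by (rule nn_integral_density[symmetric]) measurable
  also have "\<dots> = (\<integral>\<^sup>+t. g t \<partial>distr (density lborel (\<lambda>z. indicator disk z)) borel (\<lambda>z::complex. (cmod z)\<^sup>2))"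
    by (rule nn_integral_distr[symmetric]) measurable
  also have "\<dots> = (\<integral>\<^sup>+t. ennreal pi * indicator {0<..<1} t * g t \<partial>lborel)"
    unfolding distr_cmod_square by (rule nn_integral_density) measurable
  finally show ?thesis .
qed

section \<open>The measure \<open>mu \<alpha>\<close>: rotation invariance, radial moments, and
  functions vanishing almost everywhere\<close>

lemma sets_mu [measurable_cong]: "sets (mu \<alpha>) = sets (restrict_space lborel disk)"
  by (simp add: mu_def)

lemma space_mu [simp]: "space (mu \<alpha>) = disk"
  by (simp add: mu_def space_restrict_space)

lemma borel_measurable_mu: "f \<in> borel_measurable borel \<Longrightarrow> f \<in> borel_measurable (mu \<alpha>)"
  by (simp add: measurable_cong_sets[OF sets_mu refl] measurable_restrict_space1)

definition mu_weight :: "real \<Rightarrow> complex \<Rightarrow> real" where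
  "mu_weight \<alpha> z = (\<alpha> + 1) / pi * (1 - (cmod z)\<^sup>2) powr \<alpha>"

lemma measurable_mu_weight [measurable]: "mu_weight \<alpha> \<in> borel_measurable borel"
  unfolding mu_weight_def by measurable

lemma mu_weight_nonneg: "\<alpha> > -1 \<Longrightarrow> mu_weight \<alpha> z \<ge> 0"
  unfolding mu_weight_def by simp

lemma mu_weight_pos: "\<alpha> > -1 \<Longrightarrow> z \<in> disk \<Longrightarrow> mu_weight \<alpha> z > 0"
  unfolding mu_weight_def using one_minus_cmod_square_pos[of z] by simp

lemma mu_eq: "mu \<alpha> = density (restrict_space lborel disk) (\<lambda>z. ennreal (mu_weight \<alpha> z))"
  unfolding mu_def mu_weight_def ..

lemma nn_integral_mu:
  assumes [measurable]: "f \<in> borel_measurable borel"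
  shows "(\<integral>\<^sup>+z. f z \<partial>mu \<alpha>) = (\<integral>\<^sup>+z. indicator disk z * (ennreal (mu_weight \<alpha> z) * f z) \<partial>lborel)"
  unfolding mu_eq
  by (subst nn_integral_density)
     (auto simp: nn_integral_restrict_space measurable_restrict_space1 mult_ac)

lemma integral_mu:
  fixes f :: "complex \<Rightarrow> complex"
  assumes [measurable]: "f \<in> borel_measurable borel" and "\<alpha> > -1"
  shows "(LINT z|mu \<alpha>. f z) = (LINT z|lborel. indicator disk z *\<^sub>R (mu_weight \<alpha> z *\<^sub>R f z))"
  unfolding mu_eq
  by (subst integral_density)
     (auto simp: integral_restrict_space measurable_restrict_space1 mu_weight_nonneg[OF assms(2)]
       intro!: borel_measurable_scaleR borel_measurable_indicator)

lemma integral_mu_rotation: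
  fixes f :: "complex \<Rightarrow> complex"
  assumes [measurable]: "f \<in> borel_measurable borel" and \<alpha>: "\<alpha> > -1" and \<tau>: "cmod \<tau> = 1"
  shows "(LINT z|mu \<alpha>. f (\<tau> * z)) = (LINT z|mu \<alpha>. f z)"
proof -
  have w: "mu_weight \<alpha> (\<tau> * z) = mu_weight \<alpha> z" "indicator disk (\<tau> * z) = (indicator disk z :: real)" for z
    by (simp_all add: mu_weight_def norm_mult \<tau> indicator_def)
  have "(LINT z|mu \<alpha>. f z) = (LINT z|distr lborel borel ((*) \<tau>). indicator disk z *\<^sub>R (mu_weight \<alpha> z *\<^sub>R f z))"
    by (simp add: integral_mu \<alpha> lborel_distr_rotation[OF \<tau>])
  also have "\<dots> = (LINT z|lborel. indicator disk z *\<^sub>R (mu_weight \<alpha> z *\<^sub>R f (\<tau> * z)))"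
    by (subst integral_distr) (measurable, simp add: w)
  also have "\<dots> = (LINT z|mu \<alpha>. f (\<tau> * z))"
    by (simp add: integral_mu \<alpha>)
  finally show ?thesis ..
qed

text \<open>A rotation by the angle \<open>pi / (a - b)\<close> changes the sign of the integrand,
  so the integral equals its own negative. The radial factor \<open>r\<close> serves for powers of
  the weight and for the indicators of smaller disks.\<close>

lemma integral_mu_monomial_eq_0:
  assumes [measurable]: "r \<in> borel_measurable borel" and \<alpha>: "\<alpha> > -1" and "a \<noteq> b"
  shows "(LINT z|mu \<alpha>. r (cmod z) * (z ^ a * cnj z ^ b)) = 0"
proof -
  define I where "I = (LINT z|mu \<alpha>. r (cmod z) * (z ^ a * cnj z ^ b))"
  obtain \<tau> where \<tau>: "cmod \<tau> = 1" "\<tau> ^ a * cnj \<tau> ^ b = -1"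
  proof (cases "a > b")
    case True
    define \<tau> where "\<tau> = cis (pi / (a - b))"
    have "\<tau> ^ a * cnj \<tau> ^ b = \<tau> ^ (a - b) * (\<tau> * cnj \<tau>) ^ b"
      using True by (simp add: power_mult_distrib power_add[symmetric] flip: mult.assoc)
    also have "\<tau> * cnj \<tau> = 1"
      by (simp add: \<tau>_def cis_cnj cis_mult)
    also have "\<tau> ^ (a - b) = -1"
      using True by (simp add: \<tau>_def Complex.DeMoivre of_nat_diff)
    finally show ?thesis
      using that[of \<tau>] by (simp add: \<tau>_def)
  next
    case False
    then have ab: "b > a" using \<open>a \<noteq> b\<close> by simp
    define \<tau> where "\<tau> = cis (pi / (b - a))"
    have "\<tau> ^ a * cnj \<tau> ^ b = cnj \<tau> ^ (b - a) * (\<tau> * cnj \<tau>) ^ a"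
      using ab by (simp add: power_mult_distrib power_add[symmetric] mult_ac)
    also have "\<tau> * cnj \<tau> = 1"
      by (simp add: \<tau>_def cis_cnj cis_mult)
    also have "cnj \<tau> ^ (b - a) = -1"
      using ab by (simp add: \<tau>_def Complex.DeMoivre of_nat_diff flip: complex_cnj_power)
    finally show ?thesis
      using that[of \<tau>] by (simp add: \<tau>_def)
  qed
  have "I = (LINT z|mu \<alpha>. r (cmod (\<tau> * z)) * ((\<tau> * z) ^ a * cnj (\<tau> * z) ^ b))"
    unfolding I_def by (rule integral_mu_rotation[OF _ \<alpha> \<tau>(1), symmetric]) measurable
  also have "\<dots> = (LINT z|mu \<alpha>. (\<tau> ^ a * cnj \<tau> ^ b) * (r (cmod z) * (z ^ a * cnj z ^ b)))"
    by (simp add: norm_mult \<tau>(1) power_mult_distrib mult_ac)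
  also have "\<dots> = - I"
    unfolding I_def \<tau>(2) by simp
  finally show ?thesis
    unfolding I_def by simp
qed

text \<open>The integral of \<open>((cmod z)\<^sup>2) ^ s * (1 - (cmod z)\<^sup>2) ^ j\<close>
  against \<open>mu \<alpha>\<close>: with \<open>t\<close> for the squared modulus it becomes a
  Beta integral.\<close>

definition moment :: "real \<Rightarrow> nat \<Rightarrow> nat \<Rightarrow> real" where
  "moment \<alpha> j s = (\<alpha> + 1) * Beta (real s + 1) (\<alpha> + j + 1)"

lemma nn_integral_mu_radial:
  assumes \<alpha>: "\<alpha> > -1"
  shows "(\<integral>\<^sup>+z. ennreal (((cmod z)\<^sup>2) ^ s * (1 - (cmod z)\<^sup>2) ^ j) \<partial>mu \<alpha>) = ennreal (moment \<alpha> j s)"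
proof -
  let ?B = "\<lambda>t::real. t powr (real s + 1 - 1) * (1 - t) powr (\<alpha> + j + 1 - 1)"
  have "(?B has_integral Beta (real s + 1) (\<alpha> + j + 1)) {0..1}"
    using \<alpha> by (intro has_integral_Beta_real) auto
  then have B: "(\<integral>\<^sup>+t. ennreal (indicator {0..1} t * ?B t) \<partial>lborel) = ennreal (Beta (real s + 1) (\<alpha> + j + 1))"
    by (intro nn_integral_has_integral_lebesgue) auto
  have "(\<integral>\<^sup>+z. ennreal (((cmod z)\<^sup>2) ^ s * (1 - (cmod z)\<^sup>2) ^ j) \<partial>mu \<alpha>) =
     (\<integral>\<^sup>+z. indicator disk z * ennreal ((\<alpha> + 1) / pi * ((1 - (cmod z)\<^sup>2) powr \<alpha> *
       (((cmod z)\<^sup>2) ^ s * (1 - (cmod z)\<^sup>2) ^ j))) \<partial>lborel)"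
    using \<alpha> by (subst nn_integral_mu)
      (auto simp: mu_weight_def ennreal_mult'[symmetric] mult.assoc intro!: nn_integral_cong)
  also have "\<dots> = (\<integral>\<^sup>+t. ennreal pi * indicator {0<..<1} t *
      ennreal ((\<alpha> + 1) / pi * ((1 - t) powr \<alpha> * (t ^ s * (1 - t) ^ j))) \<partial>lborel)"
    by (rule nn_integral_disk_radial) measurable
  also have "\<dots> = (\<integral>\<^sup>+t. ennreal (\<alpha> + 1) * ennreal (indicator {0..1} t * ?B t) \<partial>lborel)"
  proof (rule nn_integral_cong_AE)
    \<comment> \<open>The endpoints are discarded because the two intervals differ there and because
      \<open>0 powr 0 = 0\<close> whereas \<open>0 ^ 0 = 1\<close>.\<close>
    have "AE t in lborel. t \<noteq> (0::real) \<and> t \<noteq> 1"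
      using AE_lborel_singleton[of "0::real"] AE_lborel_singleton[of "1::real"] by eventually_elim auto
    then show "AE t in lborel. ennreal pi * indicator {0<..<1} t *
      ennreal ((\<alpha> + 1) / pi * ((1 - t) powr \<alpha> * (t ^ s * (1 - t) ^ j))) =
      ennreal (\<alpha> + 1) * ennreal (indicator {0..1} t * ?B t)"
    proof eventually_elim
      case (elim t)
      show ?case
      proof (cases "t \<in> {0<..<1}")
        case True
        then have "?B t = (1 - t) powr \<alpha> * (t ^ s * (1 - t) ^ j)"
          by (simp add: powr_realpow powr_add)
        then show ?thesis
          using True \<alpha> by (simp add: ennreal_mult'[symmetric])
      next
        case False
        then show ?thesis using elim by (auto simp: indicator_def)
      qed
    qed
  qed
  also have "\<dots> = ennreal (\<alpha> + 1) * ennreal (Beta (real s + 1) (\<alpha> + j + 1))"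
    by (subst nn_integral_cmult) (measurable, simp only: B)
  also have "\<dots> = ennreal (moment \<alpha> j s)"
    unfolding moment_def using \<alpha> by (simp add: ennreal_mult'[symmetric])
  finally show ?thesis .
qed

lemma moment_eq:
  assumes \<alpha>: "\<alpha> > -1"
  shows "moment \<alpha> j s = (\<alpha> + 1) * fact s * Gamma (\<alpha> + j + 1) / Gamma (\<alpha> + j + s + 2)"
proof -
  have "Gamma (real s + 1) = fact s"
    by (metis Gamma_fact add.commute)
  then show ?thesis
    unfolding moment_def Beta_def by (simp add: add_ac)
qed

lemma moment_pos: "\<alpha> > -1 \<Longrightarrow> moment \<alpha> j s > 0"
  unfolding moment_eq by (auto intro!: mult_pos_pos divide_pos_pos Gamma_real_pos)

lemma integral_mu_radial:
  assumes \<alpha>: "\<alpha> > -1"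
  shows "integrable (mu \<alpha>) (\<lambda>z. ((cmod z)\<^sup>2) ^ s * (1 - (cmod z)\<^sup>2) ^ j)"
    and "(LINT z|mu \<alpha>. ((cmod z)\<^sup>2) ^ s * (1 - (cmod z)\<^sup>2) ^ j) = moment \<alpha> j s"
proof -
  have "(\<lambda>z. ((cmod z)\<^sup>2) ^ s * (1 - (cmod z)\<^sup>2) ^ j) \<in> borel_measurable (mu \<alpha>)"
    by (rule borel_measurable_mu) measurable
  moreover have "AE z in mu \<alpha>. 0 \<le> ((cmod z)\<^sup>2) ^ s * (1 - (cmod z)\<^sup>2) ^ j"
    by (rule AE_I2) (simp add: abs_square_le_1 less_imp_le)
  ultimately show "integrable (mu \<alpha>) (\<lambda>z. ((cmod z)\<^sup>2) ^ s * (1 - (cmod z)\<^sup>2) ^ j)"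
    and "(LINT z|mu \<alpha>. ((cmod z)\<^sup>2) ^ s * (1 - (cmod z)\<^sup>2) ^ j) = moment \<alpha> j s"
    using nn_integral_eq_integrable[of "\<lambda>z. ((cmod z)\<^sup>2) ^ s * (1 - (cmod z)\<^sup>2) ^ j" "mu \<alpha>" "moment \<alpha> j s"]
      nn_integral_mu_radial[OF \<alpha>] moment_pos[OF \<alpha>] by (auto simp: less_imp_le)
qed

lemma finite_measure_mu:
  assumes \<alpha>: "\<alpha> > -1"
  shows "finite_measure (mu \<alpha>)"
proof
  \<comment> \<open>The total mass is the moment with \<open>s = j = 0\<close>.\<close>
  have "emeasure (mu \<alpha>) (space (mu \<alpha>)) = (\<integral>\<^sup>+z. ennreal (((cmod z)\<^sup>2) ^ 0 * (1 - (cmod z)\<^sup>2) ^ 0) \<partial>mu \<alpha>)"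
    by simp
  then show "emeasure (mu \<alpha>) (space (mu \<alpha>)) \<noteq> \<infinity>"
    unfolding nn_integral_mu_radial[OF \<alpha>] by simp
qed

text \<open>The set where \<open>g\<close> is nonzero is open and the density is positive, so if
  nonempty it would contain a ball of positive measure. This is the passage from vanishing norm to
  pointwise equality.\<close>

lemma continuous_AE_mu_zero:
  fixes g :: "complex \<Rightarrow> complex"
  assumes \<alpha>: "\<alpha> > -1" and g: "continuous_on disk g" and ae: "AE z in mu \<alpha>. g z = 0" and z: "z \<in> disk"
  shows "g z = 0"
proof (rule ccontr)
  assume nz: "g z \<noteq> 0"
  define U where "U = {w \<in> disk. g w \<noteq> 0}"
  have "open U"
    unfolding U_def using continuous_open_preimage[OF g open_ball open_delete[OF open_UNIV, of 0]]
    by (auto simp: vimage_def Int_def)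
  then have Um: "U \<in> sets borel" by simp
  have sub: "U \<subseteq> disk" by (auto simp: U_def)
  have "AE w in restrict_space lborel disk. 0 < ennreal (mu_weight \<alpha> w) \<longrightarrow> g w = 0"
    using ae unfolding mu_eq by (subst (asm) AE_density) (auto intro!: measurable_restrict_space1)
  with AE_space have "AE w in restrict_space lborel disk. g w = 0"
  proof eventually_elim
    case (elim w)
    then show ?case
      using mu_weight_pos[OF \<alpha>, of w] by (simp add: space_restrict_space)
  qed
  then have "AE w in lborel. w \<in> disk \<longrightarrow> g w = 0"
    by (subst (asm) AE_restrict_space_iff) auto
  then have "AE w in lborel. w \<notin> U"
    by eventually_elim (auto simp: U_def)
  then have "emeasure lborel U = 0"
    using Um by (subst (asm) AE_iff_measurable[OF _ refl]) auto
  moreover have "emeasure lborel U > 0"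
  proof -
    from \<open>open U\<close> nz z obtain e where e: "e > 0" "ball z e \<subseteq> U"
      unfolding U_def by (metis (mono_tags, lifting) mem_Collect_eq openE)
    have "0 < emeasure lborel (ball z e)"
      using e(1) by (simp add: emeasure_ball ennreal_zero_less_mult_iff unit_ball_vol_2)
    also have "\<dots> \<le> emeasure lborel U"
      using e(2) Um by (intro emeasure_mono) auto
    finally show ?thesis .
  qed
  ultimately show False by simp
qed

section \<open>The weighted $L^2$ space\<close>

definition L2 :: "real \<Rightarrow> (complex \<Rightarrow> complex) set" where
  "L2 \<alpha> = {f \<in> borel_measurable (mu \<alpha>). integrable (mu \<alpha>) (\<lambda>z. (cmod (f z))\<^sup>2)}"

lemma L2_integrable_inner:
  assumes "f \<in> L2 \<alpha>" "g \<in> L2 \<alpha>"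
  shows "integrable (mu \<alpha>) (\<lambda>z. f z * cnj (g z))"
proof (rule Bochner_Integration.integrable_bound)
  show "integrable (mu \<alpha>) (\<lambda>z. (cmod (f z))\<^sup>2 + (cmod (g z))\<^sup>2)"
    using assms by (auto simp: L2_def)
  have [measurable]: "f \<in> borel_measurable (mu \<alpha>)" "g \<in> borel_measurable (mu \<alpha>)"
    using assms by (auto simp: L2_def)
  show "(\<lambda>z. f z * cnj (g z)) \<in> borel_measurable (mu \<alpha>)"
    by measurable
  have "cmod (f z) * cmod (g z) \<le> (cmod (f z))\<^sup>2 + (cmod (g z))\<^sup>2" for z
  proof -
    have "0 \<le> cmod (f z) * cmod (g z)" by simp
    then show ?thesis
      using sum_squares_bound[of "cmod (f z)" "cmod (g z)"] by linarith
  qed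
  then show "AE z in mu \<alpha>. norm (f z * cnj (g z)) \<le> norm ((cmod (f z))\<^sup>2 + (cmod (g z))\<^sup>2)"
    by (simp add: norm_mult)
qed

lemma L2_cmult:
  assumes "f \<in> L2 \<alpha>"
  shows "(\<lambda>z. c * f z) \<in> L2 \<alpha>"
  using assms by (auto simp: L2_def norm_mult power_mult_distrib)

lemma L2_zero: "(\<lambda>z. 0) \<in> L2 \<alpha>"
  by (simp add: L2_def)

lemma L2_add:
  assumes "f \<in> L2 \<alpha>" "g \<in> L2 \<alpha>"
  shows "(\<lambda>z. f z + g z) \<in> L2 \<alpha>"
proof -
  have [measurable]: "f \<in> borel_measurable (mu \<alpha>)" "g \<in> borel_measurable (mu \<alpha>)"
    using assms by (auto simp: L2_def)
  have "integrable (mu \<alpha>) (\<lambda>z. (cmod (f z + g z))\<^sup>2)"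
  proof (rule Bochner_Integration.integrable_bound)
    show "integrable (mu \<alpha>) (\<lambda>z. 2 * (cmod (f z))\<^sup>2 + 2 * (cmod (g z))\<^sup>2)"
      using assms by (auto simp: L2_def)
    have "(cmod (f z + g z))\<^sup>2 \<le> 2 * (cmod (f z))\<^sup>2 + 2 * (cmod (g z))\<^sup>2" for z
    proof -
      have "(cmod (f z + g z))\<^sup>2 \<le> (cmod (f z) + cmod (g z))\<^sup>2"
        by (intro power_mono norm_triangle_ineq) simp
      also have "\<dots> \<le> 2 * (cmod (f z))\<^sup>2 + 2 * (cmod (g z))\<^sup>2"
        using sum_squares_bound[of "cmod (f z)" "cmod (g z)"] by (simp add: power2_sum)
      finally show ?thesis .
    qed
    then show "AE z in mu \<alpha>. norm ((cmod (f z + g z))\<^sup>2) \<le> norm (2 * (cmod (f z))\<^sup>2 + 2 * (cmod (g z))\<^sup>2)"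
      by simp
  qed measurable
  then show ?thesis
    by (simp add: L2_def)
qed

lemma L2_diff: "f \<in> L2 \<alpha> \<Longrightarrow> g \<in> L2 \<alpha> \<Longrightarrow> (\<lambda>z. f z - g z) \<in> L2 \<alpha>"
  using L2_add[OF _ L2_cmult[of g \<alpha> "-1"], of f] by simp

lemma L2_sum:
  assumes "\<And>i. i \<in> I \<Longrightarrow> f i \<in> L2 \<alpha>"
  shows "(\<lambda>z. \<Sum>i\<in>I. f i z) \<in> L2 \<alpha>"
  using assms by (induction I rule: infinite_finite_induct) (simp_all add: L2_zero L2_add)

lemma L2_bounded:
  assumes \<alpha>: "\<alpha> > -1" and m: "f \<in> borel_measurable (mu \<alpha>)" and b: "\<And>z. z \<in> disk \<Longrightarrow> cmod (f z) \<le> B"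
  shows "f \<in> L2 \<alpha>"
proof -
  interpret finite_measure "mu \<alpha>" by (rule finite_measure_mu[OF \<alpha>])
  have "integrable (mu \<alpha>) (\<lambda>z. (cmod (f z))\<^sup>2)"
  proof (rule integrable_const_bound)
    show "AE z in mu \<alpha>. norm ((cmod (f z))\<^sup>2) \<le> B\<^sup>2"
      using b by (intro AE_I2) (auto intro: power_mono)
    show "(\<lambda>z. (cmod (f z))\<^sup>2) \<in> borel_measurable (mu \<alpha>)"
      using m by measurable
  qed
  then show ?thesis
    using m by (simp add: L2_def)
qed

lemma L2_inner_cnj: "L2_inner \<alpha> g f = cnj (L2_inner \<alpha> f g)"
  unfolding L2_inner_def by (subst Bochner_Integration.integral_cnj[symmetric]) (simp add: mult.commute)

lemma L2_inner_add_left: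
  "f \<in> L2 \<alpha> \<Longrightarrow> g \<in> L2 \<alpha> \<Longrightarrow> h \<in> L2 \<alpha> \<Longrightarrow>
    L2_inner \<alpha> (\<lambda>z. f z + g z) h = L2_inner \<alpha> f h + L2_inner \<alpha> g h"
  unfolding L2_inner_def by (simp add: distrib_right L2_integrable_inner)

lemma L2_inner_diff_left:
  "f \<in> L2 \<alpha> \<Longrightarrow> g \<in> L2 \<alpha> \<Longrightarrow> h \<in> L2 \<alpha> \<Longrightarrow>
    L2_inner \<alpha> (\<lambda>z. f z - g z) h = L2_inner \<alpha> f h - L2_inner \<alpha> g h"
  unfolding L2_inner_def by (simp add: left_diff_distrib L2_integrable_inner)

lemma L2_inner_cmult_left: "L2_inner \<alpha> (\<lambda>z. c * f z) h = c * L2_inner \<alpha> f h"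
  unfolding L2_inner_def by (simp add: mult.assoc)

lemma L2_inner_cmult_right: "L2_inner \<alpha> f (\<lambda>z. c * h z) = cnj c * L2_inner \<alpha> f h"
  by (subst (1 2) L2_inner_cnj) (simp add: L2_inner_cmult_left)

lemma L2_inner_sum_left:
  assumes "\<And>i. i \<in> I \<Longrightarrow> f i \<in> L2 \<alpha>" "h \<in> L2 \<alpha>"
  shows "L2_inner \<alpha> (\<lambda>z. \<Sum>i\<in>I. f i z) h = (\<Sum>i\<in>I. L2_inner \<alpha> (f i) h)"
  using assms
proof (induction I rule: infinite_finite_induct)
  case (insert x F)
  then show ?case by (simp add: L2_inner_add_left L2_sum)
qed (simp_all add: L2_inner_def)

lemma L2_inner_sum_right:
  assumes "\<And>i. i \<in> I \<Longrightarrow> f i \<in> L2 \<alpha>" "h \<in> L2 \<alpha>"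
  shows "L2_inner \<alpha> h (\<lambda>z. \<Sum>i\<in>I. f i z) = (\<Sum>i\<in>I. L2_inner \<alpha> h (f i))"
proof -
  have "L2_inner \<alpha> h (\<lambda>z. \<Sum>i\<in>I. f i z) = cnj (\<Sum>i\<in>I. L2_inner \<alpha> (f i) h)"
    by (subst L2_inner_cnj) (simp only: L2_inner_sum_left[OF assms])
  also have "\<dots> = (\<Sum>i\<in>I. L2_inner \<alpha> h (f i))"
    unfolding cnj_sum by (rule sum.cong[OF refl]) (rule L2_inner_cnj[symmetric])
  finally show ?thesis .
qed

lemma L2_norm_nonneg: "L2_norm \<alpha> f \<ge> 0"
  unfolding L2_norm_def by simp

lemma L2_norm_square: "(L2_norm \<alpha> f)\<^sup>2 = (LINT z|mu \<alpha>. (cmod (f z))\<^sup>2)"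
  unfolding L2_norm_def by simp

lemma L2_inner_self: "L2_inner \<alpha> f f = of_real ((L2_norm \<alpha> f)\<^sup>2)"
  unfolding L2_inner_def L2_norm_square
  by (subst integral_complex_of_real[symmetric])
     (simp add: complex_norm_square[symmetric])

lemma L2_norm_cmult: "L2_norm \<alpha> (\<lambda>z. c * f z) = cmod c * L2_norm \<alpha> f"
  unfolding L2_norm_def by (simp add: norm_mult power_mult_distrib real_sqrt_mult)

lemma L2_norm_diff_square:
  assumes "f \<in> L2 \<alpha>" "g \<in> L2 \<alpha>"
  shows "(L2_norm \<alpha> (\<lambda>z. f z - g z))\<^sup>2 =
    (L2_norm \<alpha> f)\<^sup>2 + (L2_norm \<alpha> g)\<^sup>2 - 2 * Re (L2_inner \<alpha> f g)"
proof -
  have "L2_inner \<alpha> (\<lambda>z. f z - g z) (\<lambda>z. f z - g z) =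
     L2_inner \<alpha> f (\<lambda>z. f z - g z) - L2_inner \<alpha> g (\<lambda>z. f z - g z)"
    using assms by (simp add: L2_inner_diff_left L2_diff)
  also have "\<dots> = cnj (L2_inner \<alpha> (\<lambda>z. f z - g z) f) - cnj (L2_inner \<alpha> (\<lambda>z. f z - g z) g)"
    by (metis L2_inner_cnj)
  also have "\<dots> = cnj (L2_inner \<alpha> f f - L2_inner \<alpha> g f) - cnj (L2_inner \<alpha> f g - L2_inner \<alpha> g g)"
    using assms by (simp add: L2_inner_diff_left)
  finally have "Re (L2_inner \<alpha> (\<lambda>z. f z - g z) (\<lambda>z. f z - g z)) = Re \<dots>"
    by (rule arg_cong)
  then show ?thesis
    unfolding L2_inner_self by (simp add: L2_inner_self L2_inner_cnj[of \<alpha> g f])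
qed

lemma L2_norm_0_AE:
  assumes "f \<in> L2 \<alpha>" "L2_norm \<alpha> f = 0"
  shows "AE z in mu \<alpha>. f z = 0"
proof -
  have "(LINT z|mu \<alpha>. (cmod (f z))\<^sup>2) = 0"
    using assms(2) L2_norm_square[of \<alpha> f] by simp
  then show ?thesis
    using assms(1) by (subst (asm) integral_nonneg_eq_0_iff_AE) (auto simp: L2_def)
qed

text \<open>Nonnegativity of the squared norm of \<open>f\<close> minus its projection on
  \<open>g\<close>. Functions are not identified almost everywhere, so a \<open>g\<close> of norm
  zero may be nonzero somewhere and is treated apart.\<close>

lemma L2_Cauchy_Schwarz:
  assumes "f \<in> L2 \<alpha>" "g \<in> L2 \<alpha>"
  shows "cmod (L2_inner \<alpha> f g) \<le> L2_norm \<alpha> f * L2_norm \<alpha> g"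
proof (cases "L2_norm \<alpha> g = 0")
  case True
  have "AE z in mu \<alpha>. f z * cnj (g z) = 0"
    using L2_norm_0_AE[OF assms(2) True] by eventually_elim simp
  then have "L2_inner \<alpha> f g = 0"
    unfolding L2_inner_def by (rule integral_eq_zero_AE)
  then show ?thesis by (simp add: True)
next
  case False
  then have pos: "L2_norm \<alpha> g > 0"
    using L2_norm_nonneg[of \<alpha> g] by simp
  define n where "n = L2_norm \<alpha> g"
  define t where "t = L2_inner \<alpha> f g"
  have "0 \<le> (L2_norm \<alpha> (\<lambda>z. f z - (t / n\<^sup>2) * g z))\<^sup>2" by simp
  also have "\<dots> = (L2_norm \<alpha> f)\<^sup>2 + (cmod (t / n\<^sup>2) * n)\<^sup>2 - 2 * Re (cnj (t / n\<^sup>2) * t)"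
    by (subst L2_norm_diff_square[OF assms(1) L2_cmult[OF assms(2)]])
       (simp only: L2_norm_cmult L2_inner_cmult_right n_def t_def)
  also have "Re (cnj (t / n\<^sup>2) * t) = (cmod t)\<^sup>2 / n\<^sup>2"
  proof -
    have "cnj (t / n\<^sup>2) * t = of_real ((cmod t)\<^sup>2 / n\<^sup>2)"
      by (simp add: complex_norm_square[symmetric] mult.commute del: of_real_power)
    then show ?thesis by (metis Re_complex_of_real)
  qed
  also have "(cmod (t / n\<^sup>2) * n)\<^sup>2 = (cmod t)\<^sup>2 / n\<^sup>2"
    using pos by (simp add: n_def norm_divide norm_power power_mult_distrib power_divide field_simps)
  finally have "(cmod t)\<^sup>2 / n\<^sup>2 \<le> (L2_norm \<alpha> f)\<^sup>2"
    by simp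
  then have "(cmod t)\<^sup>2 \<le> (L2_norm \<alpha> f * n)\<^sup>2"
    using pos by (simp add: n_def field_simps)
  then show ?thesis
    unfolding t_def n_def using L2_norm_nonneg by (metis power2_le_imp_le mult_nonneg_nonneg)
qed

section \<open>Orthonormal series\<close>

locale orthonormal_seq =
  fixes \<alpha> :: real and e :: "nat \<Rightarrow> complex \<Rightarrow> complex"
  assumes e_L2: "e p \<in> L2 \<alpha>"
    and e_inner: "L2_inner \<alpha> (e p) (e q) = (if p = q then 1 else 0)"
begin

lemma comb_L2: "(\<lambda>z. \<Sum>p\<in>I. c p * e p z) \<in> L2 \<alpha>"
  by (intro L2_sum L2_cmult e_L2)

lemma inner_comb_left: 
  assumes "g \<in> L2 \<alpha>"
  shows "L2_inner \<alpha> (\<lambda>z. \<Sum>p\<in>I. c p * e p z) g = (\<Sum>p\<in>I. c p * L2_inner \<alpha> (e p) g)"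
  using assms by (simp add: L2_inner_sum_left L2_cmult e_L2 L2_inner_cmult_left)

lemma norm_comb:
  assumes "finite I"
  shows "(L2_norm \<alpha> (\<lambda>z. \<Sum>p\<in>I. c p * e p z))\<^sup>2 = (\<Sum>p\<in>I. (cmod (c p))\<^sup>2)"
proof -
  have "L2_inner \<alpha> (e p) (\<lambda>z. \<Sum>p\<in>I. c p * e p z) = cnj (c p)" if "p \<in> I" for p
    using that assms
    by (simp add: L2_inner_sum_right L2_cmult e_L2 L2_inner_cmult_right e_inner if_distrib cong: if_cong)
  then have "L2_inner \<alpha> (\<lambda>z. \<Sum>p\<in>I. c p * e p z) (\<lambda>z. \<Sum>p\<in>I. c p * e p z) = (\<Sum>p\<in>I. c p * cnj (c p))"
    by (simp add: inner_comb_left comb_L2)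
  also have "\<dots> = of_real (\<Sum>p\<in>I. (cmod (c p))\<^sup>2)"
    unfolding of_real_sum complex_norm_square ..
  finally show ?thesis
    unfolding L2_inner_self by (simp only: of_real_eq_iff)
qed

lemma Bessel:
  assumes "f \<in> L2 \<alpha>"
  shows "summable (\<lambda>p. (cmod (L2_inner \<alpha> f (e p)))\<^sup>2)"
proof (rule summableI_nonneg_bounded)
  fix N
  let ?c = "\<lambda>p. L2_inner \<alpha> f (e p)"
  let ?S = "\<lambda>z. \<Sum>p<N. ?c p * e p z"
  have "L2_inner \<alpha> f ?S = cnj (L2_inner \<alpha> ?S f)"
    by (rule L2_inner_cnj)
  also have "\<dots> = (\<Sum>p<N. cnj (?c p) * ?c p)"
    using assms by (simp add: inner_comb_left L2_inner_cnj[of \<alpha> "e _" f])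
  also have "\<dots> = of_real (\<Sum>p<N. (cmod (?c p))\<^sup>2)"
    unfolding of_real_sum complex_norm_square by (rule sum.cong[OF refl]) (rule mult.commute)
  finally have "Re (L2_inner \<alpha> f ?S) = (\<Sum>p<N. (cmod (?c p))\<^sup>2)"
    by (metis Re_complex_of_real)
  then have "(L2_norm \<alpha> (\<lambda>z. f z - ?S z))\<^sup>2 = (L2_norm \<alpha> f)\<^sup>2 - (\<Sum>p<N. (cmod (?c p))\<^sup>2)"
    by (simp add: L2_norm_diff_square[OF assms comb_L2] norm_comb)
  then show "(\<Sum>p<N. (cmod (?c p))\<^sup>2) \<le> (L2_norm \<alpha> f)\<^sup>2"
    using zero_le_power2[of "L2_norm \<alpha> (\<lambda>z. f z - ?S z)"] by linarith
qed simp

text \<open>The limit \<open>F\<close> is given pointwise. For fixed \<open>N\<close>, Fatou's lemma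
  is applied to the squared distances of later partial sums from the \<open>N\<close>-th one, whose
  integrals are finite sums of squared coefficients bounded by the tail.\<close>

lemma
  assumes c: "summable (\<lambda>p. (cmod (c p))\<^sup>2)"
    and F: "\<And>z. z \<in> disk \<Longrightarrow> (\<lambda>p. c p * e p z) sums F z"
  shows series_L2: "F \<in> L2 \<alpha>"
    and series_tail: "(L2_norm \<alpha> (\<lambda>z. F z - (\<Sum>p<N. c p * e p z)))\<^sup>2 \<le> (\<Sum>p. (cmod (c (p + N)))\<^sup>2)"
proof -
  define S where "S N z = (\<Sum>p<N. c p * e p z)" for N z
  have [measurable]: "e p \<in> borel_measurable (mu \<alpha>)" for p
    using e_L2 by (simp add: L2_def)
  have Sm [measurable]: "S N \<in> borel_measurable (mu \<alpha>)" for N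
    unfolding S_def by measurable
  have lim: "(\<lambda>M. S M z) \<longlonglongrightarrow> F z" if "z \<in> disk" for z
    using F[OF that] unfolding sums_def S_def .
  have Fm [measurable]: "F \<in> borel_measurable (mu \<alpha>)"
    by (rule borel_measurable_LIMSEQ_metric[of S]) (auto simp: lim)
  have key: "(\<integral>\<^sup>+z. ennreal ((cmod (F z - S N z))\<^sup>2) \<partial>mu \<alpha>) \<le> ennreal (\<Sum>p. (cmod (c (p + N)))\<^sup>2)" for N
  proof -
    let ?T = "ennreal (\<Sum>p. (cmod (c (p + N)))\<^sup>2)"
    have "(\<integral>\<^sup>+z. ennreal ((cmod (F z - S N z))\<^sup>2) \<partial>mu \<alpha>) =
        (\<integral>\<^sup>+z. liminf (\<lambda>M. ennreal ((cmod (S M z - S N z))\<^sup>2)) \<partial>mu \<alpha>)"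
    proof (rule nn_integral_cong)
      fix z assume "z \<in> space (mu \<alpha>)"
      then have "(\<lambda>M. ennreal ((cmod (S M z - S N z))\<^sup>2)) \<longlonglongrightarrow> ennreal ((cmod (F z - S N z))\<^sup>2)"
        by (intro tendsto_intros lim) simp
      then show "ennreal ((cmod (F z - S N z))\<^sup>2) = liminf (\<lambda>M. ennreal ((cmod (S M z - S N z))\<^sup>2))"
        using lim_imp_Liminf[OF sequentially_bot] by metis
    qed
    also have "\<dots> \<le> liminf (\<lambda>M. \<integral>\<^sup>+z. ennreal ((cmod (S M z - S N z))\<^sup>2) \<partial>mu \<alpha>)"
      by (rule nn_integral_liminf) measurable
    also have "\<dots> \<le> limsup (\<lambda>M. \<integral>\<^sup>+z. ennreal ((cmod (S M z - S N z))\<^sup>2) \<partial>mu \<alpha>)"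
      by (rule Liminf_le_Limsup) simp
    also have "\<dots> \<le> ?T"
    proof (rule Limsup_bounded, rule eventually_sequentiallyI[of N])
      fix M assume M: "N \<le> M"
      have eq: "S M z - S N z = (\<Sum>p\<in>{N..<M}. c p * e p z)" for z
        unfolding S_def lessThan_atLeast0 using sum_diff_nat_ivl[OF le0 M] by simp
      have "(\<integral>\<^sup>+z. ennreal ((cmod (S M z - S N z))\<^sup>2) \<partial>mu \<alpha>) = 
          ennreal (LINT z|mu \<alpha>. (cmod (S M z - S N z))\<^sup>2)"
        unfolding eq using comb_L2[of c "{N..<M}"] by (intro nn_integral_eq_integral) (auto simp: L2_def)
      also have "\<dots> = ennreal (\<Sum>p\<in>{N..<M}. (cmod (c p))\<^sup>2)"
        unfolding eq L2_norm_square[symmetric] by (simp add: norm_comb)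
      also have "(\<Sum>p\<in>{N..<M}. (cmod (c p))\<^sup>2) = (\<Sum>p<M - N. (cmod (c (p + N)))\<^sup>2)"
        using sum.shift_bounds_nat_ivl[of "\<lambda>p. (cmod (c p))\<^sup>2" 0 N "M - N"] M by (simp add: lessThan_atLeast0)
      also have "\<dots> \<le> (\<Sum>p. (cmod (c (p + N)))\<^sup>2)"
        using c by (intro sum_le_suminf summable_ignore_initial_segment) auto
      finally show "(\<integral>\<^sup>+z. ennreal ((cmod (S M z - S N z))\<^sup>2) \<partial>mu \<alpha>) \<le> ?T"
        by (simp add: ennreal_leI)
    qed
    finally show ?thesis .
  qed
  have D: "(\<lambda>z. F z - S N z) \<in> L2 \<alpha>" for N
  proof -
    have "integrable (mu \<alpha>) (\<lambda>z. (cmod (F z - S N z))\<^sup>2)"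
      using key[of N] by (intro integrableI_bounded) (auto simp: le_less_trans)
    then show ?thesis by (simp add: L2_def)
  qed
  \<comment> \<open>With \<open>N = 0\<close> the subtracted partial sum is empty.\<close>
  show "F \<in> L2 \<alpha>"
    using D[of 0] by (simp add: S_def)
  show "(L2_norm \<alpha> (\<lambda>z. F z - (\<Sum>p<N. c p * e p z)))\<^sup>2 \<le> (\<Sum>p. (cmod (c (p + N)))\<^sup>2)"
  proof -
    have "(\<integral>\<^sup>+z. ennreal ((cmod (F z - S N z))\<^sup>2) \<partial>mu \<alpha>) = ennreal ((L2_norm \<alpha> (\<lambda>z. F z - S N z))\<^sup>2)"
      unfolding L2_norm_square using D[of N] by (intro nn_integral_eq_integral) (auto simp: L2_def)
    moreover have "0 \<le> (\<Sum>p. (cmod (c (p + N)))\<^sup>2)"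
      using summable_ignore_initial_segment[OF c, of N] by (intro suminf_nonneg) auto
    ultimately show ?thesis
      using key[of N] by (simp add: S_def ennreal_le_iff)
  qed
qed

lemma series_tendsto:
  assumes c: "summable (\<lambda>p. (cmod (c p))\<^sup>2)"
    and F: "\<And>z. z \<in> disk \<Longrightarrow> (\<lambda>p. c p * e p z) sums F z"
  shows "(\<lambda>N. L2_norm \<alpha> (\<lambda>z. F z - (\<Sum>p<N. c p * e p z))) \<longlonglongrightarrow> 0"
proof -
  have "(\<lambda>N. (L2_norm \<alpha> (\<lambda>z. F z - (\<Sum>p<N. c p * e p z)))\<^sup>2) \<longlonglongrightarrow> 0"
    by (rule tendsto_sandwich[OF _ _ tendsto_const suminf_exist_split2[OF c]];
        intro always_eventually allI series_tail[OF c F]) auto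
  then have "(\<lambda>N. sqrt ((L2_norm \<alpha> (\<lambda>z. F z - (\<Sum>p<N. c p * e p z)))\<^sup>2)) \<longlonglongrightarrow> sqrt 0"
    by (rule tendsto_real_sqrt)
  then show ?thesis
    by (simp add: L2_norm_nonneg)
qed

lemma series_inner:
  assumes c: "summable (\<lambda>p. (cmod (c p))\<^sup>2)"
    and F: "\<And>z. z \<in> disk \<Longrightarrow> (\<lambda>p. c p * e p z) sums F z"
    and g: "g \<in> L2 \<alpha>"
  shows "(\<lambda>p. c p * L2_inner \<alpha> (e p) g) sums L2_inner \<alpha> F g"
proof -
  let ?S = "\<lambda>N z. \<Sum>p<N. c p * e p z"
  have FL: "F \<in> L2 \<alpha>" by (rule series_L2[OF c F])
  have "(\<lambda>N. L2_norm \<alpha> (\<lambda>z. F z - ?S N z) * L2_norm \<alpha> g) \<longlonglongrightarrow> 0"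
    using tendsto_mult_right[OF series_tendsto[OF c F], of "L2_norm \<alpha> g"] by simp
  then have "(\<lambda>N. L2_inner \<alpha> F g - L2_inner \<alpha> (?S N) g) \<longlonglongrightarrow> 0"
  proof (rule Lim_null_comparison[rotated], intro always_eventually allI)
    fix N
    show "norm (L2_inner \<alpha> F g - L2_inner \<alpha> (?S N) g) \<le> L2_norm \<alpha> (\<lambda>z. F z - ?S N z) * L2_norm \<alpha> g"
      using L2_Cauchy_Schwarz[OF L2_diff[OF FL comb_L2] g] by (simp add: L2_inner_diff_left FL comb_L2 g)
  qed
  then have "(\<lambda>N. L2_inner \<alpha> (?S N) g) \<longlonglongrightarrow> L2_inner \<alpha> F g"
    by (rule Lim_transform2[rotated]) (rule tendsto_const)
  then show ?thesis
    unfolding sums_def by (simp add: inner_comb_left g)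
qed

lemma series_coeff:
  assumes c: "summable (\<lambda>p. (cmod (c p))\<^sup>2)"
    and F: "\<And>z. z \<in> disk \<Longrightarrow> (\<lambda>p. c p * e p z) sums F z"
  shows "L2_inner \<alpha> F (e q) = c q"
proof -
  have "(\<lambda>p. c p * (if p = q then 1 else 0)) sums L2_inner \<alpha> F (e q)"
    using series_inner[OF c F e_L2[of q]] by (simp add: e_inner)
  moreover have "(\<lambda>p. c p * (if p = q then 1 else 0)) sums c q"
    using sums_single[of q c] by (simp add: if_distrib cong: if_cong)
  ultimately show ?thesis
    by (rule sums_unique2)
qed

end

section \<open>Moments of polyanalytic functions\<close>

abbreviation cmonom :: "nat \<Rightarrow> nat \<Rightarrow> complex \<Rightarrow> complex" where
  "cmonom a b \<equiv> \<lambda>z. z ^ a * cnj z ^ b"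

lemma cmonom_L2:
  assumes "\<alpha> > -1"
  shows "cmonom a b \<in> L2 \<alpha>"
proof (rule L2_bounded[OF assms])
  show "cmonom a b \<in> borel_measurable (mu \<alpha>)"
    by (rule borel_measurable_mu) measurable
  show "cmod (cmonom a b z) \<le> 1" if "z \<in> disk" for z
    using that by (simp add: norm_mult norm_power mult_le_one power_le_one)
qed

lemma L2_cong: "(\<And>z. z \<in> disk \<Longrightarrow> f z = g z) \<Longrightarrow> f \<in> L2 \<alpha> \<longleftrightarrow> g \<in> L2 \<alpha>"
proof -
  assume eq: "\<And>z. z \<in> disk \<Longrightarrow> f z = g z"
  have "f \<in> borel_measurable (mu \<alpha>) \<longleftrightarrow> g \<in> borel_measurable (mu \<alpha>)"
    by (rule measurable_cong) (use eq in simp)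
  moreover have "integrable (mu \<alpha>) (\<lambda>z. (cmod (f z))\<^sup>2) \<longleftrightarrow> integrable (mu \<alpha>) (\<lambda>z. (cmod (g z))\<^sup>2)"
    by (rule Bochner_Integration.integrable_cong) (use eq in simp_all)
  ultimately show ?thesis
    by (simp add: L2_def)
qed

lemma L2_inner_cong:
  "(\<And>z. z \<in> disk \<Longrightarrow> f z = f' z) \<Longrightarrow> (\<And>z. z \<in> disk \<Longrightarrow> g z = g' z) \<Longrightarrow>
    L2_inner \<alpha> f g = L2_inner \<alpha> f' g'"
  unfolding L2_inner_def by (rule Bochner_Integration.integral_cong) simp_all

text \<open>The diagonal moment over the disk of radius \<open>r\<close>. Its exact value is never
  computed; only its limit as the radius tends to 1 enters.\<close>

definition trunc_moment :: "real \<Rightarrow> real \<Rightarrow> nat \<Rightarrow> complex" where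
  "trunc_moment \<alpha> r s = (LINT z|mu \<alpha>. of_real (indicator {..<r} (cmod z)) * (z ^ s * cnj z ^ s))"

text \<open>On the smaller disk the series converges absolutely and uniformly and may be integrated
  term by term; rotation invariance leaves only the term with \<open>j + b = s\<close>.\<close>

lemma integral_mu_trunc_power_series:
  assumes \<alpha>: "\<alpha> > -1" and r: "0 < r" "r < 1"
    and h: "\<And>z. z \<in> disk \<Longrightarrow> (\<lambda>j. c j * z ^ j) sums h z"
  shows "(LINT z|mu \<alpha>. of_real (indicator {..<r} (cmod z)) * (h z * (z ^ b * cnj z ^ s))) =
    (if b \<le> s then c (s - b) * trunc_moment \<alpha> r s else 0)"
    and "integrable (mu \<alpha>) (\<lambda>z. of_real (indicator {..<r} (cmod z)) * (h z * (z ^ b * cnj z ^ s)))"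
proof -
  interpret finite_measure "mu \<alpha>" by (rule finite_measure_mu[OF \<alpha>])
  define f where "f j z = complex_of_real (indicator {..<r} (cmod z)) * (c j * z ^ j * (z ^ b * cnj z ^ s))" for j z
  have [measurable]: "f j \<in> borel_measurable (mu \<alpha>)" for j
    unfolding f_def by (rule borel_measurable_mu) measurable
  \<comment> \<open>Convergence at the larger radius \<open>r'\<close> gives absolute convergence at
    \<open>r\<close>, hence a summable majorant on the truncated disk.\<close>
  obtain r' where r': "r < r'" "r' < 1" using r(2) dense by blast
  have "summable (\<lambda>j. c j * of_real r' ^ j)"
    using h[of "of_real r'"] r r' sums_summable by force
  then have sr: "summable (\<lambda>j. cmod (c j * of_real r ^ j))"
    by (rule powser_insidea) (use r r' in simp)
  have bnd: "cmod (f j z) \<le> cmod (c j * of_real r ^ j)" if z: "z \<in> disk" for j z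
  proof (cases "cmod z < r")
    case True
    have "cmod (f j z) = cmod (c j) * cmod z ^ j * (cmod z ^ b * cmod z ^ s)"
      using True by (simp add: f_def norm_mult norm_power)
    also have "\<dots> \<le> cmod (c j) * r ^ j * (1 * 1)"
      using True z r by (intro mult_mono power_mono) (auto simp: power_le_one)
    finally show ?thesis
      using r by (simp add: norm_mult norm_power)
  next
    case False
    then show ?thesis by (simp add: f_def)
  qed
  have int: "integrable (mu \<alpha>) (f j)" for j
    by (rule integrable_const_bound[where B = "cmod (c j * of_real r ^ j)"]) (auto intro!: AE_I2 bnd)
  have sum1: "AE z in mu \<alpha>. summable (\<lambda>j. norm (f j z))"
    by (rule AE_I2) (rule summable_comparison_test'[OF sr], simp add: bnd)
  have sum2: "summable (\<lambda>j. LINT z|mu \<alpha>. norm (f j z))"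
  proof (rule summable_comparison_test'[of "\<lambda>j. cmod (c j * of_real r ^ j) * measure (mu \<alpha>) (space (mu \<alpha>))" 0])
    show "summable (\<lambda>j. cmod (c j * of_real r ^ j) * measure (mu \<alpha>) (space (mu \<alpha>)))"
      by (rule summable_mult2[OF sr])
    fix j
    have "(LINT z|mu \<alpha>. norm (f j z)) \<le> (LINT z|mu \<alpha>. cmod (c j * of_real r ^ j))"
      using int by (intro integral_mono) (auto intro: bnd)
    then show "norm (LINT z|mu \<alpha>. norm (f j z)) \<le> cmod (c j * of_real r ^ j) * measure (mu \<alpha>) (space (mu \<alpha>))"
      by (simp add: integral_nonneg_AE mult.commute)
  qed
  have sumf: "(\<Sum>j. f j z) = of_real (indicator {..<r} (cmod z)) * (h z * (z ^ b * cnj z ^ s))" if "z \<in> disk" for z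
    unfolding f_def
    by (rule sums_unique[symmetric]) (intro sums_mult sums_mult2 h that)
  have "integrable (mu \<alpha>) (\<lambda>z. \<Sum>j. f j z)"
    by (rule integrable_suminf[OF int sum1 sum2])
  then show "integrable (mu \<alpha>) (\<lambda>z. of_real (indicator {..<r} (cmod z)) * (h z * (z ^ b * cnj z ^ s)))"
    by (rule Bochner_Integration.integrable_cong[THEN iffD1, rotated -1]) (simp_all add: sumf)
  have summand: "(LINT z|mu \<alpha>. f j z) = (if j + b = s then c j * trunc_moment \<alpha> r s else 0)" for j
  proof -
    have "(LINT z|mu \<alpha>. f j z) = c j * (LINT z|mu \<alpha>. of_real (indicator {..<r} (cmod z)) * (z ^ (j + b) * cnj z ^ s))"
      unfolding f_def integral_mult_right_zero[symmetric] by (simp add: power_add mult_ac)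
    also have "(LINT z|mu \<alpha>. of_real (indicator {..<r} (cmod z)) * (z ^ (j + b) * cnj z ^ s)) =
        (if j + b = s then trunc_moment \<alpha> r s else 0)"
      using integral_mu_monomial_eq_0[OF _ \<alpha>, of "\<lambda>x. of_real (indicator {..<r} x)" "j + b" s]
      by (auto simp: trunc_moment_def)
    finally show ?thesis by simp
  qed
  have "(\<lambda>j. LINT z|mu \<alpha>. f j z) sums (LINT z|mu \<alpha>. (\<Sum>j. f j z))"
    by (rule sums_integral[OF int sum1 sum2])
  also have "(LINT z|mu \<alpha>. (\<Sum>j. f j z)) = (LINT z|mu \<alpha>. of_real (indicator {..<r} (cmod z)) * (h z * (z ^ b * cnj z ^ s)))"
    by (rule Bochner_Integration.integral_cong) (simp_all add: sumf)
  finally have s: "(\<lambda>j. if j + b = s then c j * trunc_moment \<alpha> r s else 0) sums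
      (LINT z|mu \<alpha>. of_real (indicator {..<r} (cmod z)) * (h z * (z ^ b * cnj z ^ s)))"
    by (simp only: summand)
  moreover have "(\<lambda>j. if j + b = s then c j * trunc_moment \<alpha> r s else 0) sums
      (if b \<le> s then c (s - b) * trunc_moment \<alpha> r s else 0)"
  proof (cases "b \<le> s")
    case True
    then have "(\<lambda>j. if j + b = s then c j * trunc_moment \<alpha> r s else 0) =
        (\<lambda>j. if j = s - b then c j * trunc_moment \<alpha> r s else 0)"
      by (auto simp: fun_eq_iff)
    then show ?thesis
      using sums_single[of "s - b" "\<lambda>j. c j * trunc_moment \<alpha> r s"] True by simp
  next
    case False
    then have "(\<lambda>j. if j + b = s then c j * trunc_moment \<alpha> r s else 0) = (\<lambda>j. 0)"
      by (auto simp: fun_eq_iff)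
    then show ?thesis using False by simp
  qed
  ultimately show "(LINT z|mu \<alpha>. of_real (indicator {..<r} (cmod z)) * (h z * (z ^ b * cnj z ^ s))) =
    (if b \<le> s then c (s - b) * trunc_moment \<alpha> r s else 0)"
    by (rule sums_unique2)
qed

lemma cmonom_integrable:
  assumes "\<alpha> > -1"
  shows "integrable (mu \<alpha>) (cmonom a b)"
  using L2_integrable_inner[OF cmonom_L2[OF assms, of a b] cmonom_L2[OF assms, of 0 0]] by simp

lemma trunc_indicator_tendsto:
  assumes "z \<in> disk"
  shows "(\<lambda>n. complex_of_real (indicator {..<1 - 1 / real (n + 2)} (cmod z)) * w) \<longlonglongrightarrow> w"
proof -
  have "(\<lambda>n. 1 - 1 / real (n + 2)) \<longlonglongrightarrow> 1 - 0"
    by (intro tendsto_diff tendsto_const LIMSEQ_ignore_initial_segment[OF lim_inverse_n', of 2])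
  then have "eventually (\<lambda>n. 1 - 1 / real (n + 2) > cmod z) sequentially"
    using assms by (intro order_tendstoD) auto
  then have "eventually (\<lambda>n. complex_of_real (indicator {..<1 - 1 / real (n + 2)} (cmod z)) * w = w) sequentially"
    by eventually_elim simp
  then show ?thesis
    by (rule tendsto_eventually)
qed

lemma trunc_integral_tendsto:
  fixes F :: "complex \<Rightarrow> complex"
  assumes "integrable (mu \<alpha>) F"
  shows "(\<lambda>n. LINT z|mu \<alpha>. of_real (indicator {..<1 - 1 / real (n + 2)} (cmod z)) * F z) \<longlonglongrightarrow>
    (LINT z|mu \<alpha>. F z)"
proof (rule integral_dominated_convergence[where w = "\<lambda>z. cmod (F z)"])
  have [measurable]: "F \<in> borel_measurable (mu \<alpha>)"
    using assms by (rule borel_measurable_integrable)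
  show "F \<in> borel_measurable (mu \<alpha>)" by fact
  fix n
  have [measurable]: "(\<lambda>z. complex_of_real (indicator {..<1 - 1 / real (n + 2)} (cmod z))) \<in> borel_measurable (mu \<alpha>)"
    by (rule borel_measurable_mu) measurable
  show "(\<lambda>z. of_real (indicator {..<1 - 1 / real (n + 2)} (cmod z)) * F z) \<in> borel_measurable (mu \<alpha>)"
    by measurable
next
  show "AE z in mu \<alpha>. (\<lambda>n. of_real (indicator {..<1 - 1 / real (n + 2)} (cmod z)) * F z) \<longlonglongrightarrow> F z"
    by (rule AE_I2) (rule trunc_indicator_tendsto, simp)
  show "AE z in mu \<alpha>. norm (of_real (indicator {..<1 - 1 / real (n + 2)} (cmod z)) * F z) \<le> cmod (F z)" for n
    by (rule AE_I2) (simp add: indicator_def)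
qed (use assms in simp)

lemma cmonom_diagonal: "cmonom s s z = of_real (((cmod z)\<^sup>2) ^ s)"
  unfolding power_mult_distrib[symmetric] complex_norm_square[symmetric] of_real_power ..

lemma integral_mu_diagonal_cmonom:
  assumes "\<alpha> > -1"
  shows "(LINT z|mu \<alpha>. z ^ s * cnj z ^ s) = of_real (moment \<alpha> 0 s)"
proof -
  have "z ^ s * cnj z ^ s = of_real (((cmod z)\<^sup>2) ^ s * (1 - (cmod z)\<^sup>2) ^ 0)" for z
    by (simp only: cmonom_diagonal power_0 mult_1_right)
  then show ?thesis
    using integral_mu_radial(2)[OF assms, of s 0] by (simp only: integral_complex_of_real)
qed

text \<open>The single terms \<open>cnj z ^ k * h k z\<close> may fail to be integrable against
  monomials. They are separated on truncated disks; dominated convergence is applied to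
  \<open>f\<close> times the conjugated monomial as a whole, while the right-hand side is a finite
  sum of convergent truncated moments.\<close>

lemma polyanalytic_moment:
  assumes \<alpha>: "\<alpha> > -1" and f: "f \<in> L2 \<alpha>"
    and eq: "\<And>z. z \<in> disk \<Longrightarrow> f z = (\<Sum>k<n. cnj z ^ k * h k z)"
    and h: "\<And>k z. k < n \<Longrightarrow> z \<in> disk \<Longrightarrow> (\<lambda>j. c k j * z ^ j) sums h k z"
  shows "L2_inner \<alpha> f (cmonom a b) =
    (\<Sum>k<n. if b \<le> k + a then c k (k + a - b) * of_real (moment \<alpha> 0 (k + a)) else 0)"
proof -
  \<comment> \<open>The shift by 2 keeps all radii strictly between 0 and 1, beginning with
    1/2.\<close>
  define R where "R m = 1 - 1 / real (m + 2)" for m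
  have R: "0 < R m" "R m < 1" for m
    by (simp_all add: R_def field_simps)
  have "(LINT z|mu \<alpha>. of_real (indicator {..<R m} (cmod z)) * (f z * cnj (cmonom a b z))) =
     (\<Sum>k<n. if b \<le> k + a then c k (k + a - b) * trunc_moment \<alpha> (R m) (k + a) else 0)" for m
  proof -
    have "(LINT z|mu \<alpha>. of_real (indicator {..<R m} (cmod z)) * (f z * cnj (cmonom a b z))) =
      (LINT z|mu \<alpha>. (\<Sum>k<n. of_real (indicator {..<R m} (cmod z)) * (h k z * (z ^ b * cnj z ^ (k + a)))))"
      by (rule Bochner_Integration.integral_cong)
         (simp_all add: eq sum_distrib_left sum_distrib_right power_add mult_ac)
    also have "\<dots> = (\<Sum>k<n. LINT z|mu \<alpha>. of_real (indicator {..<R m} (cmod z)) * (h k z * (z ^ b * cnj z ^ (k + a))))"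
      by (rule Bochner_Integration.integral_sum)
         (use integral_mu_trunc_power_series(2)[OF \<alpha> R h] in blast)
    also have "\<dots> = (\<Sum>k<n. if b \<le> k + a then c k (k + a - b) * trunc_moment \<alpha> (R m) (k + a) else 0)"
      by (rule sum.cong[OF refl], rule integral_mu_trunc_power_series(1)[OF \<alpha> R h]) auto
    finally show ?thesis .
  qed
  moreover have "(\<lambda>m. LINT z|mu \<alpha>. of_real (indicator {..<R m} (cmod z)) * (f z * cnj (cmonom a b z)))
      \<longlonglongrightarrow> L2_inner \<alpha> f (cmonom a b)"
    unfolding R_def L2_inner_def
    by (rule trunc_integral_tendsto[OF L2_integrable_inner[OF f cmonom_L2[OF \<alpha>]]])
  moreover have "(\<lambda>m. \<Sum>k<n. if b \<le> k + a then c k (k + a - b) * trunc_moment \<alpha> (R m) (k + a) else 0)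
      \<longlonglongrightarrow> (\<Sum>k<n. if b \<le> k + a then c k (k + a - b) * of_real (moment \<alpha> 0 (k + a)) else 0)"
  proof -
    have "(\<lambda>m. trunc_moment \<alpha> (R m) s) \<longlonglongrightarrow> of_real (moment \<alpha> 0 s)" for s
      using trunc_integral_tendsto[OF cmonom_integrable[OF \<alpha>, of s s]]
      unfolding R_def trunc_moment_def integral_mu_diagonal_cmonom[OF \<alpha>] .
    then show ?thesis
      by (intro tendsto_sum) (auto intro: tendsto_mult_left)
  qed
  ultimately show ?thesis
    by (simp add: LIMSEQ_unique)
qed

section \<open>Orthonormality of the disk polynomials\<close>

text \<open>The \<open>q\<close>-th backward difference of \<open>N choose b\<close> in
  \<open>N\<close>. By Pascal's rule every step lowers both entries by one, and after
  \<open>b\<close> steps the constant 1 is left, which one further step annihilates.\<close>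

lemma alternating_binomial_sum:
  assumes "q \<le> N"
  shows "(\<Sum>j\<le>q. of_nat (q choose j) * ((-1) ^ j * of_nat ((N - j) choose b))) =
    (if q \<le> b then of_nat ((N - q) choose (b - q)) else (0::real))"
  using assms
proof (induction q arbitrary: N b)
  case (Suc q)
  then obtain M where M: "N = Suc M" "q \<le> M"
    by (cases N) auto
  have "(\<Sum>j\<le>Suc q. of_nat (Suc q choose j) * ((-1) ^ j * of_nat ((N - j) choose b))) =
      (\<Sum>j\<le>q. of_nat (q choose j) * ((-1) ^ Suc j * of_nat ((N - Suc j) choose b) + (-1) ^ j * of_nat ((N - j) choose b) :: real))"
    by (rule sum_binomial_Suc[of q "\<lambda>j i. (-1) ^ j * of_nat ((N - j) choose b)", symmetric])
  also have "\<dots> = (\<Sum>j\<le>q. of_nat (q choose j) * ((-1) ^ j * (if b = 0 then 0 else of_nat ((M - j) choose (b - 1)))))"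
  proof (rule sum.cong[OF refl])
    fix j assume "j \<in> {..q}"
    then have "N - j = Suc (M - j)" using M by auto
    then show "of_nat (q choose j) * ((-1) ^ Suc j * of_nat ((N - Suc j) choose b) + (-1) ^ j * of_nat ((N - j) choose b) :: real) =
      of_nat (q choose j) * ((-1) ^ j * (if b = 0 then 0 else of_nat ((M - j) choose (b - 1))))"
      by (cases b) (simp_all add: M algebra_simps)
  qed
  also have "\<dots> = (if Suc q \<le> b then of_nat ((N - Suc q) choose (b - Suc q)) else 0)"
  proof (cases b)
    case (Suc b')
    then show ?thesis
      using Suc.IH[OF M(2), of b'] by (simp add: M(1))
  qed simp
  finally show ?case .
qed simp

lemma gbinomial_Gamma_shift:
  fixes \<alpha> :: real
  assumes \<alpha>: "\<alpha> > -1" and "j \<le> q"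
  shows "(real q + \<alpha>) gchoose (q - j) = Gamma (\<alpha> + q + 1) / (fact (q - j) * Gamma (\<alpha> + j + 1))"
proof -
  have "real q + \<alpha> + 1 \<notin> \<int>\<^sub>\<le>\<^sub>0"
    using \<alpha> by (auto elim!: nonpos_Ints_cases)
  then show ?thesis
    using \<open>j \<le> q\<close> by (simp add: gbinomial_Gamma of_nat_diff add_ac)
qed

lemma disk_poly_const_square:
  assumes "\<alpha> > -1"
  shows "(disk_poly_const \<alpha> p q)\<^sup>2 = (\<alpha> + p + q + 1) * Gamma (\<alpha> + p + 1) * Gamma (\<alpha> + q + 1)
           / ((\<alpha> + 1) * fact p * fact q * (Gamma (\<alpha> + p + q + 1))\<^sup>2)"
  unfolding disk_poly_const_def using assms
  by (intro real_sqrt_pow2 divide_nonneg_nonneg mult_nonneg_nonneg) (auto intro!: less_imp_le Gamma_real_pos)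

lemma disk_poly_factor_eq:
  assumes "\<alpha> > -1"
  shows "disk_poly_factor \<alpha> p q = disk_poly_const \<alpha> p q * Gamma (\<alpha> + p + q + 1) * fact q / Gamma (\<alpha> + q + 1)"
proof -
  have "(real p + real q + \<alpha>) gchoose p = Gamma (\<alpha> + p + q + 1) / (fact p * Gamma (\<alpha> + q + 1))"
    using gbinomial_Gamma_shift[OF assms, of q "p + q"] by (simp add: add_ac)
  then show ?thesis
    unfolding disk_poly_factor_def by simp
qed

text \<open>The square of \<open>Gamma (\<alpha> + p + q + 1)\<close> cancels. What is left grows in
  \<open>p\<close> like a power of exponent \<open>\<alpha> + 1\<close>, the polynomial growth
  behind the synthesis of functions from coefficients.\<close>

lemma disk_poly_factor_square:
  assumes \<alpha>: "\<alpha> > -1"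
  shows "(disk_poly_factor \<alpha> p q)\<^sup>2 =
    (\<alpha> + p + q + 1) * Gamma (\<alpha> + p + 1) * fact q / ((\<alpha> + 1) * fact p * Gamma (\<alpha> + q + 1))"
proof -
  have cancel: "x * P * Q / (A * r * f * G\<^sup>2) * G\<^sup>2 * f\<^sup>2 / Q\<^sup>2 = x * P * f / (A * r * Q)"
    if "G \<noteq> 0" "Q \<noteq> 0" "f \<noteq> 0" for x P Q A r f G :: real
    using that by (simp add: power2_eq_square)
  have "Gamma (\<alpha> + p + q + 1) > 0" "Gamma (\<alpha> + q + 1) > 0"
    using \<alpha> by (auto intro!: Gamma_real_pos)
  then show ?thesis
    unfolding disk_poly_factor_eq[OF \<alpha>] power_divide power_mult_distrib disk_poly_const_square[OF \<alpha>]
    by (intro cancel) auto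
qed

lemma disk_poly_factor_nonneg:
  assumes \<alpha>: "\<alpha> > -1"
  shows "disk_poly_factor \<alpha> p q \<ge> 0"
  unfolding disk_poly_factor_eq[OF \<alpha>] disk_poly_const_def using \<alpha>
  by (intro divide_nonneg_nonneg mult_nonneg_nonneg real_sqrt_ge_zero)
     (auto intro!: less_imp_le Gamma_real_pos)

lemma disk_poly_factor_pos:
  assumes \<alpha>: "\<alpha> > -1"
  shows "disk_poly_factor \<alpha> p q > 0"
proof -
  have "0 < (disk_poly_factor \<alpha> p q)\<^sup>2"
    unfolding disk_poly_factor_square[OF \<alpha>] using \<alpha>
    by (intro divide_pos_pos mult_pos_pos) (auto intro!: Gamma_real_pos)
  then show ?thesis
    using disk_poly_factor_nonneg[OF \<alpha>, of p q] by (simp add: less_le)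
qed

text \<open>Every monomial has the rotational degree \<open>p - q\<close>, so it is determined by
  the power \<open>b\<close> of \<open>cnj z\<close>. The vanishing of \<open>d b\<close> for
  \<open>p + b < q\<close> guards the truncated exponent; the top coefficient \<open>d q\<close> is
  given because it must be nonzero and fixes the normalization.\<close>

lemma disk_poly_expansion:
  obtains d where "\<And>z. z \<in> disk \<Longrightarrow> disk_poly \<alpha> p q z = (\<Sum>b\<le>q. d b * cmonom (p + b - q) b z)"
    and "\<And>b. p + b < q \<Longrightarrow> d b = 0"
    and "d q = of_real (disk_poly_factor \<alpha> p q * ((real p + real q + \<alpha>) gchoose q))"
proof -
  define K where "K = disk_poly_factor \<alpha> p q"
  define t where "t j = complex_of_real (K * ((-1) ^ j * (of_nat (p choose j) * ((q + \<alpha>) gchoose (q - j)))))" for j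
  \<comment> \<open>The \<open>i\<close>-th binomial term of \<open>(1 - z * cnj z) ^ j\<close> has
    the power \<open>b = q - j + i\<close> of \<open>cnj z\<close>; hence
    \<open>i = b + j - q\<close>, and the side condition makes this subtraction exact.\<close>
  define d where "d b = (\<Sum>j | j \<le> q \<and> q - j \<le> b. t j * ((-1) ^ (b + j - q) * of_nat (j choose (b + j - q))))" for b
  have t0: "t j = 0" if "p < j" for j
    using that by (simp add: t_def)
  have "disk_poly \<alpha> p q z = (\<Sum>b\<le>q. d b * cmonom (p + b - q) b z)" if z: "z \<in> disk" for z
  proof -
    have "disk_poly \<alpha> p q z = (\<Sum>j\<le>q. t j * (z ^ (p - j) * cnj z ^ (q - j) * (1 - z * cnj z) ^ j))"
      unfolding disk_poly_eq[OF z] t_def K_def by (simp add: sum_distrib_left mult_ac)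
    also have "\<dots> = (\<Sum>j\<le>q. \<Sum>b\<in>{q - j..q}. t j * ((-1) ^ (b + j - q) * of_nat (j choose (b + j - q))) * cmonom (p + b - q) b z)"
    proof (rule sum.cong[OF refl])
      fix j assume "j \<in> {..q}"
      then have j: "j \<le> q" by simp
      show "t j * (z ^ (p - j) * cnj z ^ (q - j) * (1 - z * cnj z) ^ j) =
        (\<Sum>b\<in>{q - j..q}. t j * ((-1) ^ (b + j - q) * of_nat (j choose (b + j - q))) * cmonom (p + b - q) b z)"
      proof (cases "j \<le> p")
        case True
        have "(1 - z * cnj z) ^ j = (\<Sum>i\<le>j. of_nat (j choose i) * (- (z * cnj z)) ^ i)"
          using binomial_ring[of "- (z * cnj z)" 1 j] by simp
        then have "z ^ (p - j) * cnj z ^ (q - j) * (1 - z * cnj z) ^ j =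
            (\<Sum>i\<le>j. (-1) ^ i * of_nat (j choose i) * cmonom (p - j + i) (q - j + i) z)"
          by (simp add: sum_distrib_left power_add power_minus[of "z * cnj z"] power_mult_distrib mult_ac)
        also have "\<dots> = (\<Sum>b\<in>{q - j..q}. ((-1) ^ (b + j - q) * of_nat (j choose (b + j - q))) * cmonom (p + b - q) b z)"
          by (rule sum.reindex_bij_witness[of _ "\<lambda>b. b + j - q" "\<lambda>i. q - j + i"]) (use j True in auto)
        finally show ?thesis
          by (simp add: sum_distrib_left mult.assoc)
      next
        case False
        then show ?thesis by (simp add: t0)
      qed
    qed
    also have "\<dots> = (\<Sum>j\<le>q. \<Sum>b | b \<le> q \<and> q - j \<le> b. t j * ((-1) ^ (b + j - q) * of_nat (j choose (b + j - q))) * cmonom (p + b - q) b z)"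
      by (intro sum.cong refl) auto
    also have "\<dots> = (\<Sum>b\<le>q. \<Sum>j | j \<le> q \<and> q - j \<le> b. t j * ((-1) ^ (b + j - q) * of_nat (j choose (b + j - q))) * cmonom (p + b - q) b z)"
      using sum.swap_restrict[of "{..q}" "{..q}" "\<lambda>j b. t j * ((-1) ^ (b + j - q) * of_nat (j choose (b + j - q))) * cmonom (p + b - q) b z"
          "\<lambda>j b. q - j \<le> b"] by simp
    also have "\<dots> = (\<Sum>b\<le>q. d b * cmonom (p + b - q) b z)"
      unfolding d_def by (simp add: sum_distrib_right)
    finally show ?thesis .
  qed
  moreover have "d b = 0" if "p + b < q" for b
    unfolding d_def using that by (intro sum.neutral) (auto simp: t0)
  moreover have "d q = of_real (K * ((real p + real q + \<alpha>) gchoose q))"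
  proof -
    \<comment> \<open>For \<open>b = q\<close> only \<open>i = j\<close> occurs, and its sign
      cancels the one in \<open>t j\<close>; the Vandermonde convolution sums the rest.\<close>
    have "d q = (\<Sum>j\<le>q. t j * (-1) ^ j)"
      unfolding d_def by (rule sum.cong) auto
    also have "\<dots> = (\<Sum>j\<le>q. of_real (K * ((of_nat p gchoose j) * ((q + \<alpha>) gchoose (q - j)))))"
      unfolding t_def by (rule sum.cong[OF refl]) (simp add: binomial_gbinomial)
    also have "\<dots> = of_real (K * (\<Sum>j\<le>q. (of_nat p gchoose j) * ((q + \<alpha>) gchoose (q - j))))"
      by (simp add: sum_distrib_left)
    also have "\<dots> = of_real (K * ((real p + real q + \<alpha>) gchoose q))"
      using gbinomial_Vandermonde[of "real p" "q + \<alpha>" q] by (simp only: atMost_atLeast0 add.assoc)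
    finally show ?thesis .
  qed
  ultimately show ?thesis
    unfolding K_def by (rule that)
qed

lemma disk_poly_L2:
  assumes "\<alpha> > -1"
  shows "disk_poly \<alpha> p q \<in> L2 \<alpha>"
proof -
  obtain d where "\<And>z. z \<in> disk \<Longrightarrow> disk_poly \<alpha> p q z = (\<Sum>b\<le>q. d b * cmonom (p + b - q) b z)"
    by (rule disk_poly_expansion[of \<alpha> p q]) (rule that, assumption)
  then show ?thesis
    using L2_cong[of "disk_poly \<alpha> p q" "\<lambda>z. \<Sum>b\<le>q. d b * cmonom (p + b - q) b z"]
    by (simp add: L2_sum L2_cmult cmonom_L2[OF assms])
qed

text \<open>Unless the rotational degrees \<open>p - q\<close> and \<open>a - b\<close> agree, every
  term integrates to zero. If they agree, all terms are radial, and their sum is the finite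
  difference of order \<open>q\<close> that kills \<open>b < q\<close>.\<close>

lemma disk_poly_inner_cmonom:
  assumes \<alpha>: "\<alpha> > -1"
  shows "L2_inner \<alpha> (disk_poly \<alpha> p q) (cmonom a b) =
    (if a + q = p + b \<and> q \<le> b then
       of_real (disk_poly_factor \<alpha> p q * (\<alpha> + 1) * Gamma (\<alpha> + q + 1) * fact p * fact b /
         (fact q * Gamma (\<alpha> + p + b + 2)) * ((p + b - q) choose (b - q)))
     else 0)"
proof -
  define K where "K = disk_poly_factor \<alpha> p q"
  define t where "t j = K * ((-1) ^ j * (of_nat (p choose j) * ((q + \<alpha>) gchoose (q - j))))" for j
  let ?g = "\<lambda>j z. complex_of_real ((1 - (cmod z)\<^sup>2) ^ j) * (z ^ (p - j + b) * cnj z ^ (q - j + a))"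
  have int: "integrable (mu \<alpha>) (?g j)" for j
  proof -
    interpret finite_measure "mu \<alpha>" by (rule finite_measure_mu[OF \<alpha>])
    show ?thesis
    proof (rule integrable_const_bound[where B = 1])
      show "?g j \<in> borel_measurable (mu \<alpha>)"
        by (rule borel_measurable_mu) measurable
      have "cmod (?g j z) \<le> 1" if z: "z \<in> disk" for z
      proof -
        have "\<bar>1 - (cmod z)\<^sup>2\<bar> \<le> 1"
          using one_minus_cmod_square_pos[OF z] by simp
        then have "cmod (complex_of_real ((1 - (cmod z)\<^sup>2) ^ j)) \<le> 1"
          unfolding norm_of_real power_abs by (intro power_le_one) auto
        moreover have "cmod (z ^ (p - j + b) * cnj z ^ (q - j + a)) \<le> 1"
          using z by (simp add: norm_mult norm_power power_le_one mult_le_one)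
        ultimately show ?thesis
          unfolding norm_mult[of "complex_of_real _"] by (intro mult_le_one) auto
      qed
      then show "AE z in mu \<alpha>. norm (?g j z) \<le> 1"
        by (intro AE_I2) simp
    qed
  qed
  have I: "L2_inner \<alpha> (disk_poly \<alpha> p q) (cmonom a b) = (\<Sum>j\<le>q. of_real (t j) * (LINT z|mu \<alpha>. ?g j z))"
  proof -
    have "L2_inner \<alpha> (disk_poly \<alpha> p q) (cmonom a b) = (LINT z|mu \<alpha>. (\<Sum>j\<le>q. of_real (t j) * ?g j z))"
      unfolding L2_inner_def
    proof (rule Bochner_Integration.integral_cong[OF refl])
      fix z assume "z \<in> space (mu \<alpha>)"
      then have z: "z \<in> disk" by simp
      have "complex_of_real (1 - (cmod z)\<^sup>2) = 1 - z * cnj z"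
        by (simp add: complex_norm_square[symmetric])
      then show "disk_poly \<alpha> p q z * cnj (cmonom a b z) = (\<Sum>j\<le>q. of_real (t j) * ?g j z)"
        unfolding disk_poly_eq[OF z] t_def K_def power_add
        by (simp add: sum_distrib_left sum_distrib_right mult_ac)
    qed
    also have "\<dots> = (\<Sum>j\<le>q. of_real (t j) * (LINT z|mu \<alpha>. ?g j z))"
      by (subst Bochner_Integration.integral_sum)
         (rule integrable_mult_right, rule int, simp only: integral_mult_right_zero)
    finally show ?thesis .
  qed
  have t0: "t j = 0" if "p < j" for j
    using that by (simp add: t_def)
  show ?thesis
  proof (cases "a + q = p + b")
    case False
    have "of_real (t j) * (LINT z|mu \<alpha>. ?g j z) = 0" if "j \<le> q" for j
    proof (cases "j \<le> p")
      case True
      then have "p - j + b \<noteq> q - j + a" using False that by simp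
      then have "(LINT z|mu \<alpha>. ?g j z) = 0"
        using integral_mu_monomial_eq_0[OF _ \<alpha>, of "\<lambda>x. complex_of_real ((1 - x\<^sup>2) ^ j)" "p - j + b" "q - j + a"]
        by simp
      then show ?thesis by simp
    qed (simp add: t0)
    then have "(\<Sum>j\<le>q. of_real (t j) * (LINT z|mu \<alpha>. ?g j z)) = 0"
      by (intro sum.neutral ballI) (simp only: atMost_iff)
    then show ?thesis
      unfolding I using False by (simp only: simp_thms if_False)
  next
    case True
    define C where "C = K * (\<alpha> + 1) * Gamma (\<alpha> + q + 1) * fact p * fact b / (fact q * Gamma (\<alpha> + p + b + 2))"
    have qpb: "q \<le> p + b" using True by simp
    have "of_real (t j) * (LINT z|mu \<alpha>. ?g j z) =
        of_real (C * (of_nat (q choose j) * ((-1) ^ j * of_nat ((p + b - j) choose b))))" if j: "j \<le> q" for j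
    proof (cases "j \<le> p")
      case jp: True
      then have eq: "q - j + a = p - j + b" "p - j + b = p + b - j" using True j by auto
      have "?g j z = of_real (((cmod z)\<^sup>2) ^ (p + b - j) * (1 - (cmod z)\<^sup>2) ^ j)" for z
        unfolding eq cmonom_diagonal by simp
      then have "(LINT z|mu \<alpha>. ?g j z) = of_real (moment \<alpha> j (p + b - j))"
        using integral_mu_radial(2)[OF \<alpha>, of "p + b - j" j] by (simp only: integral_complex_of_real)
      moreover have "t j * moment \<alpha> j (p + b - j) =
          C * (of_nat (q choose j) * ((-1) ^ j * of_nat ((p + b - j) choose b)))"
      proof -
        have G: "Gamma (\<alpha> + j + 1) > 0" "Gamma (\<alpha> + p + b + 2) > 0"
          using \<alpha> by (auto intro!: Gamma_real_pos)
        \<comment> \<open>The power \<open>p + b - j\<close> of the squared modulus and the power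
          \<open>j\<close> of the weight add up to \<open>p + b\<close>, so the Gamma value in the
          denominator is the same for all \<open>j\<close>. The factor
          \<open>Gamma (\<alpha> + j + 1)\<close> cancels against the generalized binomial.\<close>
        have 1: "\<alpha> + real j + real (p + b - j) + 2 = \<alpha> + p + b + 2"
          using jp by simp
        have 2: "real (p choose j) = fact p / (fact j * fact (p - j))"
          by (rule binomial_fact[OF jp])
        have 3: "real (q choose j) = fact q / (fact j * fact (q - j))"
          by (rule binomial_fact[OF j])
        have 4: "real ((p + b - j) choose b) = fact (p + b - j) / (fact b * fact (p - j))"
        proof -
          have "b \<le> p + b - j" "p + b - j - b = p - j"
            using jp by linarith+
          then show ?thesis
            using binomial_fact[of b "p + b - j", where 'a = real] by simp
        qed
        show ?thesis
          unfolding t_def C_def moment_eq[OF \<alpha>] gbinomial_Gamma_shift[OF \<alpha> j] 1 2 3 4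
          using G by (simp add: field_simps)
      qed
      ultimately show ?thesis
        by (metis of_real_mult)
    next
      case jp: False
      \<comment> \<open>Both sides vanish for \<open>j > p\<close>: on the right the binomial
        coefficient is zero, the subtraction being exact because
        \<open>j \<le> q \<le> p + b\<close>.\<close>
      then have "p + b - j < b" using j qpb by auto
      then show ?thesis using jp by (simp add: t0)
    qed
    then have "L2_inner \<alpha> (disk_poly \<alpha> p q) (cmonom a b) =
        of_real (C * (\<Sum>j\<le>q. of_nat (q choose j) * ((-1) ^ j * of_nat ((p + b - j) choose b))))"
      unfolding I sum_distrib_left of_real_sum by (intro sum.cong) auto
    then show ?thesis
      unfolding alternating_binomial_sum[OF qpb] using True by (simp add: C_def K_def)
  qed
qed

text \<open>The first factor is orthogonal to all monomials with \<open>b < q\<close>, so of the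
  expansion of the second only the top coefficient counts; for \<open>p = p'\<close> it is inverse
  to the remaining inner product.\<close>

lemma disk_poly_orthonormal:
  assumes \<alpha>: "\<alpha> > -1"
  shows "L2_inner \<alpha> (disk_poly \<alpha> p q) (disk_poly \<alpha> p' q) = (if p = p' then 1 else 0)"
proof -
  obtain d where d: "\<And>z. z \<in> disk \<Longrightarrow> disk_poly \<alpha> p' q z = (\<Sum>b\<le>q. d b * cmonom (p' + b - q) b z)"
    "\<And>b. p' + b < q \<Longrightarrow> d b = 0"
    "d q = of_real (disk_poly_factor \<alpha> p' q * ((real p' + real q + \<alpha>) gchoose q))"
    by (rule disk_poly_expansion[of \<alpha> p' q]) (rule that, assumption+)
  have "L2_inner \<alpha> (disk_poly \<alpha> p q) (disk_poly \<alpha> p' q) =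
      L2_inner \<alpha> (disk_poly \<alpha> p q) (\<lambda>z. \<Sum>b\<le>q. d b * cmonom (p' + b - q) b z)"
    by (rule L2_inner_cong) (simp_all add: d(1))
  also have "\<dots> = (\<Sum>b\<le>q. cnj (d b) * L2_inner \<alpha> (disk_poly \<alpha> p q) (cmonom (p' + b - q) b))"
    by (simp only: L2_inner_sum_right L2_cmult cmonom_L2[OF \<alpha>] disk_poly_L2[OF \<alpha>] L2_inner_cmult_right)
  also have "\<dots> = (\<Sum>b\<le>q. if b = q then cnj (d q) * L2_inner \<alpha> (disk_poly \<alpha> p q) (cmonom p' q) else 0)"
  proof (rule sum.cong[OF refl])
    fix b assume "b \<in> {..q}"
    then show "cnj (d b) * L2_inner \<alpha> (disk_poly \<alpha> p q) (cmonom (p' + b - q) b) =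
       (if b = q then cnj (d q) * L2_inner \<alpha> (disk_poly \<alpha> p q) (cmonom p' q) else 0)"
      by (auto simp: disk_poly_inner_cmonom[OF \<alpha>])
  qed
  also have "\<dots> = cnj (d q) * L2_inner \<alpha> (disk_poly \<alpha> p q) (cmonom p' q)"
    by simp
  also have "\<dots> = (if p = p' then 1 else 0)"
  proof (cases "p = p'")
    case True
    define G where "G = Gamma (\<alpha> + p + q + 1)"
    have pos: "G > 0" "Gamma (\<alpha> + p + 1) > 0" "Gamma (\<alpha> + q + 1) > 0" "\<alpha> + p + q + 1 > 0" "\<alpha> + 1 > 0"
      using \<alpha> by (auto intro!: Gamma_real_pos simp: G_def)
    have cancel: "x * P * f / (A * r * Q) * (G / (f * P) * (A * Q * r / (x * G))) = 1"
      if "0 < x" "0 < P" "0 < A" "0 < Q" "0 < G" "0 < f" "0 < r" for x P f A r Q G :: real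
      using that by simp
    have g: "(real p + real q + \<alpha>) gchoose q = G / (fact q * Gamma (\<alpha> + p + 1))"
      using gbinomial_Gamma_shift[OF \<alpha>, of p "p + q"] by (simp add: add_ac G_def)
    have G2: "Gamma (\<alpha> + p + q + 2) = (\<alpha> + p + q + 1) * G"
    proof -
      have "\<alpha> + p + q + 1 \<notin> \<int>\<^sub>\<le>\<^sub>0"
        using pos(4) by (auto elim!: nonpos_Ints_cases)
      from Gamma_plus1[OF this] show ?thesis
        by (simp add: G_def add_ac)
    qed
    have "disk_poly_factor \<alpha> p q * (G / (fact q * Gamma (\<alpha> + p + 1))) *
       (disk_poly_factor \<alpha> p q * (\<alpha> + 1) * Gamma (\<alpha> + q + 1) * fact p * fact q /
         (fact q * Gamma (\<alpha> + p + q + 2))) =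
       (disk_poly_factor \<alpha> p q)\<^sup>2 * ((G / (fact q * Gamma (\<alpha> + p + 1))) *
       ((\<alpha> + 1) * Gamma (\<alpha> + q + 1) * fact p / Gamma (\<alpha> + p + q + 2)))"
      by (simp add: power2_eq_square)
    also have "\<dots> = 1"
      unfolding disk_poly_factor_square[OF \<alpha>] G2 by (intro cancel pos) simp_all
    finally have "disk_poly_factor \<alpha> p q * (G / (fact q * Gamma (\<alpha> + p + 1))) *
       (disk_poly_factor \<alpha> p q * (\<alpha> + 1) * Gamma (\<alpha> + q + 1) * fact p * fact q /
         (fact q * Gamma (\<alpha> + p + q + 2))) = 1" .
    then show ?thesis
      unfolding d(3) disk_poly_inner_cmonom[OF \<alpha>] True[symmetric]
      by (simp only: complex_cnj_complex_of_real simp_thms if_True le_refl diff_self_eq_0 binomial_n_0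
          of_nat_1 mult_1_right g of_real_mult[symmetric] of_real_1)
  next
    case False
    then show ?thesis by (simp add: disk_poly_inner_cmonom[OF \<alpha>])
  qed
  finally show ?thesis .
qed

section \<open>The disk polynomials span the true polyanalytic Bergman space\<close>

definition zero_ext :: "(complex \<Rightarrow> complex) \<Rightarrow> complex \<Rightarrow> complex" where
  "zero_ext f z = (if z \<in> disk then f z else 0)"

lemma poly_Bergman_iff:
  "f \<in> poly_Bergman n \<alpha> \<longleftrightarrow> polyanalytic n f \<and> f \<in> L2 \<alpha> \<and> (\<forall>z. z \<notin> disk \<longrightarrow> f z = 0)"
  unfolding poly_Bergman_def L2_def by auto

lemma zero_ext_poly_Bergman:
  assumes "polyanalytic n f" "f \<in> L2 \<alpha>"
  shows "zero_ext f \<in> poly_Bergman n \<alpha>"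
  unfolding poly_Bergman_iff
  using polyanalytic_cong[of "zero_ext f" f n] L2_cong[of "zero_ext f" f \<alpha>] assms
  by (simp add: zero_ext_def)

lemma polyanalytic_cmonom_sum:
  assumes "\<And>b. b \<in> I \<Longrightarrow> b < n"
  shows "polyanalytic n (\<lambda>z. \<Sum>b\<in>I. c b * cmonom (a b) b z)"
proof (rule polyanalytic_sum)
  fix b assume "b \<in> I"
  then have "polyanalytic n (\<lambda>z. cnj z ^ b * (c b * z ^ a b))"
    by (intro polyanalytic_cnj_power_mult assms holomorphic_intros)
  then show "polyanalytic n (\<lambda>z. c b * cmonom (a b) b z)"
    by (simp add: mult_ac)
qed

lemma holomorphic_disk_power_series:
  assumes "h holomorphic_on disk"
  shows "\<exists>c. \<forall>z\<in>disk. (\<lambda>j. c j * z ^ j) sums h z"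
proof -
  have "(\<lambda>j. (deriv ^^ j) h 0 / fact j * (z - 0) ^ j) sums h z" if "z \<in> disk" for z
    by (rule holomorphic_power_series[OF assms that])
  then show ?thesis by (intro exI[of _ "\<lambda>j. (deriv ^^ j) h 0 / fact j"]) simp
qed

lemma polyanalytic_coefficients:
  assumes "polyanalytic n f"
  obtains h c where "\<And>z. z \<in> disk \<Longrightarrow> f z = (\<Sum>k<n. cnj z ^ k * h k z)"
    and "\<And>k z. k < n \<Longrightarrow> z \<in> disk \<Longrightarrow> (\<lambda>j. c k j * z ^ j) sums h k z"
proof -
  obtain h where h: "\<And>k. k < n \<Longrightarrow> h k holomorphic_on disk"
    "\<And>z. z \<in> disk \<Longrightarrow> f z = (\<Sum>k<n. cnj z ^ k * h k z)"
    using polyanalytic_decomposition[OF assms] by blast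
  have "\<forall>k. \<exists>c. k < n \<longrightarrow> (\<forall>z\<in>disk. (\<lambda>j. c j * z ^ j) sums h k z)"
    using holomorphic_disk_power_series[OF h(1)] by blast
  then obtain c where "\<And>k. k < n \<Longrightarrow> \<forall>z\<in>disk. (\<lambda>j. c k j * z ^ j) sums h k z"
    by metis
  then show thesis
    using that[of h c] h(2) by blast
qed

section \<open>Components of a fixed rotational degree and their identification with disk
  polynomials\<close>

lemma cmonom_inner:
  assumes \<alpha>: "\<alpha> > -1"
  shows "L2_inner \<alpha> (cmonom a' b') (cmonom a b) = (if a' + b = b' + a then of_real (moment \<alpha> 0 (b' + a)) else 0)"
proof -
  have "L2_inner \<alpha> (cmonom a' b') (cmonom a b) = (LINT z|mu \<alpha>. z ^ (a' + b) * cnj z ^ (b' + a))"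
    unfolding L2_inner_def by (simp add: power_add mult_ac)
  also have "\<dots> = (if a' + b = b' + a then of_real (moment \<alpha> 0 (b' + a)) else 0)"
    using integral_mu_monomial_eq_0[OF _ \<alpha>, of "\<lambda>x. 1" "a' + b" "b' + a"] integral_mu_diagonal_cmonom[OF \<alpha>]
    by simp
  finally show ?thesis .
qed

text \<open>
  The part of \<open>f = (\<Sum>k<n. cnj z ^ k * (\<Sum>j. c k j * z ^ j))\<close> on which the rotations act like
  on \<open>disk_poly \<alpha> p q\<close>, that is, by the character of degree \<open>p - q\<close>.
\<close>

definition degree_part :: "nat \<Rightarrow> nat \<Rightarrow> (nat \<Rightarrow> nat \<Rightarrow> complex) \<Rightarrow> nat \<Rightarrow> complex \<Rightarrow> complex" where
  "degree_part n q c p z = (\<Sum>k<n. (if q \<le> p + k then c k (p + k - q) else 0) * cmonom (p + k - q) k z)"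

lemma degree_part_L2: "\<alpha> > -1 \<Longrightarrow> degree_part n q c p \<in> L2 \<alpha>"
  unfolding degree_part_def[abs_def] by (intro L2_sum L2_cmult cmonom_L2)

text \<open>A monomial is orthogonal to all monomials of another rotational degree. Both sides are
  therefore the same finite sum of moments, although the full expansion of \<open>f\<close> has not
  been shown to converge in the mean.\<close>

lemma degree_part_inner:
  assumes \<alpha>: "\<alpha> > -1" and f: "f \<in> L2 \<alpha>"
    and eq: "\<And>z. z \<in> disk \<Longrightarrow> f z = (\<Sum>k<n. cnj z ^ k * h k z)"
    and h: "\<And>k z. k < n \<Longrightarrow> z \<in> disk \<Longrightarrow> (\<lambda>j. c k j * z ^ j) sums h k z"
    and ab: "a + q = p + b"
  shows "L2_inner \<alpha> (degree_part n q c p) (cmonom a b) = L2_inner \<alpha> f (cmonom a b)"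
proof -
  have "L2_inner \<alpha> (degree_part n q c p) (cmonom a b) =
      (\<Sum>k<n. (if q \<le> p + k then c k (p + k - q) else 0) * L2_inner \<alpha> (cmonom (p + k - q) k) (cmonom a b))"
    unfolding degree_part_def[abs_def]
    by (simp only: L2_inner_sum_left L2_cmult cmonom_L2[OF \<alpha>] L2_inner_cmult_left)
  also have "\<dots> = (\<Sum>k<n. if b \<le> k + a then c k (k + a - b) * of_real (moment \<alpha> 0 (k + a)) else 0)"
  proof (rule sum.cong[OF refl])
    fix k
    have 1: "q \<le> p + k \<longleftrightarrow> b \<le> k + a" using ab by linarith
    have 2: "p + k - q = k + a - b" using ab by linarith
    show "(if q \<le> p + k then c k (p + k - q) else 0) * L2_inner \<alpha> (cmonom (p + k - q) k) (cmonom a b) =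
      (if b \<le> k + a then c k (k + a - b) * of_real (moment \<alpha> 0 (k + a)) else 0)"
      unfolding cmonom_inner[OF \<alpha>] 1 2 by simp
  qed
  also have "\<dots> = L2_inner \<alpha> f (cmonom a b)"
    by (rule polyanalytic_moment[OF \<alpha> f eq h, symmetric]) auto
  finally show ?thesis .
qed

lemma degree_part_inner_disk_poly:
  assumes \<alpha>: "\<alpha> > -1" and f: "f \<in> L2 \<alpha>"
    and eq: "\<And>z. z \<in> disk \<Longrightarrow> f z = (\<Sum>k<n. cnj z ^ k * h k z)"
    and h: "\<And>k z. k < n \<Longrightarrow> z \<in> disk \<Longrightarrow> (\<lambda>j. c k j * z ^ j) sums h k z"
  shows "L2_inner \<alpha> (degree_part n q c p) (disk_poly \<alpha> p q) = L2_inner \<alpha> f (disk_poly \<alpha> p q)"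
proof -
  obtain d where d: "\<And>z. z \<in> disk \<Longrightarrow> disk_poly \<alpha> p q z = (\<Sum>b\<le>q. d b * cmonom (p + b - q) b z)"
    "\<And>b. p + b < q \<Longrightarrow> d b = 0"
    by (rule disk_poly_expansion[of \<alpha> p q]) (rule that, assumption+)
  have *: "L2_inner \<alpha> g (disk_poly \<alpha> p q) = (\<Sum>b\<le>q. cnj (d b) * L2_inner \<alpha> g (cmonom (p + b - q) b))"
    if "g \<in> L2 \<alpha>" for g
  proof -
    have "L2_inner \<alpha> g (disk_poly \<alpha> p q) = L2_inner \<alpha> g (\<lambda>z. \<Sum>b\<le>q. d b * cmonom (p + b - q) b z)"
      by (rule L2_inner_cong) (simp_all add: d(1))
    also have "\<dots> = (\<Sum>b\<le>q. cnj (d b) * L2_inner \<alpha> g (cmonom (p + b - q) b))"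
      by (simp only: L2_inner_sum_right L2_cmult cmonom_L2[OF \<alpha>] that L2_inner_cmult_right)
    finally show ?thesis .
  qed
  have "cnj (d b) * L2_inner \<alpha> (degree_part n q c p) (cmonom (p + b - q) b) =
      cnj (d b) * L2_inner \<alpha> f (cmonom (p + b - q) b)" for b
  proof (cases "p + b < q")
    case False
    then have "L2_inner \<alpha> (degree_part n q c p) (cmonom (p + b - q) b) = L2_inner \<alpha> f (cmonom (p + b - q) b)"
      by (intro degree_part_inner[OF \<alpha> f eq h]) auto
    then show ?thesis by simp
  qed (simp add: d(2))
  then show ?thesis
    by (simp only: *[OF f] *[OF degree_part_L2[OF \<alpha>]])
qed

text \<open>For each \<open>k \<le> q\<close> the index \<open>p = j + q - k\<close> meets every
  coefficient \<open>c k j\<close> once, after \<open>q - k\<close> initial zeros. This bound on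
  \<open>k\<close> is why natural \<open>p\<close> exhaust all degrees.\<close>

lemma degree_part_sums:
  assumes eq: "f z = (\<Sum>k<Suc q. cnj z ^ k * h k z)"
    and h: "\<And>k. k < Suc q \<Longrightarrow> (\<lambda>j. c k j * z ^ j) sums h k z"
  shows "(\<lambda>p. degree_part (Suc q) q c p z) sums f z"
proof -
  have "(\<lambda>p. (if q \<le> p + k then c k (p + k - q) else 0) * cmonom (p + k - q) k z) sums (cnj z ^ k * h k z)"
    if k: "k < Suc q" for k
  proof (rule sums_zero_iff_shift[where n = "q - k", THEN iffD1])
    show "(\<lambda>i. (if q \<le> i + (q - k) + k then c k (i + (q - k) + k - q) else 0) *
        cmonom (i + (q - k) + k - q) k z) sums (cnj z ^ k * h k z)"
      using sums_mult[OF h[OF k], of "cnj z ^ k"] k by (simp add: mult_ac)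
  qed (use k in auto)
  then show ?thesis
    unfolding eq degree_part_def by (intro sums_sum) auto
qed

text \<open>A \<open>q\<close>-analytic \<open>g\<close> is seen by the disk polynomial only through
  its component of the same degree, a finite combination of monomials with \<open>k < q\<close>, to
  which the disk polynomial is orthogonal.\<close>

lemma disk_poly_mem_true_poly_Bergman:
  assumes \<alpha>: "\<alpha> > -1"
  shows "disk_poly \<alpha> p q \<in> true_poly_Bergman (Suc q) \<alpha>"
proof -
  obtain d where d: "\<And>z. z \<in> disk \<Longrightarrow> disk_poly \<alpha> p q z = (\<Sum>b\<le>q. d b * cmonom (p + b - q) b z)"
    by (rule disk_poly_expansion[of \<alpha> p q]) (rule that, assumption)
  have "polyanalytic (Suc q) (disk_poly \<alpha> p q)"
    using polyanalytic_cong[of "disk_poly \<alpha> p q" "\<lambda>z. \<Sum>b\<le>q. d b * cmonom (p + b - q) b z" "Suc q"] d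
      polyanalytic_cmonom_sum[of "{..q}" "Suc q"] by simp
  then have "disk_poly \<alpha> p q \<in> poly_Bergman (Suc q) \<alpha>"
    unfolding poly_Bergman_iff using disk_poly_L2[OF \<alpha>] by (simp add: disk_poly_def)
  moreover have "L2_inner \<alpha> (disk_poly \<alpha> p q) g = 0" if g: "g \<in> poly_Bergman q \<alpha>" for g
  proof -
    have gL: "g \<in> L2 \<alpha>" and gp: "polyanalytic q g"
      using g by (auto simp: poly_Bergman_iff)
    obtain h c where hc: "\<And>z. z \<in> disk \<Longrightarrow> g z = (\<Sum>k<q. cnj z ^ k * h k z)"
      "\<And>k z. k < q \<Longrightarrow> z \<in> disk \<Longrightarrow> (\<lambda>j. c k j * z ^ j) sums h k z"
      by (rule polyanalytic_coefficients[OF gp]) (rule that, assumption+)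
    have "L2_inner \<alpha> g (disk_poly \<alpha> p q) = L2_inner \<alpha> (degree_part q q c p) (disk_poly \<alpha> p q)"
      by (rule degree_part_inner_disk_poly[OF \<alpha> gL hc, symmetric]) auto
    also have "\<dots> = (\<Sum>k<q. (if q \<le> p + k then c k (p + k - q) else 0) *
        L2_inner \<alpha> (cmonom (p + k - q) k) (disk_poly \<alpha> p q))"
      unfolding degree_part_def[abs_def]
      by (simp only: L2_inner_sum_left L2_cmult cmonom_L2[OF \<alpha>] disk_poly_L2[OF \<alpha>] L2_inner_cmult_left)
    also have "\<dots> = 0"
      by (rule sum.neutral)
         (simp add: L2_inner_cnj[of \<alpha> "cmonom _ _" "disk_poly \<alpha> p q"] disk_poly_inner_cmonom[OF \<alpha>])
    finally show ?thesis
      by (simp add: L2_inner_cnj[of \<alpha> "disk_poly \<alpha> p q" g])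
  qed
  ultimately show ?thesis
    unfolding true_poly_Bergman_def by simp
qed

text \<open>Subtracting a multiple of the disk polynomial removes the monomial with
  \<open>cnj z ^ q\<close>. The remainder \<open>G\<close> is a combination of lower monomials and
  also orthogonal to them, since \<open>f\<close> and the disk polynomial are; so it is orthogonal
  to itself.\<close>

lemma true_poly_Bergman_degree_part:
  assumes \<alpha>: "\<alpha> > -1" and f: "f \<in> true_poly_Bergman (Suc q) \<alpha>"
    and eq: "\<And>z. z \<in> disk \<Longrightarrow> f z = (\<Sum>k<Suc q. cnj z ^ k * h k z)"
    and h: "\<And>k z. k < Suc q \<Longrightarrow> z \<in> disk \<Longrightarrow> (\<lambda>j. c k j * z ^ j) sums h k z"
    and z: "z \<in> disk"
  shows "degree_part (Suc q) q c p z = L2_inner \<alpha> f (disk_poly \<alpha> p q) * disk_poly \<alpha> p q z"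
proof -
  have fL: "f \<in> L2 \<alpha>"
    using f by (simp add: true_poly_Bergman_def poly_Bergman_iff)
  have orth: "L2_inner \<alpha> f g = 0" if "g \<in> poly_Bergman q \<alpha>" for g
    using f that by (simp add: true_poly_Bergman_def)
  obtain d where d: "\<And>z. z \<in> disk \<Longrightarrow> disk_poly \<alpha> p q z = (\<Sum>b\<le>q. d b * cmonom (p + b - q) b z)"
    "\<And>b. p + b < q \<Longrightarrow> d b = 0"
    "d q = of_real (disk_poly_factor \<alpha> p q * ((real p + real q + \<alpha>) gchoose q))"
    by (rule disk_poly_expansion[of \<alpha> p q]) (rule that, assumption+)
  have "(real p + real q + \<alpha>) gchoose q > 0"
    using gbinomial_Gamma_shift[OF \<alpha>, of p "p + q"] \<alpha>
    by (auto simp: intro!: divide_pos_pos mult_pos_pos Gamma_real_pos)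
  then have dq: "d q \<noteq> 0"
    using d(3) disk_poly_factor_pos[OF \<alpha>, of p q] by simp
  \<comment> \<open>The quotient of the coefficients of \<open>z ^ p * cnj z ^ q\<close> in the
    degree part and in the disk polynomial.\<close>
  define l where "l = c q p / d q"
  define u where "u b = (if q \<le> p + b then c b (p + b - q) else 0) - l * d b" for b
  define G where "G z = degree_part (Suc q) q c p z - l * disk_poly \<alpha> p q z" for z
  have GL: "G \<in> L2 \<alpha>"
    unfolding G_def[abs_def] by (intro L2_diff L2_cmult degree_part_L2 disk_poly_L2 \<alpha>)
  have uq: "u q = 0" "\<And>b. p + b < q \<Longrightarrow> u b = 0"
    using dq d(2) by (simp_all add: u_def l_def)
  have Geq: "G w = (\<Sum>b<q. u b * cmonom (p + b - q) b w)" if "w \<in> disk" for w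
  proof -
    have "G w = (\<Sum>b<Suc q. u b * cmonom (p + b - q) b w)"
      unfolding G_def degree_part_def d(1)[OF that] u_def lessThan_Suc_atMost sum_distrib_left sum_subtractf[symmetric]
      by (simp add: algebra_simps)
    then show ?thesis by (simp add: uq)
  qed
  \<comment> \<open>The factor \<open>u b\<close> covers \<open>p + b < q\<close>, where the
    truncated exponent gives a monomial of the wrong degree but \<open>u b = 0\<close>.\<close>
  have Gmono: "u b * L2_inner \<alpha> G (cmonom (p + b - q) b) = 0" if b: "b < q" for b
  proof (cases "p + b < q")
    case False
    have "L2_inner \<alpha> (degree_part (Suc q) q c p) (cmonom (p + b - q) b) = L2_inner \<alpha> f (cmonom (p + b - q) b)"
      using False by (intro degree_part_inner[OF \<alpha> fL eq h]) auto
    also have "\<dots> = L2_inner \<alpha> f (zero_ext (cmonom (p + b - q) b))"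
      by (rule L2_inner_cong) (simp_all add: zero_ext_def)
    also have "\<dots> = 0"
      using polyanalytic_cmonom_sum[of "{b}" q "\<lambda>_. 1" "\<lambda>b. p + b - q"] b
      by (intro orth zero_ext_poly_Bergman cmonom_L2 \<alpha>) simp
    finally have 1: "L2_inner \<alpha> (degree_part (Suc q) q c p) (cmonom (p + b - q) b) = 0" .
    have "L2_inner \<alpha> (disk_poly \<alpha> p q) (cmonom (p + b - q) b) = 0"
      using b by (simp add: disk_poly_inner_cmonom[OF \<alpha>])
    then have "L2_inner \<alpha> G (cmonom (p + b - q) b) = 0"
      unfolding G_def[abs_def] using 1
      by (simp only: L2_inner_diff_left L2_cmult degree_part_L2 disk_poly_L2 cmonom_L2 \<alpha> L2_inner_cmult_left) simp
    then show ?thesis by simp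
  qed (simp add: uq)
  have "L2_inner \<alpha> G G = L2_inner \<alpha> G (\<lambda>w. \<Sum>b<q. u b * cmonom (p + b - q) b w)"
    by (rule L2_inner_cong) (simp_all add: Geq)
  also have "\<dots> = (\<Sum>b<q. cnj (u b) * L2_inner \<alpha> G (cmonom (p + b - q) b))"
    by (simp only: L2_inner_sum_right L2_cmult cmonom_L2[OF \<alpha>] GL L2_inner_cmult_right)
  also have "\<dots> = 0"
    by (rule sum.neutral, rule ballI) (use Gmono in \<open>simp only: lessThan_iff mult_eq_0_iff complex_cnj_zero_iff\<close>)
  finally have "L2_norm \<alpha> G = 0"
    unfolding L2_inner_self by (simp only: of_real_eq_0_iff zero_eq_power2 power_eq_0_iff)
  then have ae: "AE w in mu \<alpha>. G w = 0"
    by (rule L2_norm_0_AE[OF GL])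
  have cont: "continuous_on disk G"
    using continuous_on_cong[OF refl Geq, of disk] by (auto intro!: continuous_intros)
  have G0: "G w = 0" if "w \<in> disk" for w
    by (rule continuous_AE_mu_zero[OF \<alpha> cont ae that])
  \<comment> \<open>Orthonormality now identifies \<open>l\<close> as the expansion coefficient of
    \<open>f\<close>.\<close>
  have "L2_inner \<alpha> f (disk_poly \<alpha> p q) = L2_inner \<alpha> (degree_part (Suc q) q c p) (disk_poly \<alpha> p q)"
    by (rule degree_part_inner_disk_poly[OF \<alpha> fL eq h, symmetric]) auto
  also have "\<dots> = L2_inner \<alpha> (\<lambda>z. l * disk_poly \<alpha> p q z) (disk_poly \<alpha> p q)"
    using G0 by (intro L2_inner_cong) (simp_all add: G_def)
  also have "\<dots> = l"
    by (simp add: L2_inner_cmult_left disk_poly_orthonormal[OF \<alpha>])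
  finally have "L2_inner \<alpha> f (disk_poly \<alpha> p q) = l" .
  then show ?thesis
    using G0[OF z] by (simp add: G_def)
qed

lemma true_poly_Bergman_expansion:
  assumes \<alpha>: "\<alpha> > -1" and f: "f \<in> true_poly_Bergman (Suc q) \<alpha>" and z: "z \<in> disk"
  shows "(\<lambda>p. L2_inner \<alpha> f (disk_poly \<alpha> p q) * disk_poly \<alpha> p q z) sums f z"
proof -
  have "polyanalytic (Suc q) f"
    using f by (simp add: true_poly_Bergman_def poly_Bergman_iff)
  then obtain h c where hc: "\<And>z. z \<in> disk \<Longrightarrow> f z = (\<Sum>k<Suc q. cnj z ^ k * h k z)"
      "\<And>k z. k < Suc q \<Longrightarrow> z \<in> disk \<Longrightarrow> (\<lambda>j. c k j * z ^ j) sums h k z"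
    by (rule polyanalytic_coefficients) (rule that, assumption+)
  have "(\<lambda>p. degree_part (Suc q) q c p z) sums f z"
    by (rule degree_part_sums[where f = f and z = z and q = q and h = h and c = c]) (use hc z in auto)
  then show ?thesis
    by (simp only: true_poly_Bergman_degree_part[OF \<alpha> f hc z])
qed

section \<open>Synthesis of functions from square-summable coefficients\<close>

text \<open>The quotient of successive factors tends to 1, so the factors leave the radius of
  convergence unchanged.\<close>

lemma disk_poly_factor_Suc:
  assumes \<alpha>: "\<alpha> > -1"
  shows "disk_poly_factor \<alpha> (Suc p) q = disk_poly_factor \<alpha> p q *
    sqrt ((\<alpha> + p + q + 2) / (\<alpha> + p + q + 1) * ((\<alpha> + p + 1) / (real p + 1)))"
proof -
  have G: "Gamma (\<alpha> + Suc p + 1) = (\<alpha> + p + 1) * Gamma (\<alpha> + p + 1)"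
  proof -
    have "\<alpha> + p + 1 \<notin> \<int>\<^sub>\<le>\<^sub>0"
      using \<alpha> by (auto elim!: nonpos_Ints_cases)
    from Gamma_plus1[OF this] show ?thesis
      by (simp add: add_ac)
  qed
  have cancel: "x' * (y * P) * f / (A * (w * r) * Q) = x * P * f / (A * r * Q) * (x' / x * (y / w))"
    if "x \<noteq> 0" for x' y P f A w r Q x :: real
    using that by (simp add: field_simps)
  have "(disk_poly_factor \<alpha> (Suc p) q)\<^sup>2 =
      (disk_poly_factor \<alpha> p q)\<^sup>2 * ((\<alpha> + p + q + 2) / (\<alpha> + p + q + 1) * ((\<alpha> + p + 1) / (real p + 1)))"
  proof -
    have 1: "\<alpha> + real (Suc p) + real q + 1 = \<alpha> + p + q + 2" "fact (Suc p) = (real p + 1) * fact p"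
      by simp_all
    have "\<alpha> + real p + real q + 1 \<noteq> 0" using \<alpha> by simp
    then show ?thesis
      unfolding disk_poly_factor_square[OF \<alpha>] G 1 by (rule cancel)
  qed
  then have "sqrt ((disk_poly_factor \<alpha> (Suc p) q)\<^sup>2) =
      sqrt ((disk_poly_factor \<alpha> p q)\<^sup>2 * ((\<alpha> + p + q + 2) / (\<alpha> + p + q + 1) * ((\<alpha> + p + 1) / (real p + 1))))"
    by simp
  then show ?thesis
    unfolding real_sqrt_mult[of "(disk_poly_factor \<alpha> p q)\<^sup>2"]
    by (simp add: disk_poly_factor_nonneg[OF \<alpha>])
qed

lemma summable_disk_poly_factor:
  assumes \<alpha>: "\<alpha> > -1" and r: "0 < r" "r < 1"
  shows "summable (\<lambda>p. disk_poly_factor \<alpha> p q * (real p + 1) ^ j * r ^ p)"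
proof -
  \<comment> \<open>\<open>g p\<close> is the quotient of successive terms. Its limit is
    \<open>r\<close>, and \<open>(1 + r) / 2\<close> lies strictly between \<open>r\<close> and 1,
    as the ratio test requires.\<close>
  define g where "g p = sqrt ((\<alpha> + p + q + 2) / (\<alpha> + p + q + 1) * ((\<alpha> + p + 1) / (real p + 1))) *
     ((real p + 2) / (real p + 1)) ^ j * r" for p :: nat
  let ?f = "\<lambda>p. disk_poly_factor \<alpha> p q * (real p + 1) ^ j * r ^ p"
  have lim: "(\<lambda>p. (real p + a) / (real p + b)) \<longlonglongrightarrow> 1" for a b :: real
    by real_asymp
  have "g \<longlonglongrightarrow> sqrt (1 * 1) * 1 ^ j * r"
    unfolding g_def
    using lim[of "\<alpha> + q + 2" "\<alpha> + q + 1"] lim[of "\<alpha> + 1" 1] lim[of 2 1]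
    by (intro tendsto_mult tendsto_real_sqrt tendsto_power tendsto_const) (simp_all add: add_ac)
  then have "g \<longlonglongrightarrow> r" by simp
  then have "eventually (\<lambda>p. g p < (1 + r) / 2) sequentially"
    using r by (intro order_tendstoD) auto
  then obtain N where N: "\<And>p. p \<ge> N \<Longrightarrow> g p < (1 + r) / 2"
    unfolding eventually_sequentially by blast
  show ?thesis
  proof (rule summable_ratio_test[of "(1 + r) / 2" N])
    show "(1 + r) / 2 < 1" using r by simp
    fix p assume p: "p \<ge> N"
    have pos: "?f p \<ge> 0" for p
      using r disk_poly_factor_nonneg[OF \<alpha>] by simp
    have eq: "(real (Suc p) + 1) ^ j = (real p + 1) ^ j * ((real p + 2) / (real p + 1)) ^ j"
      by (simp add: power_divide add.commute)
    have "?f (Suc p) = g p * ?f p"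
      unfolding g_def disk_poly_factor_Suc[OF \<alpha>] eq power_Suc by (simp only: mult_ac)
    also have "\<dots> \<le> (1 + r) / 2 * ?f p"
      using N[OF p] pos by (intro mult_right_mono) auto
    finally show "norm (?f (Suc p)) \<le> (1 + r) / 2 * norm (?f p)"
      by (simp only: real_norm_def abs_of_nonneg[OF pos])
  qed
qed

lemma binomial_le_Suc_power: "real (p choose j) \<le> (real p + 1) ^ j"
proof (cases "j \<le> p")
  case True
  have "real (p choose j) \<le> real p ^ j"
    using binomial_le_pow[OF True] by (metis of_nat_le_iff of_nat_power)
  also have "\<dots> \<le> (real p + 1) ^ j"
    by (intro power_mono) auto
  finally show ?thesis .
qed (simp add: binomial_eq_0)

text \<open>The part of a series of disk polynomials that multiplies a fixed
  \<open>cnj z ^ (q - j) * (1 - z * cnj z) ^ j\<close>: an ordinary power series in \<open>z\<close>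
  with polynomially growing coefficients.\<close>

lemma disk_poly_coefficient_series:
  assumes \<alpha>: "\<alpha> > -1" and c: "\<And>p. cmod (c p) \<le> B"
  obtains U where "U holomorphic_on disk"
    and "\<And>z. z \<in> disk \<Longrightarrow> (\<lambda>p. c p * of_real (disk_poly_factor \<alpha> p q * (p choose j)) * z ^ (p - j)) sums U z"
proof -
  define A where "A p = c p * of_real (disk_poly_factor \<alpha> p q * (p choose j))" for p
  define U where "U z = (\<Sum>i. A (i + j) * z ^ i)" for z
  have sm: "summable (\<lambda>i. A (i + j) * z ^ i)" if z: "z \<in> disk" for z
  proof -
    obtain r where r: "cmod z < r" "r < 1"
      using z dense[of "cmod z" 1] by auto
    then have r0: "0 < r" by (meson norm_ge_zero le_less_trans)
    have "summable (\<lambda>p. A p * of_real r ^ p)"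
    proof (rule summable_comparison_test'[of "\<lambda>p. B * (disk_poly_factor \<alpha> p q * (real p + 1) ^ j * r ^ p)" 0])
      show "summable (\<lambda>p. B * (disk_poly_factor \<alpha> p q * (real p + 1) ^ j * r ^ p))"
        by (intro summable_mult summable_disk_poly_factor \<alpha> r0 r)
      fix p
      have "cmod (A p * of_real r ^ p) = cmod (c p) * (disk_poly_factor \<alpha> p q * (p choose j) * r ^ p)"
        using r0 disk_poly_factor_nonneg[OF \<alpha>, of p q] by (simp add: A_def norm_mult norm_power)
      also have "\<dots> \<le> B * (disk_poly_factor \<alpha> p q * (real p + 1) ^ j * r ^ p)"
        using r0 disk_poly_factor_nonneg[OF \<alpha>, of p q] order_trans[OF norm_ge_zero c[of p]]
        by (intro mult_mono c binomial_le_Suc_power) auto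
      finally show "norm (A p * of_real r ^ p) \<le> B * (disk_poly_factor \<alpha> p q * (real p + 1) ^ j * r ^ p)" .
    qed
    then have "summable (\<lambda>i. A (i + j) * of_real r ^ (i + j))"
      by (rule summable_ignore_initial_segment)
    then have "summable (\<lambda>i. of_real r ^ j * (A (i + j) * of_real r ^ i))"
      by (simp add: power_add mult_ac)
    then have "summable (\<lambda>i. A (i + j) * of_real r ^ i)"
      using r0 by (subst (asm) summable_cmult_iff) auto
    then show ?thesis
      by (rule powser_inside) (use r r0 in simp)
  qed
  have "U holomorphic_on ball 0 1"
    by (rule power_series_holomorphic[where a = "\<lambda>i. A (i + j)"])
       (use sm in \<open>auto simp: U_def intro: summable_sums\<close>)
  moreover have "(\<lambda>p. A p * z ^ (p - j)) sums U z" if "z \<in> disk" for z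
  \<comment> \<open>The first \<open>j\<close> terms vanish because \<open>p choose j = 0\<close>
    for \<open>p < j\<close>.\<close>
  proof (rule sums_zero_iff_shift[where n = j, THEN iffD1])
    show "(\<lambda>i. A (i + j) * z ^ (i + j - j)) sums U z"
      using summable_sums[OF sm[OF that]] by (simp add: U_def)
  qed (simp add: A_def)
  ultimately show thesis
    using that[of U] by (simp add: A_def)
qed

text \<open>The sum over \<open>j\<close> in \<open>disk_poly_eq\<close> is finite, so the series
  over \<open>p\<close> is formed for each \<open>j\<close> separately. Expanding
  \<open>(1 - z * cnj z) ^ j\<close> produces powers of \<open>cnj z\<close> up to \<open>q\<close>
  only, hence a \<open>(q + 1)\<close>-analytic sum.\<close>

lemma disk_poly_series:
  assumes \<alpha>: "\<alpha> > -1" and c: "\<And>p. cmod (c p) \<le> B"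
  obtains F where "polyanalytic (Suc q) F"
    and "\<And>z. z \<in> disk \<Longrightarrow> (\<lambda>p. c p * disk_poly \<alpha> p q z) sums F z"
proof -
  have "\<forall>j. \<exists>U. U holomorphic_on disk \<and>
    (\<forall>z\<in>disk. (\<lambda>p. c p * of_real (disk_poly_factor \<alpha> p q * (p choose j)) * z ^ (p - j)) sums U z)"
  proof
    fix j
    show "\<exists>U. U holomorphic_on disk \<and>
      (\<forall>z\<in>disk. (\<lambda>p. c p * of_real (disk_poly_factor \<alpha> p q * (p choose j)) * z ^ (p - j)) sums U z)"
      by (rule disk_poly_coefficient_series[where c = c and q = q and j = j, OF \<alpha> c]) blast
  qed
  then obtain U where U: "\<And>j. U j holomorphic_on disk"
    "\<And>j z. z \<in> disk \<Longrightarrow> (\<lambda>p. c p * of_real (disk_poly_factor \<alpha> p q * (p choose j)) * z ^ (p - j)) sums U j z"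
    by metis
  define g where "g j = (-1) ^ j * complex_of_real ((q + \<alpha>) gchoose (q - j))" for j
  define F where "F z = (\<Sum>j\<le>q. g j * cnj z ^ (q - j) * (1 - z * cnj z) ^ j * U j z)" for z
  have "polyanalytic (Suc q) F"
  proof -
    have "F = (\<lambda>z. \<Sum>j\<le>q. \<Sum>i\<le>j. cnj z ^ (q - j + i) * (g j * of_nat (j choose i) * (-1) ^ i * z ^ i * U j z))"
    proof
      fix z
      have "(1 - z * cnj z) ^ j = (\<Sum>i\<le>j. of_nat (j choose i) * (-1) ^ i * z ^ i * cnj z ^ i)" for j
        using binomial_ring[of "- (z * cnj z)" 1 j]
        by (simp add: power_minus[of "z * cnj z"] power_mult_distrib mult_ac)
      then show "F z = (\<Sum>j\<le>q. \<Sum>i\<le>j. cnj z ^ (q - j + i) * (g j * of_nat (j choose i) * (-1) ^ i * z ^ i * U j z))"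
        unfolding F_def power_add by (simp add: sum_distrib_left sum_distrib_right mult_ac)
    qed
    moreover have "polyanalytic (Suc q)
        (\<lambda>z. \<Sum>j\<le>q. \<Sum>i\<le>j. cnj z ^ (q - j + i) * (g j * of_nat (j choose i) * (-1) ^ i * z ^ i * U j z))"
      by (intro polyanalytic_sum polyanalytic_cnj_power_mult holomorphic_intros U(1)) auto
    ultimately show ?thesis by (simp only:)
  qed
  moreover have "(\<lambda>p. c p * disk_poly \<alpha> p q z) sums F z" if z: "z \<in> disk" for z
  proof -
    have "(\<lambda>p. \<Sum>j\<le>q. g j * cnj z ^ (q - j) * (1 - z * cnj z) ^ j *
        (c p * of_real (disk_poly_factor \<alpha> p q * (p choose j)) * z ^ (p - j))) sums F z"
      unfolding F_def by (intro sums_sum sums_mult U(2) z)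
    moreover have "c p * disk_poly \<alpha> p q z = (\<Sum>j\<le>q. g j * cnj z ^ (q - j) * (1 - z * cnj z) ^ j *
        (c p * of_real (disk_poly_factor \<alpha> p q * (p choose j)) * z ^ (p - j)))" for p
      unfolding disk_poly_eq[OF z] g_def by (simp add: sum_distrib_left mult_ac)
    ultimately show ?thesis by simp
  qed
  ultimately show thesis by (rule that)
qed

lemma orthonormal_seq_disk_poly:
  assumes "\<alpha> > -1"
  shows "orthonormal_seq \<alpha> (\<lambda>p. disk_poly \<alpha> p q)"
  by standard (simp_all add: disk_poly_L2[OF assms] disk_poly_orthonormal[OF assms])

text \<open>Square-summable coefficients are bounded, so the pointwise sum exists and is
  polyanalytic; convergence in the mean then carries orthogonality over to it.\<close>

lemma true_poly_Bergman_synthesis: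
  assumes \<alpha>: "\<alpha> > -1" and c: "summable (\<lambda>p. (cmod (c p))\<^sup>2)"
  obtains F where "F \<in> true_poly_Bergman (Suc q) \<alpha>"
    and "\<And>z. (\<lambda>p. c p * disk_poly \<alpha> p q z) sums F z"
proof -
  interpret orthonormal_seq \<alpha> "\<lambda>p. disk_poly \<alpha> p q"
    by (rule orthonormal_seq_disk_poly[OF \<alpha>])
  have "cmod (c p) \<le> sqrt (\<Sum>p. (cmod (c p))\<^sup>2)" for p
    using sum_le_suminf[OF c, of "{p}"] by (intro real_le_rsqrt) simp
  then obtain F where F: "polyanalytic (Suc q) F" "\<And>z. z \<in> disk \<Longrightarrow> (\<lambda>p. c p * disk_poly \<alpha> p q z) sums F z"
    by (rule disk_poly_series[OF \<alpha>]) (rule that, assumption+)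
  have FL: "F \<in> L2 \<alpha>"
    by (rule series_L2[OF c F(2)])
  have "L2_inner \<alpha> (zero_ext F) g = 0" if g: "g \<in> poly_Bergman q \<alpha>" for g
  proof -
    have "L2_inner \<alpha> (zero_ext F) g = L2_inner \<alpha> F g"
      by (rule L2_inner_cong) (simp_all add: zero_ext_def)
    moreover have "(\<lambda>p. c p * L2_inner \<alpha> (disk_poly \<alpha> p q) g) sums L2_inner \<alpha> F g"
      using g by (intro series_inner[OF c F(2)]) (auto simp: poly_Bergman_iff)
    moreover have "L2_inner \<alpha> (disk_poly \<alpha> p q) g = 0" for p
      using disk_poly_mem_true_poly_Bergman[OF \<alpha>, of p q] g by (simp add: true_poly_Bergman_def)
    ultimately show ?thesis
      using sums_unique by fastforce
  qed
  then have "zero_ext F \<in> true_poly_Bergman (Suc q) \<alpha>"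
    unfolding true_poly_Bergman_def using zero_ext_poly_Bergman[OF F(1) FL] by simp
  moreover have "(\<lambda>p. c p * disk_poly \<alpha> p q z) sums zero_ext F z" for z
    using F(2)[of z] by (auto simp: zero_ext_def disk_poly_def)
  ultimately show thesis by (rule that)
qed

section \<open>Initial topologies and double series\<close>

lemma topspace_initial_topology:
  assumes "F \<noteq> {}"
  shows "topspace (initial_topology X F) = X"
proof -
  obtain \<phi> where "\<phi> \<in> F" using assms by blast
  then have "X \<in> {{x \<in> X. \<phi> x \<in> U} |\<phi> U. \<phi> \<in> F \<and> open U}"
    by (auto intro!: exI[of _ \<phi>] exI[of _ UNIV])
  then show ?thesis
    unfolding initial_topology_def topology_generated_by_topspace by blast
qed

lemma continuous_map_initial_topology:
  assumes "F \<noteq> {}" "G \<noteq> {}" and "\<And>x. x \<in> X \<Longrightarrow> \<Phi> x \<in> Y"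
    and "\<And>\<psi>. \<psi> \<in> G \<Longrightarrow> \<exists>\<phi>\<in>F. \<forall>x\<in>X. \<psi> (\<Phi> x) = \<phi> x"
  shows "continuous_map (initial_topology X F) (initial_topology Y G) \<Phi>"
proof -
  have "continuous_map (initial_topology X F)
      (topology_generated_by {{y \<in> Y. \<psi> y \<in> U} |\<psi> U. \<psi> \<in> G \<and> open U}) \<Phi>"
  proof (rule continuous_on_generated_topo)
    fix V assume "V \<in> {{y \<in> Y. \<psi> y \<in> U} |\<psi> U. \<psi> \<in> G \<and> open U}"
    then obtain \<psi> U where V: "V = {y \<in> Y. \<psi> y \<in> U}" "\<psi> \<in> G" "open U" by blast
    then obtain \<phi> where \<phi>: "\<phi> \<in> F" "\<forall>x\<in>X. \<psi> (\<Phi> x) = \<phi> x"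
      using assms(4) by blast
    have "\<Phi> -` V \<inter> topspace (initial_topology X F) = {x \<in> X. \<phi> x \<in> U}"
      unfolding topspace_initial_topology[OF assms(1)] V(1) using \<phi>(2) assms(3) by auto
    also have "openin (initial_topology X F) \<dots>"
      unfolding initial_topology_def using \<phi>(1) V(3) by (intro topology_generated_by_Basis) blast
    finally show "openin (initial_topology X F) (\<Phi> -` V \<inter> topspace (initial_topology X F))" .
  next
    have "\<Phi> ` topspace (initial_topology X F) \<subseteq> topspace (initial_topology Y G)"
      unfolding topspace_initial_topology[OF assms(1)] topspace_initial_topology[OF assms(2)]
      using assms(3) by blast
    then show "\<Phi> ` topspace (initial_topology X F) \<subseteq> \<Union> {{y \<in> Y. \<psi> y \<in> U} |\<psi> U. \<psi> \<in> G \<and> open U}"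
      unfolding initial_topology_def topology_generated_by_topspace .
  qed
  then show ?thesis
    unfolding initial_topology_def[of Y] .
qed

text \<open>It suffices that the bijection matches the two defining families. The functionals are
  compared on \<open>X\<close> only: those on operators are defined on all functions between
  function spaces.\<close>

lemma homeomorphic_map_initial_topology:
  assumes bij: "bij_betw \<Phi> X Y" and "G \<noteq> {}"
    and FG: "\<And>\<phi>. \<phi> \<in> F \<Longrightarrow> \<exists>\<psi>\<in>G. \<forall>x\<in>X. \<phi> x = \<psi> (\<Phi> x)"
    and GF: "\<And>\<psi>. \<psi> \<in> G \<Longrightarrow> \<exists>\<phi>\<in>F. \<forall>x\<in>X. \<psi> (\<Phi> x) = \<phi> x"
  shows "homeomorphic_map (initial_topology X F) (initial_topology Y G) \<Phi>"
proof -
  have F: "F \<noteq> {}" using \<open>G \<noteq> {}\<close> GF by blast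
  define \<Psi> where "\<Psi> = the_inv_into X \<Phi>"
  have inv: "\<And>x. x \<in> X \<Longrightarrow> \<Psi> (\<Phi> x) = x" "\<And>y. y \<in> Y \<Longrightarrow> \<Phi> (\<Psi> y) = y"
    "\<And>x. x \<in> X \<Longrightarrow> \<Phi> x \<in> Y" "\<And>y. y \<in> Y \<Longrightarrow> \<Psi> y \<in> X"
    using bij unfolding \<Psi>_def bij_betw_def
    by (auto simp: the_inv_into_f_f f_the_inv_into_f intro: the_inv_into_into)
  have "continuous_map (initial_topology X F) (initial_topology Y G) \<Phi>"
    by (rule continuous_map_initial_topology[OF F \<open>G \<noteq> {}\<close>]) (fact inv(3), fact GF)
  moreover have "continuous_map (initial_topology Y G) (initial_topology X F) \<Psi>"
  proof (rule continuous_map_initial_topology[OF \<open>G \<noteq> {}\<close> F])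
    show "\<Psi> y \<in> X" if "y \<in> Y" for y
      by (rule inv(4)[OF that])
    fix \<phi> assume "\<phi> \<in> F"
    then obtain \<psi> where "\<psi> \<in> G" "\<forall>x\<in>X. \<phi> x = \<psi> (\<Phi> x)" using FG by blast
    then show "\<exists>\<psi>\<in>G. \<forall>y\<in>Y. \<phi> (\<Psi> y) = \<psi> y"
      using inv(2,4) by (intro bexI[of _ \<psi>]) auto
  qed
  ultimately show ?thesis
    unfolding homeomorphic_map_maps homeomorphic_maps_def
      topspace_initial_topology[OF F] topspace_initial_topology[OF \<open>G \<noteq> {}\<close>]
    using inv(1,2) by blast
qed

text \<open>Fubini for an absolutely convergent double series: \<open>k\<close> numbers a series of
  functions, and \<open>p\<close> is the integration variable for counting measure.\<close>

lemma
  fixes u :: "nat \<Rightarrow> nat \<Rightarrow> complex"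
  assumes inner: "\<And>k. summable (\<lambda>p. norm (u k p))" and outer: "summable (\<lambda>k. \<Sum>p. norm (u k p))"
  shows suminf_swap: "(\<Sum>k. \<Sum>p. u k p) = (\<Sum>p. \<Sum>k. u k p)"
    and summable_norm_swap: "summable (\<lambda>p. norm (\<Sum>k. u k p))"
    and summable_swap: "summable (\<lambda>k. u k p)"
proof -
  have sk: "summable (\<lambda>k. norm (u k p))" for p
  proof (rule summable_comparison_test'[OF outer, of 0])
    fix k
    show "norm (norm (u k p)) \<le> (\<Sum>p. norm (u k p))"
      using sum_le_suminf[OF inner[of k], of "{p}"] by simp
  qed
  show "summable (\<lambda>k. u k p)"
    by (rule summable_norm_cancel[OF sk])
  have int: "integrable (count_space UNIV) (u k)" for k
    by (simp add: integrable_count_space_nat_iff inner)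
  have ae: "AE p in count_space UNIV. summable (\<lambda>k. norm (u k p))"
    by (rule AE_I2) (rule sk)
  have "(\<integral>p. norm (u k p) \<partial>count_space UNIV) = (\<Sum>p. norm (u k p))" for k
    by (rule integral_count_space_nat) (simp add: integrable_count_space_nat_iff inner)
  then have sm: "summable (\<lambda>k. \<integral>p. norm (u k p) \<partial>count_space UNIV)"
    by (simp add: outer)
  have I: "integrable (count_space UNIV) (\<lambda>p. \<Sum>k. u k p)"
    by (rule integrable_suminf[OF int ae sm])
  then show "summable (\<lambda>p. norm (\<Sum>k. u k p))"
    by (simp add: integrable_count_space_nat_iff)
  have "(\<integral>p. (\<Sum>k. u k p) \<partial>count_space UNIV) = (\<Sum>k. \<integral>p. u k p \<partial>count_space UNIV)"
    by (rule integral_suminf[OF int ae sm])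
  then show "(\<Sum>k. \<Sum>p. u k p) = (\<Sum>p. \<Sum>k. u k p)"
    by (simp add: integral_count_space_nat[OF I] integral_count_space_nat[OF int])
qed

section \<open>Diagonal operators\<close>

text \<open>A Hilbert space of functions in which orthonormal expansions converge pointwise.\<close>

locale coordinate_space =
  fixes \<alpha> :: real and H :: "(complex \<Rightarrow> complex) set" and e :: "nat \<Rightarrow> complex \<Rightarrow> complex"
  assumes H_L2: "f \<in> H \<Longrightarrow> f \<in> L2 \<alpha>"
    and H_add: "f \<in> H \<Longrightarrow> g \<in> H \<Longrightarrow> (\<lambda>z. f z + g z) \<in> H"
    and H_cmult: "f \<in> H \<Longrightarrow> (\<lambda>z. c * f z) \<in> H"
    and e_mem: "e p \<in> H"
    and e_orthonormal: "L2_inner \<alpha> (e p) (e q) = (if p = q then 1 else 0)"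
    and expansion: "f \<in> H \<Longrightarrow> (\<lambda>p. L2_inner \<alpha> f (e p) * e p z) sums f z"
    and synthesis: "summable (\<lambda>p. (cmod (a p))\<^sup>2) \<Longrightarrow> \<exists>F\<in>H. \<forall>z. (\<lambda>p. a p * e p z) sums F z"
begin

sublocale orthonormal_seq \<alpha> e
  by standard (simp_all add: H_L2 e_mem e_orthonormal)

definition coord :: "(complex \<Rightarrow> complex) \<Rightarrow> nat \<Rightarrow> complex" where
  "coord f p = L2_inner \<alpha> f (e p)"

lemma coord_add: "f \<in> H \<Longrightarrow> g \<in> H \<Longrightarrow> coord (\<lambda>z. f z + g z) p = coord f p + coord g p"
  unfolding coord_def by (simp add: L2_inner_add_left H_L2 e_mem)

lemma coord_cmult: "coord (\<lambda>z. c * f z) p = c * coord f p"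
  unfolding coord_def by (rule L2_inner_cmult_left)

lemma coord_e: "coord (e q) p = (if q = p then 1 else 0)"
  unfolding coord_def by (rule e_orthonormal)

lemma coord_summable: "f \<in> H \<Longrightarrow> summable (\<lambda>p. (cmod (coord f p))\<^sup>2)"
  unfolding coord_def by (intro Bessel H_L2)

text \<open>Pointwise convergence of expansions yields equality of functions everywhere. Identities
  between operators are proved below by comparing coordinates.\<close>

lemma coord_inject:
  assumes "f \<in> H" "g \<in> H" "\<And>p. coord f p = coord g p"
  shows "f = g"
proof
  fix z
  show "f z = g z"
    using expansion[OF assms(1), of z] expansion[OF assms(2), of z] assms(3)
    unfolding coord_def by (simp add: sums_unique2)
qed

definition synth :: "(nat \<Rightarrow> complex) \<Rightarrow> complex \<Rightarrow> complex" where
  "synth c z = (\<Sum>p. c p * e p z)"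

lemma
  assumes c: "summable (\<lambda>p. (cmod (c p))\<^sup>2)"
  shows synth_mem: "synth c \<in> H" and synth_sums: "(\<lambda>p. c p * e p z) sums synth c z"
    and coord_synth: "coord (synth c) p = c p"
proof -
  obtain F where F: "F \<in> H" "\<And>z. (\<lambda>p. c p * e p z) sums F z"
    using synthesis[OF c] by blast
  have "synth c = F"
    unfolding synth_def using F(2) by (auto simp: sums_iff)
  then show "synth c \<in> H" "(\<lambda>p. c p * e p z) sums synth c z" "coord (synth c) p = c p"
    using F series_coeff[OF c F(2)] by (simp_all add: coord_def)
qed

text \<open>Parseval's identity in polarized form.\<close>

lemma inner_sums:
  assumes "f \<in> H" "g \<in> H"
  shows "(\<lambda>p. coord f p * cnj (coord g p)) sums L2_inner \<alpha> f g"
proof -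
  have "(\<lambda>p. coord f p * L2_inner \<alpha> (e p) g) sums L2_inner \<alpha> f g"
    by (rule series_inner[OF coord_summable[OF assms(1)] _ H_L2[OF assms(2)]])
       (simp add: coord_def expansion[OF assms(1)])
  then show ?thesis
    unfolding coord_def by (simp only: L2_inner_cnj[of \<alpha> "e _" g])
qed

lemma norm_sums:
  assumes "f \<in> H"
  shows "(\<lambda>p. (cmod (coord f p))\<^sup>2) sums (L2_norm \<alpha> f)\<^sup>2"
proof -
  have "(\<lambda>p. of_real ((cmod (coord f p))\<^sup>2)) sums (of_real ((L2_norm \<alpha> f)\<^sup>2) :: complex)"
    using inner_sums[OF assms assms] unfolding L2_inner_self complex_norm_square .
  then show ?thesis
    by (simp only: sums_of_real_iff)
qed

lemma norm_e: "L2_norm \<alpha> (e p) = 1"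
proof -
  have "complex_of_real ((L2_norm \<alpha> (e p))\<^sup>2) = 1"
    using e_orthonormal[of p p] unfolding L2_inner_self by simp
  then have "(L2_norm \<alpha> (e p))\<^sup>2 = 1"
    by (simp only: of_real_eq_1_iff)
  then show ?thesis
    using L2_norm_nonneg[of \<alpha> "e p"] by (simp add: power2_eq_1_iff)
qed

lemma orthonormal_basis: "orthonormal_basis \<alpha> H e"
  unfolding orthonormal_basis_def
proof (intro conjI allI ballI impI)
  fix f and \<epsilon> :: real assume f: "f \<in> H" and "\<epsilon> > 0"
  have "(\<lambda>N. L2_norm \<alpha> (\<lambda>z. f z - (\<Sum>p<N. coord f p * e p z))) \<longlonglongrightarrow> 0"
    by (rule series_tendsto[OF coord_summable[OF f]]) (simp add: coord_def expansion[OF f])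
  then have "eventually (\<lambda>N. L2_norm \<alpha> (\<lambda>z. f z - (\<Sum>p<N. coord f p * e p z)) < \<epsilon>) sequentially"
    using \<open>\<epsilon> > 0\<close> by (rule order_tendstoD)
  then show "\<exists>N c. L2_norm \<alpha> (\<lambda>z. f z - (\<Sum>p<N. c p * e p z)) < \<epsilon>"
    unfolding eventually_sequentially by blast
qed (simp_all add: e_mem e_orthonormal)

section \<open>Diagonal operators and their eigenvalue sequences\<close>

lemma H_sum: "(\<lambda>z. \<Sum>p<N. c p * e p z) \<in> H" for N :: nat
proof (induction N)
  case 0
  then show ?case using H_cmult[OF e_mem, of 0] by simp
next
  case (Suc N)
  then show ?case using H_add[OF Suc H_cmult[OF e_mem]] by simp
qed

text \<open>A diagonal matrix entry, meaningful for every \<open>S\<close>; it is an eigenvalue once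
  \<open>S\<close> is diagonal.\<close>

definition eigenvalue :: "oper \<Rightarrow> nat \<Rightarrow> complex" where
  "eigenvalue S p = coord (S (e p)) p"

lemma bounded_ops_mem: "S \<in> bounded_ops \<alpha> H \<Longrightarrow> f \<in> H \<Longrightarrow> S f \<in> H"
  unfolding bounded_ops_def by auto

lemma bounded_ops_cmult: "S \<in> bounded_ops \<alpha> H \<Longrightarrow> f \<in> H \<Longrightarrow> S (\<lambda>z. c * f z) = (\<lambda>z. c * S f z)"
  unfolding bounded_ops_def by auto

lemma bounded_ops_add:
  "S \<in> bounded_ops \<alpha> H \<Longrightarrow> f \<in> H \<Longrightarrow> g \<in> H \<Longrightarrow> S (\<lambda>z. f z + g z) = (\<lambda>z. S f z + S g z)"
  unfolding bounded_ops_def by auto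

lemma bounded_ops_bound:
  assumes "S \<in> bounded_ops \<alpha> H"
  obtains C where "\<And>f. f \<in> H \<Longrightarrow> L2_norm \<alpha> (S f) \<le> C * L2_norm \<alpha> f"
proof -
  have "\<exists>C. \<forall>f\<in>H. L2_norm \<alpha> (S f) \<le> C * L2_norm \<alpha> f"
    using assms unfolding bounded_ops_def by blast
  then show thesis using that by blast
qed

lemma diagonal_ops_bounded: "S \<in> diagonal_ops \<alpha> H e \<Longrightarrow> S \<in> bounded_ops \<alpha> H"
  unfolding diagonal_ops_def by simp

lemma diagonal_ops_e:
  assumes "S \<in> diagonal_ops \<alpha> H e"
  shows "S (e p) = (\<lambda>z. eigenvalue S p * e p z)"
proof -
  obtain c where c: "S (e p) = (\<lambda>z. c * e p z)"
    using assms unfolding diagonal_ops_def by blast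
  then have "eigenvalue S p = c"
    unfolding eigenvalue_def by (simp add: coord_cmult coord_e)
  then show ?thesis using c by simp
qed

lemma diagonal_ops_sum:
  fixes N :: nat
  assumes S: "S \<in> diagonal_ops \<alpha> H e"
  shows "S (\<lambda>z. \<Sum>p<N. c p * e p z) = (\<lambda>z. \<Sum>p<N. c p * eigenvalue S p * e p z)"
proof (induction N)
  case 0
  then show ?case
    using bounded_ops_cmult[OF diagonal_ops_bounded[OF S] e_mem, of 0] by simp
next
  case (Suc N)
  have "S (\<lambda>z. (\<Sum>p<N. c p * e p z) + c N * e N z) =
      (\<lambda>z. S (\<lambda>z. \<Sum>p<N. c p * e p z) z + S (\<lambda>z. c N * e N z) z)"
    by (rule bounded_ops_add[OF diagonal_ops_bounded[OF S] H_sum H_cmult[OF e_mem]])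
  also have "S (\<lambda>z. c N * e N z) = (\<lambda>z. c N * S (e N) z)"
    by (rule bounded_ops_cmult[OF diagonal_ops_bounded[OF S] e_mem])
  finally show ?case
    unfolding Suc diagonal_ops_e[OF S] by (simp add: mult.assoc)
qed

text \<open>\<open>diagonal_ops\<close> prescribes \<open>S\<close> on the basis vectors only.
  Linearity settles partial sums, and boundedness extends the formula: the error in a coordinate is
  at most \<open>C\<close> times the norm of the remainder of the expansion.\<close>

lemma coord_diagonal_ops:
  assumes S: "S \<in> diagonal_ops \<alpha> H e" and f: "f \<in> H"
  shows "coord (S f) q = eigenvalue S q * coord f q"
proof -
  let ?P = "\<lambda>N z. \<Sum>p<N. coord f p * e p z"
  note bd = diagonal_ops_bounded[OF S]
  obtain C where C: "\<And>f. f \<in> H \<Longrightarrow> L2_norm \<alpha> (S f) \<le> C * L2_norm \<alpha> f"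
    using bounded_ops_bound[OF bd] by metis
  have bound: "cmod (coord (S f) q - eigenvalue S q * coord f q) \<le>
      C * L2_norm \<alpha> (\<lambda>z. f z - ?P N z)" if N: "q < N" for N
  proof -
    define g where "g = (\<lambda>z. f z + (-1) * ?P N z)"
    have g: "g \<in> H"
      unfolding g_def by (rule H_add[OF f H_cmult[OF H_sum]])
    have "S g = (\<lambda>z. S f z + (-1) * S (?P N) z)"
      unfolding g_def
      by (simp only: bounded_ops_add[OF bd f H_cmult[OF H_sum]] bounded_ops_cmult[OF bd H_sum])
    then have "coord (S g) q = coord (S f) q - coord (S (?P N)) q"
      by (simp only: coord_add[OF bounded_ops_mem[OF bd f] H_cmult[OF bounded_ops_mem[OF bd H_sum]]]
          coord_cmult) simp
    also have "coord (S (?P N)) q = (\<Sum>p<N. coord f p * eigenvalue S p * coord (e p) q)"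
      unfolding diagonal_ops_sum[OF S] unfolding coord_def by (simp add: inner_comb_left e_L2)
    also have "\<dots> = eigenvalue S q * coord f q"
      using N by (simp add: coord_e if_distrib mult.commute cong: if_cong)
    finally have "cmod (coord (S f) q - eigenvalue S q * coord f q) = cmod (L2_inner \<alpha> (S g) (e q))"
      by (simp add: coord_def)
    also have "\<dots> \<le> L2_norm \<alpha> (S g) * L2_norm \<alpha> (e q)"
      by (intro L2_Cauchy_Schwarz H_L2 bounded_ops_mem[OF bd g] e_mem)
    also have "\<dots> \<le> C * L2_norm \<alpha> g"
      using C[OF g] by (simp add: norm_e)
    finally show ?thesis
      by (simp add: g_def)
  qed
  have "(\<lambda>N. L2_norm \<alpha> (\<lambda>z. f z - ?P N z)) \<longlonglongrightarrow> 0"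
    by (rule series_tendsto[OF coord_summable[OF f]]) (simp add: coord_def expansion[OF f])
  then have "(\<lambda>N. C * L2_norm \<alpha> (\<lambda>z. f z - ?P N z)) \<longlonglongrightarrow> C * 0"
    by (rule tendsto_mult_left)
  then have "cmod (coord (S f) q - eigenvalue S q * coord f q) \<le> C * 0"
    by (rule tendsto_lowerbound[OF _ eventually_sequentiallyI[of "Suc q"]]) (use bound in auto)
  then show ?thesis by simp
qed

lemma eigenvalue_bounded:
  assumes S: "S \<in> diagonal_ops \<alpha> H e"
  shows "bounded (range (eigenvalue S))"
proof -
  obtain C where C: "\<And>f. f \<in> H \<Longrightarrow> L2_norm \<alpha> (S f) \<le> C * L2_norm \<alpha> f"
    using bounded_ops_bound[OF diagonal_ops_bounded[OF S]] by metis
  have "cmod (eigenvalue S p) \<le> C" for p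
    using C[OF e_mem[of p]] unfolding diagonal_ops_e[OF S] by (simp add: L2_norm_cmult norm_e)
  then show ?thesis
    by (auto intro!: boundedI)
qed

lemma norm_le_if_coord_le:
  assumes "f \<in> H" "g \<in> H" and B: "B \<ge> 0" and le: "\<And>p. cmod (coord f p) \<le> B * cmod (coord g p)"
  shows "L2_norm \<alpha> f \<le> B * L2_norm \<alpha> g"
proof -
  have "(L2_norm \<alpha> f)\<^sup>2 \<le> B\<^sup>2 * (L2_norm \<alpha> g)\<^sup>2"
  proof (rule sums_le[OF _ norm_sums[OF assms(1)] sums_mult[OF norm_sums[OF assms(2)]]])
    show "(cmod (coord f p))\<^sup>2 \<le> B\<^sup>2 * (cmod (coord g p))\<^sup>2" for p
      using power_mono[OF le[of p], of 2] by (simp add: power_mult_distrib)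
  qed
  then have "(L2_norm \<alpha> f)\<^sup>2 \<le> (B * L2_norm \<alpha> g)\<^sup>2"
    by (simp add: power_mult_distrib)
  then show ?thesis
    using B by (intro power2_le_imp_le[of "L2_norm \<alpha> f"]) (auto simp: L2_norm_nonneg)
qed

definition diag :: "(nat \<Rightarrow> complex) \<Rightarrow> oper" where
  "diag x = (\<lambda>f\<in>H. synth (\<lambda>p. x p * coord f p))"

lemma
  assumes x: "bounded (range x)" and f: "f \<in> H"
  shows diag_mem: "diag x f \<in> H" and coord_diag: "coord (diag x f) p = x p * coord f p"
proof -
  obtain B where B: "\<And>p. cmod (x p) \<le> B"
    using x unfolding bounded_iff by auto
  have "summable (\<lambda>p. (cmod (x p * coord f p))\<^sup>2)"
  proof (rule summable_comparison_test'[OF summable_mult[OF coord_summable[OF f], of "B\<^sup>2"], of 0])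
    fix p
    have "(cmod (x p))\<^sup>2 \<le> B\<^sup>2"
      by (rule power_mono[OF B norm_ge_zero])
    then show "norm ((cmod (x p * coord f p))\<^sup>2) \<le> B\<^sup>2 * (cmod (coord f p))\<^sup>2"
      by (simp add: norm_mult power_mult_distrib mult_right_mono)
  qed
  then show "diag x f \<in> H" "coord (diag x f) p = x p * coord f p"
    using f by (simp_all add: diag_def synth_mem coord_synth)
qed

lemma diag_bounded_ops:
  assumes x: "bounded (range x)"
  shows "diag x \<in> bounded_ops \<alpha> H"
proof -
  obtain B where B: "B \<ge> 0" "\<And>p. cmod (x p) \<le> B"
    using x unfolding bounded_iff by (metis norm_ge_zero order_trans rangeI)
  note mem = diag_mem[OF x] and cd = coord_diag[OF x]
  have "diag x \<in> H \<rightarrow>\<^sub>E H"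
    using mem by (auto simp: diag_def)
  moreover have "diag x (\<lambda>z. f z + g z) = (\<lambda>z. diag x f z + diag x g z)" if "f \<in> H" "g \<in> H" for f g
    using that by (intro coord_inject) (simp_all add: mem cd H_add coord_add distrib_left)
  moreover have "diag x (\<lambda>z. c * f z) = (\<lambda>z. c * diag x f z)" if "f \<in> H" for f c
    using that by (intro coord_inject) (simp_all add: mem cd H_cmult coord_cmult)
  moreover have "L2_norm \<alpha> (diag x f) \<le> B * L2_norm \<alpha> f" if "f \<in> H" for f
    using that B by (intro norm_le_if_coord_le) (auto simp: mem cd norm_mult mult_right_mono)
  ultimately show ?thesis
    unfolding bounded_ops_def by (intro CollectI conjI ballI allI exI[of _ B])
qed

lemma diag_e:
  assumes x: "bounded (range x)"
  shows "diag x (e p) = (\<lambda>z. x p * e p z)"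
  by (rule coord_inject) (auto simp: diag_mem[OF x] coord_diag[OF x] e_mem H_cmult coord_cmult coord_e)

lemma diag_diagonal_ops: "bounded (range x) \<Longrightarrow> diag x \<in> diagonal_ops \<alpha> H e"
  unfolding diagonal_ops_def using diag_bounded_ops diag_e by blast

lemma eigenvalue_diag: "bounded (range x) \<Longrightarrow> eigenvalue (diag x) = x"
  by (simp add: fun_eq_iff eigenvalue_def coord_diag e_mem coord_e)

lemma bounded_ops_eqI:
  assumes "S \<in> bounded_ops \<alpha> H" "T \<in> bounded_ops \<alpha> H" "\<And>f p. f \<in> H \<Longrightarrow> coord (S f) p = coord (T f) p"
  shows "S = T"
proof (rule extensionalityI[of _ H])
  show "S \<in> extensional H" "T \<in> extensional H"
    using assms(1,2) unfolding bounded_ops_def PiE_def by auto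
  show "S f = T f" if "f \<in> H" for f
    by (rule coord_inject[OF bounded_ops_mem[OF assms(1) that] bounded_ops_mem[OF assms(2) that]])
       (rule assms(3)[OF that])
qed

lemma bij_betw_eigenvalue: "bij_betw eigenvalue (diagonal_ops \<alpha> H e) {x. bounded (range x)}"
proof (rule bij_betwI[where g = diag])
  show "diag (eigenvalue S) = S" if "S \<in> diagonal_ops \<alpha> H e" for S
    using that
    by (intro bounded_ops_eqI diag_bounded_ops eigenvalue_bounded diagonal_ops_bounded)
       (simp_all add: coord_diag eigenvalue_bounded coord_diagonal_ops)
qed (auto simp: eigenvalue_bounded diag_diagonal_ops eigenvalue_diag)

text \<open>\<open>op_adjoint\<close> is a definite description, so existence and uniqueness are
  both due; uniqueness follows by testing against basis vectors.\<close>

lemma op_adjoint_diagonal: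
  assumes S: "S \<in> diagonal_ops \<alpha> H e"
  shows "op_adjoint \<alpha> H S = diag (\<lambda>p. cnj (eigenvalue S p))"
proof -
  define x where "x = (\<lambda>p. cnj (eigenvalue S p))"
  have x: "bounded (range x)"
    using eigenvalue_bounded[OF S] by (auto simp: bounded_iff x_def)
  have adj: "L2_inner \<alpha> (S f) g = L2_inner \<alpha> f (diag x g)" if "f \<in> H" "g \<in> H" for f g
  proof -
    have "(\<lambda>p. coord (S f) p * cnj (coord g p)) sums L2_inner \<alpha> (S f) g"
      by (rule inner_sums[OF bounded_ops_mem[OF diagonal_ops_bounded[OF S] that(1)] that(2)])
    moreover have "(\<lambda>p. coord f p * cnj (coord (diag x g) p)) sums L2_inner \<alpha> f (diag x g)"
      by (rule inner_sums[OF that(1) diag_mem[OF x that(2)]])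
    moreover have "coord (S f) p * cnj (coord g p) = coord f p * cnj (coord (diag x g) p)" for p
      unfolding coord_diagonal_ops[OF S that(1)] coord_diag[OF x that(2)] by (simp add: x_def)
    ultimately show ?thesis
      by (simp add: sums_unique2)
  qed
  show ?thesis
    unfolding op_adjoint_def x_def[symmetric]
  proof (rule the_equality)
    show "diag x \<in> bounded_ops \<alpha> H \<and> (\<forall>f\<in>H. \<forall>g\<in>H. L2_inner \<alpha> (S f) g = L2_inner \<alpha> f (diag x g))"
      using diag_bounded_ops[OF x] adj by blast
    fix T assume T: "T \<in> bounded_ops \<alpha> H \<and> (\<forall>f\<in>H. \<forall>g\<in>H. L2_inner \<alpha> (S f) g = L2_inner \<alpha> f (T g))"
    show "T = diag x"
    proof (rule bounded_ops_eqI)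
      fix g p assume g: "g \<in> H"
      have "L2_inner \<alpha> (e p) (T g) = L2_inner \<alpha> (e p) (diag x g)"
        using T adj[OF e_mem g] e_mem g by metis
      then show "coord (T g) p = coord (diag x g) p"
        unfolding coord_def by (metis L2_inner_cnj)
    qed (use T diag_bounded_ops[OF x] in auto)
  qed
qed

text \<open>Parseval's identity bounds the norm by the supremum, and the unit vectors
  \<open>e p\<close> show that no smaller bound is possible.\<close>

lemma op_norm_diagonal:
  assumes S: "S \<in> diagonal_ops \<alpha> H e"
  shows "op_norm \<alpha> H S = (SUP p. cmod (eigenvalue S p))"
proof -
  define B where "B = (SUP p. cmod (eigenvalue S p))"
  have bdd: "bdd_above (range (\<lambda>p. cmod (eigenvalue S p)))"
    by (rule bounded_imp_bdd_above[OF bounded_norm_comp[THEN iffD2, OF eigenvalue_bounded[OF S]]])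
  have le: "cmod (eigenvalue S p) \<le> B" for p
    unfolding B_def by (rule cSUP_upper[OF UNIV_I bdd])
  have B0: "B \<ge> 0"
    using le[of 0] norm_ge_zero order_trans by blast
  have bound: "L2_norm \<alpha> (S f) \<le> B" if f: "f \<in> H" "L2_norm \<alpha> f \<le> 1" for f
  proof -
    have "L2_norm \<alpha> (S f) \<le> B * L2_norm \<alpha> f"
      using f(1) le
      by (intro norm_le_if_coord_le bounded_ops_mem[OF diagonal_ops_bounded[OF S]] B0)
         (auto simp: coord_diagonal_ops[OF S] norm_mult mult_right_mono)
    also have "\<dots> \<le> B * 1"
      using f(2) B0 by (intro mult_left_mono)
    finally show ?thesis by simp
  qed
  have bdd2: "bdd_above ((\<lambda>f. L2_norm \<alpha> (S f)) ` {f \<in> H. L2_norm \<alpha> f \<le> 1})"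
    using bound by (intro bdd_aboveI2) auto
  show ?thesis
    unfolding op_norm_def B_def[symmetric]
  proof (rule antisym)
    show "(SUP f\<in>{f \<in> H. L2_norm \<alpha> f \<le> 1}. L2_norm \<alpha> (S f)) \<le> B"
      using bound e_mem[of 0] norm_e[of 0] by (intro cSUP_least) auto
    show "B \<le> (SUP f\<in>{f \<in> H. L2_norm \<alpha> f \<le> 1}. L2_norm \<alpha> (S f))"
      unfolding B_def
    proof (rule cSUP_least)
      fix p
      have "cmod (eigenvalue S p) = L2_norm \<alpha> (S (e p))"
        unfolding diagonal_ops_e[OF S] by (simp add: L2_norm_cmult norm_e)
      also have "\<dots> \<le> (SUP f\<in>{f \<in> H. L2_norm \<alpha> f \<le> 1}. L2_norm \<alpha> (S f))"
        by (rule cSUP_upper[OF _ bdd2]) (simp add: e_mem norm_e)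
      finally show "cmod (eigenvalue S p) \<le> (SUP f\<in>{f \<in> H. L2_norm \<alpha> f \<le> 1}. L2_norm \<alpha> (S f))" .
    qed simp
  qed
qed

lemma eigenvalue_mult:
  assumes "S \<in> diagonal_ops \<alpha> H e" "T \<in> diagonal_ops \<alpha> H e"
  shows "eigenvalue (compose H S T) p = eigenvalue S p * eigenvalue T p"
  using assms bounded_ops_mem[OF diagonal_ops_bounded[OF assms(2)] e_mem]
  by (simp add: eigenvalue_def[of "compose H S T"] compose_eq e_mem coord_diagonal_ops coord_e)

text \<open>Expanding every inner product gives a double series, dominated through
  \<open>\<bar>x * y\<bar> \<le> x\<^sup>2 + y\<^sup>2\<close> by the squared norms of the
  \<open>f k\<close> and \<open>g k\<close>; interchanging the sums collects the coefficient of each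
  eigenvalue.\<close>

lemma weak_functional_eigenvalues:
  assumes f: "range f \<subseteq> H" "summable (\<lambda>k. (L2_norm \<alpha> (f k))\<^sup>2)"
    and g: "range g \<subseteq> H" "summable (\<lambda>k. (L2_norm \<alpha> (g k))\<^sup>2)"
  defines "a \<equiv> \<lambda>p. \<Sum>k. coord (f k) p * cnj (coord (g k) p)"
  shows "summable (\<lambda>p. cmod (a p))"
    and "S \<in> diagonal_ops \<alpha> H e \<Longrightarrow> (\<Sum>k. L2_inner \<alpha> (S (f k)) (g k)) = (\<Sum>p. a p * eigenvalue S p)"
proof -
  have fk: "f k \<in> H" and gk: "g k \<in> H" for k using f(1) g(1) by auto
  \<comment> \<open>Stated for any bounded \<open>x\<close>: the constant 1 gives summability of
    \<open>a\<close>, the eigenvalue sequence the formula for the functional.\<close>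
  have swap: "(\<forall>k. summable (\<lambda>p. norm (x p * (coord (f k) p * cnj (coord (g k) p))))) \<and>
      summable (\<lambda>k. \<Sum>p. norm (x p * (coord (f k) p * cnj (coord (g k) p))))"
    if x: "bounded (range x)" for x :: "nat \<Rightarrow> complex"
  proof -
    obtain B where B: "B \<ge> 0" "\<And>p. cmod (x p) \<le> B"
      using x unfolding bounded_iff by (metis norm_ge_zero order_trans rangeI)
    define m where "m k p = B * ((cmod (coord (f k) p))\<^sup>2 + (cmod (coord (g k) p))\<^sup>2)" for k p
    have m: "m k sums (B * ((L2_norm \<alpha> (f k))\<^sup>2 + (L2_norm \<alpha> (g k))\<^sup>2))" for k
      unfolding m_def by (intro sums_mult sums_add norm_sums fk gk)
    have le: "norm (x p * (coord (f k) p * cnj (coord (g k) p))) \<le> m k p" for k p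
    proof -
      have "cmod (coord (f k) p) * cmod (coord (g k) p) \<le> (cmod (coord (f k) p))\<^sup>2 + (cmod (coord (g k) p))\<^sup>2"
      proof -
        have "0 \<le> cmod (coord (f k) p) * cmod (coord (g k) p)" by simp
        then show ?thesis
          using sum_squares_bound[of "cmod (coord (f k) p)" "cmod (coord (g k) p)"] by linarith
      qed
      then show ?thesis
        unfolding m_def norm_mult complex_mod_cnj using B by (intro mult_mono) auto
    qed
    have 1: "summable (\<lambda>p. norm (x p * (coord (f k) p * cnj (coord (g k) p))))" for k
      by (rule summable_comparison_test'[OF sums_summable[OF m[of k]], of 0]) (use le in simp)
    have 2: "summable (\<lambda>k. \<Sum>p. norm (x p * (coord (f k) p * cnj (coord (g k) p))))"
    proof (rule summable_comparison_test'[of "\<lambda>k. B * ((L2_norm \<alpha> (f k))\<^sup>2 + (L2_norm \<alpha> (g k))\<^sup>2)" 0])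
      show "summable (\<lambda>k. B * ((L2_norm \<alpha> (f k))\<^sup>2 + (L2_norm \<alpha> (g k))\<^sup>2))"
        by (intro summable_mult summable_add f g)
      fix k
      have "(\<Sum>p. norm (x p * (coord (f k) p * cnj (coord (g k) p)))) \<le> B * ((L2_norm \<alpha> (f k))\<^sup>2 + (L2_norm \<alpha> (g k))\<^sup>2)"
        by (rule sums_le[OF le summable_sums[OF 1] m])
      moreover have "0 \<le> (\<Sum>p. norm (x p * (coord (f k) p * cnj (coord (g k) p))))"
        by (rule suminf_nonneg[OF 1]) simp
      ultimately show "norm (\<Sum>p. norm (x p * (coord (f k) p * cnj (coord (g k) p)))) \<le>
          B * ((L2_norm \<alpha> (f k))\<^sup>2 + (L2_norm \<alpha> (g k))\<^sup>2)"
        by simp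
    qed
    show ?thesis using 1 2 by blast
  qed
  have one: "bounded (range (\<lambda>p::nat. 1::complex))" by simp
  note sw1 = swap[OF one, unfolded mult_1_left]
  have s1: "\<And>k. summable (\<lambda>p. norm (coord (f k) p * cnj (coord (g k) p)))"
    and s2: "summable (\<lambda>k. \<Sum>p. norm (coord (f k) p * cnj (coord (g k) p)))"
    using sw1 by auto
  show "summable (\<lambda>p. cmod (a p))"
    unfolding a_def by (rule summable_norm_swap[OF s1 s2])
  assume S: "S \<in> diagonal_ops \<alpha> H e"
  have t1: "\<And>k. summable (\<lambda>p. norm (eigenvalue S p * (coord (f k) p * cnj (coord (g k) p))))"
    and t2: "summable (\<lambda>k. \<Sum>p. norm (eigenvalue S p * (coord (f k) p * cnj (coord (g k) p))))"
    using swap[OF eigenvalue_bounded[OF S]] by auto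
  have "L2_inner \<alpha> (S (f k)) (g k) = (\<Sum>p. eigenvalue S p * (coord (f k) p * cnj (coord (g k) p)))" for k
    using inner_sums[OF bounded_ops_mem[OF diagonal_ops_bounded[OF S] fk] gk, of k k]
    by (simp add: coord_diagonal_ops[OF S fk] sums_iff mult.assoc)
  then have "(\<Sum>k. L2_inner \<alpha> (S (f k)) (g k)) = (\<Sum>k. \<Sum>p. eigenvalue S p * (coord (f k) p * cnj (coord (g k) p)))"
    by simp
  also have "\<dots> = (\<Sum>p. \<Sum>k. eigenvalue S p * (coord (f k) p * cnj (coord (g k) p)))"
    by (rule suminf_swap[OF t1 t2])
  also have "\<dots> = (\<Sum>p. a p * eigenvalue S p)"
    unfolding a_def by (simp add: suminf_mult[OF summable_swap[OF s1 s2]] mult.commute)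
  finally show "(\<Sum>k. L2_inner \<alpha> (S (f k)) (g k)) = (\<Sum>p. a p * eigenvalue S p)" .
qed

text \<open>A summable sequence factors as \<open>a k = s k * cnj (t k)\<close> with both factors
  square-summable; scaled basis vectors then realize it as an ultraweak functional.\<close>

lemma weak_functional_exists:
  assumes a: "summable (\<lambda>p. cmod (a p))"
  shows "\<exists>\<phi>\<in>ultraweak_functionals \<alpha> H. \<forall>S\<in>diagonal_ops \<alpha> H e. (\<Sum>p. a p * eigenvalue S p) = \<phi> S"
proof -
  define s where "s k = complex_of_real (sqrt (cmod (a k)))" for k
  \<comment> \<open>If \<open>a k = 0\<close>, division by zero gives \<open>t k = 0\<close>, as
    wanted.\<close>
  define t where "t k = cnj (a k) / s k" for k
  define f where "f k = (\<lambda>z. s k * e k z)" for k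
  define g where "g k = (\<lambda>z. t k * e k z)" for k
  have st: "s k * cnj (t k) = a k" for k
    by (simp add: t_def s_def)
  have ns: "(cmod (s k))\<^sup>2 = cmod (a k)" for k
    by (simp add: s_def)
  have nt: "(cmod (t k))\<^sup>2 = cmod (a k)" for k
  proof -
    have "(cmod (t k))\<^sup>2 = (cmod (a k))\<^sup>2 / cmod (a k)"
      by (simp add: t_def norm_divide power_divide ns)
    then show ?thesis
      by (simp add: power2_eq_square)
  qed
  have fH: "f k \<in> H" and gH: "g k \<in> H" for k
    unfolding f_def g_def by (intro H_cmult e_mem)+
  have nf: "(L2_norm \<alpha> (f k))\<^sup>2 = cmod (a k)" and ng: "(L2_norm \<alpha> (g k))\<^sup>2 = cmod (a k)" for k
    unfolding f_def g_def by (simp_all add: L2_norm_cmult norm_e ns nt)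
  have "(\<lambda>S. \<Sum>k. L2_inner \<alpha> (S (f k)) (g k)) \<in> ultraweak_functionals \<alpha> H"
    unfolding ultraweak_functionals_def using fH gH a
    by (intro CollectI exI[of _ f] exI[of _ g]) (auto simp: nf ng)
  moreover have "(\<Sum>p. a p * eigenvalue S p) = (\<Sum>k. L2_inner \<alpha> (S (f k)) (g k))"
    if S: "S \<in> diagonal_ops \<alpha> H e" for S
  proof (rule arg_cong[of _ _ suminf], rule ext)
    fix k
    have "S (f k) = (\<lambda>z. s k * (eigenvalue S k * e k z))"
      unfolding f_def bounded_ops_cmult[OF diagonal_ops_bounded[OF S] e_mem] diagonal_ops_e[OF S] ..
    then have "L2_inner \<alpha> (S (f k)) (g k) = s k * (eigenvalue S k * cnj (t k))"
      unfolding g_def by (simp add: L2_inner_cmult_left L2_inner_cmult_right e_orthonormal)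
    then show "a k * eigenvalue S k = L2_inner \<alpha> (S (f k)) (g k)"
      unfolding st[of k, symmetric] by (simp add: mult_ac)
  qed
  ultimately show ?thesis
    by (intro rev_bexI[of "\<lambda>S. \<Sum>k. L2_inner \<alpha> (S (f k)) (g k)"] ballI)
qed

lemma diagonal_ops_isomorphic_l_infinity:
  "wstar_isomorphic (operator_algebra \<alpha> H (diagonal_ops \<alpha> H e)) l_infinity"
proof -
  let ?F = "{\<lambda>x. (\<Sum>p. a p * x p) | a. summable (\<lambda>p. cmod (a p))} :: ((nat \<Rightarrow> complex) \<Rightarrow> complex) set"
  have mem: "S (e p) \<in> H" if "S \<in> diagonal_ops \<alpha> H e" for S p
    by (rule bounded_ops_mem[OF diagonal_ops_bounded[OF that] e_mem])
  have add: "eigenvalue (\<lambda>f\<in>H. \<lambda>z. S f z + T f z) = (\<lambda>p. eigenvalue S p + eigenvalue T p)"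
    if "S \<in> diagonal_ops \<alpha> H e" "T \<in> diagonal_ops \<alpha> H e" for S T
    using that by (simp add: fun_eq_iff eigenvalue_def e_mem coord_add mem)
  have scale: "eigenvalue (\<lambda>f\<in>H. \<lambda>z. c * S f z) = (\<lambda>p. c * eigenvalue S p)" for c S
    by (simp add: fun_eq_iff eigenvalue_def e_mem coord_cmult)
  have star: "eigenvalue (op_adjoint \<alpha> H S) = (\<lambda>p. cnj (eigenvalue S p))" if S: "S \<in> diagonal_ops \<alpha> H e" for S
    unfolding op_adjoint_diagonal[OF S]
    by (rule eigenvalue_diag) (use eigenvalue_bounded[OF S] in \<open>auto simp: bounded_iff\<close>)
  have top: "homeomorphic_map (initial_topology (diagonal_ops \<alpha> H e) (ultraweak_functionals \<alpha> H))
      (initial_topology {x. bounded (range x)} ?F) eigenvalue"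
  proof (rule homeomorphic_map_initial_topology[OF bij_betw_eigenvalue])
    have "(\<lambda>x. \<Sum>p. 0 * x p) \<in> ?F"
      by (intro CollectI exI[of _ "\<lambda>p. 0"]) simp
    then show "?F \<noteq> {}" by blast
    fix \<phi> assume "\<phi> \<in> ultraweak_functionals \<alpha> H"
    then obtain f g where fg: "\<phi> = (\<lambda>S. \<Sum>k. L2_inner \<alpha> (S (f k)) (g k))"
      "range f \<subseteq> H" "summable (\<lambda>k. (L2_norm \<alpha> (f k))\<^sup>2)" "range g \<subseteq> H" "summable (\<lambda>k. (L2_norm \<alpha> (g k))\<^sup>2)"
      unfolding ultraweak_functionals_def by (elim CollectE exE conjE) (rule that)
    let ?a = "\<lambda>p. \<Sum>k. coord (f k) p * cnj (coord (g k) p)"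
    have "(\<lambda>x. \<Sum>p. ?a p * x p) \<in> ?F"
      using weak_functional_eigenvalues(1)[OF fg(2-5)] by (intro CollectI exI[of _ ?a] conjI refl)
    moreover have "\<forall>S\<in>diagonal_ops \<alpha> H e. \<phi> S = (\<Sum>p. ?a p * eigenvalue S p)"
      unfolding fg(1) using weak_functional_eigenvalues(2)[OF fg(2-5)] by blast
    ultimately show "\<exists>\<psi>\<in>?F. \<forall>S\<in>diagonal_ops \<alpha> H e. \<phi> S = \<psi> (eigenvalue S)"
      by (intro bexI[of _ "\<lambda>x. \<Sum>p. ?a p * x p"])
  next
    fix \<psi> assume "\<psi> \<in> ?F"
    then obtain a where "\<psi> = (\<lambda>x. \<Sum>p. a p * x p)" "summable (\<lambda>p. cmod (a p))" by blast
    then show "\<exists>\<phi>\<in>ultraweak_functionals \<alpha> H. \<forall>S\<in>diagonal_ops \<alpha> H e. \<psi> (eigenvalue S) = \<phi> S"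
      using weak_functional_exists[of a] by simp
  qed
  have "wstar_isometric_iso (operator_algebra \<alpha> H (diagonal_ops \<alpha> H e)) l_infinity eigenvalue"
    unfolding wstar_isometric_iso_def operator_algebra_def l_infinity_def
    using top bij_betw_eigenvalue
    by (simp add: add scale star op_norm_diagonal eigenvalue_mult fun_eq_iff)
  then show ?thesis
    unfolding wstar_isomorphic_def by blast
qed

end

section \<open>Radial operators\<close>

text \<open>\<open>\<omega> \<tau> p\<close> is the factor by which the rotation acts on
  \<open>e p\<close>. Modulus one preserves square-summability of coordinates; separation of the
  indices forces off-diagonal entries to vanish.\<close>

locale rotation_coordinate_space = coordinate_space +
  fixes \<omega> :: "complex \<Rightarrow> nat \<Rightarrow> complex"
  assumes e_rotation: "cmod \<tau> = 1 \<Longrightarrow> e p (inverse \<tau> * z) = \<omega> \<tau> p * e p z"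
    and norm_character: "cmod \<tau> = 1 \<Longrightarrow> cmod (\<omega> \<tau> p) = 1"
    and character_separates: "p \<noteq> q \<Longrightarrow> \<exists>\<tau>. cmod \<tau> = 1 \<and> \<omega> \<tau> p \<noteq> \<omega> \<tau> q"
begin

text \<open>Invariance of \<open>H\<close> under rotations is derived: substituting the rotated
  point into the pointwise expansion multiplies the coordinates by numbers of modulus one, and
  synthesis gives an element of \<open>H\<close>.\<close>

lemma
  assumes \<tau>: "cmod \<tau> = 1" and f: "f \<in> H"
  shows rotation_mem: "(\<lambda>z. f (inverse \<tau> * z)) \<in> H"
    and coord_rotation: "coord (\<lambda>z. f (inverse \<tau> * z)) p = \<omega> \<tau> p * coord f p"
proof -
  let ?c = "\<lambda>p. \<omega> \<tau> p * coord f p"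
  have c: "summable (\<lambda>p. (cmod (?c p))\<^sup>2)"
    using coord_summable[OF f] by (simp add: norm_mult norm_character[OF \<tau>])
  have "synth ?c = (\<lambda>z. f (inverse \<tau> * z))"
  proof
    fix z
    have "(\<lambda>p. coord f p * e p (inverse \<tau> * z)) sums f (inverse \<tau> * z)"
      unfolding coord_def by (rule expansion[OF f])
    moreover have "coord f p * e p (inverse \<tau> * z) = ?c p * e p z" for p
      unfolding e_rotation[OF \<tau>] by (simp only: mult_ac)
    ultimately have "(\<lambda>p. ?c p * e p z) sums f (inverse \<tau> * z)"
      by (simp only:)
    then show "synth ?c z = f (inverse \<tau> * z)"
      by (rule sums_unique2[OF synth_sums[OF c]])
  qed
  then show "(\<lambda>z. f (inverse \<tau> * z)) \<in> H" "coord (\<lambda>z. f (inverse \<tau> * z)) p = \<omega> \<tau> p * coord f p"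
    using synth_mem[OF c] coord_synth[OF c] by simp_all
qed

text \<open>Applying both orders of composition to \<open>e p\<close> and taking the coordinate
  \<open>q\<close> gives that entry of \<open>S\<close> once times \<open>\<omega> \<tau> p\<close>
  and once times \<open>\<omega> \<tau> q\<close>; a separating \<open>\<tau>\<close> makes it
  zero.\<close>

lemma commuting_with_rotations_iff_diagonal:
  "{S \<in> bounded_ops \<alpha> H. \<forall>\<tau>\<in>sphere 0 1.
      compose H S (\<lambda>f\<in>H. \<lambda>z. f (inverse \<tau> * z)) = compose H (\<lambda>f\<in>H. \<lambda>z. f (inverse \<tau> * z)) S} =
    diagonal_ops \<alpha> H e"
proof (intro equalityI subsetI)
  fix S assume "S \<in> {S \<in> bounded_ops \<alpha> H. \<forall>\<tau>\<in>sphere 0 1.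
      compose H S (\<lambda>f\<in>H. \<lambda>z. f (inverse \<tau> * z)) = compose H (\<lambda>f\<in>H. \<lambda>z. f (inverse \<tau> * z)) S}"
  then have S: "S \<in> bounded_ops \<alpha> H"
    and comm: "\<And>\<tau>. cmod \<tau> = 1 \<Longrightarrow>
      compose H S (\<lambda>f\<in>H. \<lambda>z. f (inverse \<tau> * z)) = compose H (\<lambda>f\<in>H. \<lambda>z. f (inverse \<tau> * z)) S"
    by auto
  have "S (e p) = (\<lambda>z. coord (S (e p)) p * e p z)" for p
  proof (rule coord_inject)
    show Se: "S (e p) \<in> H" by (rule bounded_ops_mem[OF S e_mem])
    show "(\<lambda>z. coord (S (e p)) p * e p z) \<in> H" by (rule H_cmult[OF e_mem])
    fix q
    have "coord (S (e p)) q = 0" if neq: "q \<noteq> p"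
    proof -
      obtain \<tau> where \<tau>: "cmod \<tau> = 1" "\<omega> \<tau> q \<noteq> \<omega> \<tau> p"
        using character_separates[OF neq] by blast
      have "S (\<lambda>z. e p (inverse \<tau> * z)) = (\<lambda>z. S (e p) (inverse \<tau> * z))"
        using fun_cong[OF comm[OF \<tau>(1)], of "e p"] by (simp add: compose_eq e_mem Se)
      then have "(\<lambda>z. \<omega> \<tau> p * S (e p) z) = (\<lambda>z. S (e p) (inverse \<tau> * z))"
        by (simp only: e_rotation[OF \<tau>(1)] bounded_ops_cmult[OF S e_mem])
      then have "\<omega> \<tau> p * coord (S (e p)) q = \<omega> \<tau> q * coord (S (e p)) q"
        using coord_cmult coord_rotation[OF \<tau>(1) Se] by metis
      then show ?thesis using \<tau>(2) by simp
    qed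
    then show "coord (S (e p)) q = coord (\<lambda>z. coord (S (e p)) p * e p z) q"
      by (auto simp: coord_cmult coord_e)
  qed
  then show "S \<in> diagonal_ops \<alpha> H e"
    unfolding diagonal_ops_def using S by blast
next
  fix S assume S: "S \<in> diagonal_ops \<alpha> H e"
  note bd = diagonal_ops_bounded[OF S]
  have "compose H S (\<lambda>f\<in>H. \<lambda>z. f (inverse \<tau> * z)) = compose H (\<lambda>f\<in>H. \<lambda>z. f (inverse \<tau> * z)) S"
    if \<tau>: "cmod \<tau> = 1" for \<tau>
  proof (rule extensionalityI[OF compose_extensional compose_extensional])
    fix f assume f: "f \<in> H"
    have "S (\<lambda>z. f (inverse \<tau> * z)) = (\<lambda>z. S f (inverse \<tau> * z))"
      by (rule coord_inject)
         (simp_all only: bounded_ops_mem[OF bd] rotation_mem[OF \<tau>] f coord_diagonal_ops[OF S]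
            coord_rotation[OF \<tau>] mult.left_commute)
    then show "compose H S (\<lambda>f\<in>H. \<lambda>z. f (inverse \<tau> * z)) f = compose H (\<lambda>f\<in>H. \<lambda>z. f (inverse \<tau> * z)) S f"
      using f bounded_ops_mem[OF bd f] by (simp add: compose_eq)
  qed
  then show "S \<in> {S \<in> bounded_ops \<alpha> H. \<forall>\<tau>\<in>sphere 0 1.
      compose H S (\<lambda>f\<in>H. \<lambda>z. f (inverse \<tau> * z)) = compose H (\<lambda>f\<in>H. \<lambda>z. f (inverse \<tau> * z)) S}"
    using bd by simp
qed

end

section \<open>Rotations of disk polynomials\<close>

text \<open>All monomials of the disk polynomial have degree \<open>p - q\<close>. Two natural
  powers express the character without a negative exponent.\<close>

lemma disk_poly_rotation:
  assumes \<tau>: "cmod \<tau> = 1"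
  shows "disk_poly \<alpha> p q (inverse \<tau> * z) = inverse \<tau> ^ p * \<tau> ^ q * disk_poly \<alpha> p q z"
proof (cases "z \<in> disk")
  case True
  define w where "w = inverse \<tau>"
  have w: "cmod w = 1" "cnj w = \<tau>" "w * \<tau> = 1"
  proof -
    have "\<tau> * cnj \<tau> = 1"
      using \<tau> complex_norm_square[of \<tau>] by simp
    then have "w = cnj \<tau>"
      unfolding w_def by (rule inverse_unique)
    then show "cmod w = 1" "cnj w = \<tau>" "w * \<tau> = 1"
      using \<tau> \<open>\<tau> * cnj \<tau> = 1\<close> by (simp_all add: mult.commute)
  qed
  have wz: "w * z \<in> disk"
    using True w(1) by (simp add: norm_mult)
  obtain d where d: "\<And>z. z \<in> disk \<Longrightarrow> disk_poly \<alpha> p q z = (\<Sum>b\<le>q. d b * cmonom (p + b - q) b z)"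
    "\<And>b. p + b < q \<Longrightarrow> d b = 0"
    by (rule disk_poly_expansion[of \<alpha> p q]) (rule that, assumption+)
  have summand: "d b * cmonom (p + b - q) b (w * z) = w ^ p * \<tau> ^ q * (d b * cmonom (p + b - q) b z)" for b
  proof (cases "p + b < q")
    case False
    have "w ^ (p + b - q) * \<tau> ^ b = w ^ (p + b - q) * \<tau> ^ b * (w * \<tau>) ^ q"
      by (simp add: w)
    also have "\<dots> = w ^ (p + b - q + q) * \<tau> ^ b * \<tau> ^ q"
      by (simp add: power_mult_distrib power_add mult_ac)
    also have "\<dots> = w ^ p * \<tau> ^ q * (w * \<tau>) ^ b"
      using False by (simp add: power_mult_distrib power_add mult_ac)
    finally have "w ^ (p + b - q) * \<tau> ^ b = w ^ p * \<tau> ^ q"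
      by (simp add: w)
    moreover have "d b * cmonom (p + b - q) b (w * z) = w ^ (p + b - q) * \<tau> ^ b * (d b * cmonom (p + b - q) b z)"
      by (simp add: power_mult_distrib w mult_ac)
    ultimately show ?thesis by simp
  qed (simp add: d(2))
  then show ?thesis
    unfolding w_def[symmetric] d(1)[OF True] d(1)[OF wz] sum_distrib_left
    by (intro sum.cong refl summand)
next
  case False
  then show ?thesis
    using \<tau> by (simp add: disk_poly_def norm_mult norm_inverse)
qed

lemma character_separation:
  assumes "p \<noteq> (p'::nat)"
  shows "\<exists>\<tau>. cmod \<tau> = 1 \<and> inverse \<tau> ^ p * \<tau> ^ q \<noteq> inverse \<tau> ^ p' * \<tau> ^ q"
proof -
  have *: "\<exists>\<tau>. cmod \<tau> = 1 \<and> inverse \<tau> ^ p * \<tau> ^ q \<noteq> inverse \<tau> ^ p' * \<tau> ^ q" if "p < p'" for p p' :: nat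
  proof -
    \<comment> \<open>A rotation that acts as \<open>-1\<close> in the degree difference
      \<open>p' - p\<close>.\<close>
    define \<tau> where "\<tau> = cis (pi / (p' - p))"
    have "\<tau> ^ (p' - p) = -1"
      using that by (simp add: \<tau>_def Complex.DeMoivre of_nat_diff)
    then have "\<tau> ^ p' \<noteq> \<tau> ^ p"
      using that power_diff[of \<tau> p p'] by (auto simp: \<tau>_def)
    moreover have "\<tau> \<noteq> 0"
      by (simp add: \<tau>_def)
    ultimately have "inverse \<tau> ^ p * \<tau> ^ q \<noteq> inverse \<tau> ^ p' * \<tau> ^ q"
      by (simp add: power_inverse)
    then show ?thesis
      by (intro exI[of _ \<tau>]) (simp add: \<tau>_def)
  qed
  show ?thesis
    using *[of p p'] *[of p' p] assms by (metis nat_neq_iff)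
qed

lemma true_poly_Bergman_rotation_coordinate_space:
  assumes \<alpha>: "\<alpha> > -1"
  shows "rotation_coordinate_space \<alpha> (true_poly_Bergman (Suc q) \<alpha>) (\<lambda>p. disk_poly \<alpha> p q)
    (\<lambda>\<tau> p. inverse \<tau> ^ p * \<tau> ^ q)"
proof
  let ?H = "true_poly_Bergman (Suc q) \<alpha>"
  have H: "f \<in> ?H \<longleftrightarrow> polyanalytic (Suc q) f \<and> f \<in> L2 \<alpha> \<and> (\<forall>z. z \<notin> disk \<longrightarrow> f z = 0) \<and>
      (\<forall>g\<in>poly_Bergman q \<alpha>. L2_inner \<alpha> f g = 0)" for f
    by (auto simp: true_poly_Bergman_def poly_Bergman_iff)
  show "f \<in> L2 \<alpha>" if "f \<in> ?H" for f
    using that H by blast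
  show "(\<lambda>z. f z + g z) \<in> ?H" if "f \<in> ?H" "g \<in> ?H" for f g
    using that unfolding H
    by (auto simp: polyanalytic_add L2_add L2_inner_add_left poly_Bergman_iff)
  show "(\<lambda>z. c * f z) \<in> ?H" if f: "f \<in> ?H" for f c
  proof -
    obtain h where h: "\<forall>k<Suc q. h k holomorphic_on disk" "\<forall>z\<in>disk. f z = (\<Sum>k<Suc q. cnj z ^ k * h k z)"
      using f polyanalytic_decomposition unfolding H by blast
    have "polyanalytic (Suc q) (\<lambda>z. c * f z)"
      unfolding polyanalytic_iff
      by (rule exI[of _ "\<lambda>k z. c * h k z"])
         (use h in \<open>auto intro!: holomorphic_intros simp: sum_distrib_left distrib_left mult_ac\<close>)
    then show ?thesis
      using f unfolding H by (auto simp: L2_cmult L2_inner_cmult_left)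
  qed
  show "disk_poly \<alpha> p q \<in> ?H" for p
    by (rule disk_poly_mem_true_poly_Bergman[OF \<alpha>])
  show "L2_inner \<alpha> (disk_poly \<alpha> p q) (disk_poly \<alpha> p' q) = (if p = p' then 1 else 0)" for p p'
    by (rule disk_poly_orthonormal[OF \<alpha>])
  show "(\<lambda>p. L2_inner \<alpha> f (disk_poly \<alpha> p q) * disk_poly \<alpha> p q z) sums f z" if f: "f \<in> ?H" for f z
  proof (cases "z \<in> disk")
    case False
    then show ?thesis using f unfolding H by (simp add: disk_poly_def)
  qed (rule true_poly_Bergman_expansion[OF \<alpha> f])
  show "\<exists>F\<in>?H. \<forall>z. (\<lambda>p. c p * disk_poly \<alpha> p q z) sums F z" if c: "summable (\<lambda>p. (cmod (c p))\<^sup>2)" for c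
    by (rule true_poly_Bergman_synthesis[OF \<alpha> c, where q = q]) blast
  show "disk_poly \<alpha> p q (inverse \<tau> * z) = inverse \<tau> ^ p * \<tau> ^ q * disk_poly \<alpha> p q z" if "cmod \<tau> = 1" for \<tau> p z
    by (rule disk_poly_rotation[OF that])
  show "cmod (inverse \<tau> ^ p * \<tau> ^ q) = 1" if "cmod \<tau> = 1" for \<tau> p
    using that by (simp add: norm_mult norm_power norm_inverse)
  show "\<exists>\<tau>. cmod \<tau> = 1 \<and> inverse \<tau> ^ p * \<tau> ^ q \<noteq> inverse \<tau> ^ p' * \<tau> ^ q" if "p \<noteq> p'" for p p'
    by (rule character_separation[OF that])
qed

theorem theorem7p10:
  fixes n :: nat and \<alpha> :: real
  assumes "n \<ge> 1" and "\<alpha> > -1"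
  shows "orthonormal_basis \<alpha> (true_poly_Bergman n \<alpha>) (\<lambda>p. disk_poly \<alpha> p (n - 1)) \<and>
    radial_ops n \<alpha> =
      diagonal_ops \<alpha> (true_poly_Bergman n \<alpha>) (\<lambda>p. disk_poly \<alpha> p (n - 1)) \<and>
    wstar_isomorphic
      (operator_algebra \<alpha> (true_poly_Bergman n \<alpha>) (radial_ops n \<alpha>)) l_infinity"
proof -
  obtain q where n: "n = Suc q"
    using assms(1) by (cases n) auto
  interpret rotation_coordinate_space \<alpha> "true_poly_Bergman n \<alpha>" "\<lambda>p. disk_poly \<alpha> p (n - 1)"
      "\<lambda>\<tau> p. inverse \<tau> ^ p * \<tau> ^ q"
    unfolding n diff_Suc_1 by (rule true_poly_Bergman_rotation_coordinate_space[OF assms(2)])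
  have radial: "radial_ops n \<alpha> = diagonal_ops \<alpha> (true_poly_Bergman n \<alpha>) (\<lambda>p. disk_poly \<alpha> p (n - 1))"
    unfolding radial_ops_def rotation_def by (rule commuting_with_rotations_iff_diagonal)
  then show ?thesis
    using orthonormal_basis diagonal_ops_isomorphic_l_infinity by simp
qed

end
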